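(* Consider the network Poisson model with $\mu=0$ and $\beta_n=0$, with true parameter $(\boldsymbol{\theta}^*,\boldsymbol{\gamma}^* )$ (all of which may depend on $n$), and let $\rho_n$ and $\kappa_n$ be as defined in the context. If $$\kappa_n^2 e^{40\rho_n}=o\left(\frac{n}{\log n}\right)\quad (n\to\infty),$$ then the maximum likelihood estimator $(\widehat{\boldsymbol{\theta}},\widehat{\boldsymbol{\gamma}})$ exists with probability at least $1-O(1/n)$, and is consistent in the sense that, as $n\to\infty$, $$\|\widehat{\boldsymbol{\gamma}}-\boldsymbol{\gamma}^*\|_\infty=O_p\left(\frac{\kappa_n e^{21\rho_n}\log n}{n}\right)=o_p(1),\qquad \|\widehat{\boldsymbol{\theta}}-\boldsymbol{\theta}^*\|_\infty=O_p\left(e^{7\rho_n}\sqrt{\frac{\log n}{n}}\right)=o_p(1).$$ Further, if $\widehat{\boldsymbol{\theta}}$ exists, it is unique.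
   Context: Network Poisson model. For each $n\ge 2$ there are nodes $1,\dots,n$ and a random weight matrix $A=(a_{ij})$ with $a_{ii}=0$ and, for $i\ne j$, $a_{ij}\in\{0,1,2,\dots\}$ independent Poisson random variables with mean $\lambda_{ij}(\boldsymbol{\theta}^*,\boldsymbol{\gamma}^* )$, where $$\lambda_{ij}(\boldsymbol{\theta},\boldsymbol{\gamma})=e^{\alpha_i+\beta_j+Z_{ij}^\top\boldsymbol{\gamma}},\quad \boldsymbol{\theta}=(\alpha_1,\dots,\alpha_n,\beta_1,\dots,\beta_{n-1})^\top\in\mathbb{R}^{2n-1},\quad \beta_n=0,\quad \boldsymbol{\gamma}\in\mathbb{R}^p.$$ (The general model has an extra additive parameter $\mu$ in the exponent, which is set to $0$ along with $\beta_n=0$ for identifiability.) The superscript $*$ denotes true values. The covariates $Z_{ij}\in\mathbb{R}^p$ are treated as given; $p$ is fixed and $Z_{ij}\in\mathcal{Z}^p$ for a fixed compact set $\mathcal{Z}\subset\mathbb{R}$; $q:=\max_{i,j}\|Z_{ij}\|_\infty$ is a constant. Degrees: $d_i=\sum_{j\ne i}a_{ij}$, $b_j=\sum_{i\neq j}a_{ij}$. Score functions: $F_i(\boldsymbol{\theta},\boldsymbol{\gamma})=\sum_{j\ne i}\lambda_{ij}(\boldsymbol{\theta},\boldsymbol{\gamma})-d_i$ for $i=1,\dots,n$; $F_{n+j}(\boldsymbol{\theta},\boldsymbol{\gamma})=\sum_{i\ne j}\lambda_{ij}(\boldsymbol{\theta},\boldsymbol{\gamma})-b_j$ for $j=1,\dots,n-1$;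 $F=(F_1,\dots,F_{2n-1})^\top$; and $Q(\boldsymbol{\theta},\boldsymbol{\gamma})=\sum_{i\ne j}Z_{ij}(\lambda_{ij}(\boldsymbol{\theta},\boldsymbol{\gamma})-a_{ij})\in\mathbb{R}^p$. The maximum likelihood estimator (MLE) $(\widehat{\boldsymbol{\theta}},\widehat{\boldsymbol{\gamma}})$ is the solution of $F(\boldsymbol{\theta},\boldsymbol{\gamma})=0$, $Q(\boldsymbol{\theta},\boldsymbol{\gamma})=0$, if it exists. Let $B(\mathbf{x},\epsilon)=\{\mathbf{y}:\|\mathbf{x}-\mathbf{y}\|_\infty\le\epsilon\}$. Let $\epsilon_{n1},\epsilon_{n2}>0$ be small positive numbers, and set $$\rho_n:=\max_{i\ne j}|\alpha_i^*+\beta_j^*|+2\epsilon_{n1}+pq\|\boldsymbol{\gamma}^*\|_\infty+pq\,\epsilon_{n2}.$$ Define $$H(\boldsymbol{\theta},\boldsymbol{\gamma})=\frac{\partial Q}{\partial\boldsymbol{\gamma}^\top}-\frac{\partial Q}{\partial\boldsymbol{\theta}^\top}\left[\frac{\partial F}{\partial\boldsymbol{\theta}^\top}\right]^{-1}\frac{\partial F}{\partial\boldsymbol{\gamma}^\top}$$ (all evaluated at $(\boldsymbol{\theta},\boldsymbol{\gamma})$). It is assumed that $H$ is positive definite and that $\kappa_n$ is a number such that $$\sup_{\boldsymbol{\theta}\in B(\boldsymbol{\theta}^*,\epsilon_{n1})}\|H^{-1}(\boldsymbol{\theta},\boldsymbol{\gamma}^* )\|_\infty\le\frac{\kappa_n}{n^2},$$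 where $\|\cdot\|_\infty$ of a matrix is the maximum absolute row sum. *)

theory Defs
  imports
    "HOL-Probability.Probability"
    "Jordan_Normal_Form.Gauss_Jordan_Elimination"
begin

no_notation Finite_Cartesian_Product.vec_nth (infixl "$" 90)
no_notation Inner_Product.real_inner_class.inner (infix "\<bullet>" 70)
hide_type (open) Finite_Cartesian_Product.vec
hide_const (open) Finite_Cartesian_Product.vec

section \<open>Vectors and matrices whose dimension depends on the number of nodes\<close>

text \<open>The maximum norm of a vector and the maximum absolute row sum of a matrix are meant for
  nonempty index sets only; every vector and matrix below has positive dimension.\<close>

definition vec_maxnorm :: "real vec \<Rightarrow> real" where
  "vec_maxnorm v = Max ((\<lambda>k. \<bar>v $ k\<bar>) ` {..<dim_vec v})"

definition mat_maxnorm :: "real mat \<Rightarrow> real" where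
  "mat_maxnorm A = Max ((\<lambda>r. \<Sum>c<dim_col A. \<bar>A $$ (r, c)\<bar>) ` {..<dim_row A})"

definition maxnorm_ball :: "real vec \<Rightarrow> real \<Rightarrow> real vec set" where
  "maxnorm_ball x e = {y \<in> carrier_vec (dim_vec x). vec_maxnorm (x - y) \<le> e}"

definition pos_def_mat :: "real mat \<Rightarrow> bool" where
  "pos_def_mat A \<longleftrightarrow> square_mat A \<and> transpose_mat A = A \<and>
     (\<forall>x \<in> carrier_vec (dim_row A). x \<noteq> 0\<^sub>v (dim_row A) \<longrightarrow> x \<bullet> (A *\<^sub>v x) > 0)"

text \<open>The matrix inverse, unspecified for singular arguments.\<close>

definition mat_inv :: "real mat \<Rightarrow> real mat" where
  "mat_inv A = the (mat_inverse A)"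

text \<open>Matrix of partial derivatives of a map with \<open>m\<close> real components; entry \<open>(r, c)\<close> is
  the derivative of the \<open>r\<close>-th component in the \<open>c\<close>-th coordinate.\<close>

definition jacobian :: "nat \<Rightarrow> (real vec \<Rightarrow> real vec) \<Rightarrow> real vec \<Rightarrow> real mat" where
  "jacobian m f x = mat m (dim_vec x)
     (\<lambda>(r, c). deriv (\<lambda>t. f (x |\<^sub>v c \<mapsto> t) $ r) (x $ c))"

section \<open>The network Poisson model\<close>

text \<open>Nodes are numbered \<open>0, \<dots>, n - 1\<close>.  The vector \<open>\<theta>\<close> of length \<open>2 * n - 1\<close> lists the
  out-parameters of all \<open>n\<close> nodes, followed by the in-parameters of all nodes except the last,
  whose in-parameter is fixed to \<open>0\<close>.  \<open>Z i j\<close> is the covariate vector of the ordered pair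
  \<open>(i, j)\<close> and \<open>A i j\<close> its weight.\<close>

definition out_par :: "real vec \<Rightarrow> nat \<Rightarrow> real" where
  "out_par \<theta> i = \<theta> $ i"

definition in_par :: "nat \<Rightarrow> real vec \<Rightarrow> nat \<Rightarrow> real" where
  "in_par n \<theta> j = (if j < n - 1 then \<theta> $ (n + j) else 0)"

definition pmean :: "nat \<Rightarrow> (nat \<Rightarrow> nat \<Rightarrow> real vec) \<Rightarrow> real vec \<Rightarrow> real vec \<Rightarrow> nat \<Rightarrow> nat \<Rightarrow> real" where
  "pmean n Z \<theta> \<gamma> i j = exp (out_par \<theta> i + in_par n \<theta> j + Z i j \<bullet> \<gamma>)"

definition out_degree :: "nat \<Rightarrow> (nat \<Rightarrow> nat \<Rightarrow> nat) \<Rightarrow> nat \<Rightarrow> nat" where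
  "out_degree n A i = (\<Sum>j\<in>{..<n} - {i}. A i j)"

definition in_degree :: "nat \<Rightarrow> (nat \<Rightarrow> nat \<Rightarrow> nat) \<Rightarrow> nat \<Rightarrow> nat" where
  "in_degree n A j = (\<Sum>i\<in>{..<n} - {j}. A i j)"

definition score_F ::
  "nat \<Rightarrow> (nat \<Rightarrow> nat \<Rightarrow> real vec) \<Rightarrow> (nat \<Rightarrow> nat \<Rightarrow> nat) \<Rightarrow> real vec \<Rightarrow> real vec \<Rightarrow> real vec" where
  "score_F n Z A \<theta> \<gamma> = vec (2 * n - 1) (\<lambda>r.
     if r < n then (\<Sum>j\<in>{..<n} - {r}. pmean n Z \<theta> \<gamma> r j) - real (out_degree n A r)
     else (\<Sum>i\<in>{..<n} - {r - n}. pmean n Z \<theta> \<gamma> i (r - n)) - real (in_degree n A (r - n)))"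

definition score_Q ::
  "nat \<Rightarrow> nat \<Rightarrow> (nat \<Rightarrow> nat \<Rightarrow> real vec) \<Rightarrow> (nat \<Rightarrow> nat \<Rightarrow> nat) \<Rightarrow> real vec \<Rightarrow> real vec \<Rightarrow> real vec" where
  "score_Q n p Z A \<theta> \<gamma> = vec p (\<lambda>k.
     \<Sum>i<n. \<Sum>j\<in>{..<n} - {i}. Z i j $ k * (pmean n Z \<theta> \<gamma> i j - real (A i j)))"

definition is_mle ::
  "nat \<Rightarrow> nat \<Rightarrow> (nat \<Rightarrow> nat \<Rightarrow> real vec) \<Rightarrow> (nat \<Rightarrow> nat \<Rightarrow> nat) \<Rightarrow> real vec \<Rightarrow> real vec \<Rightarrow> bool" where
  "is_mle n p Z A \<theta> \<gamma> \<longleftrightarrow> \<theta> \<in> carrier_vec (2 * n - 1) \<and> \<gamma> \<in> carrier_vec p \<and>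
     score_F n Z A \<theta> \<gamma> = 0\<^sub>v (2 * n - 1) \<and> score_Q n p Z A \<theta> \<gamma> = 0\<^sub>v p"

text \<open>The estimator is a solution of the score equations whenever there is one, and a fixed but
  unspecified pair otherwise.\<close>

definition mle ::
  "nat \<Rightarrow> nat \<Rightarrow> (nat \<Rightarrow> nat \<Rightarrow> real vec) \<Rightarrow> (nat \<Rightarrow> nat \<Rightarrow> nat) \<Rightarrow> real vec \<times> real vec" where
  "mle n p Z A = (SOME (\<theta>, \<gamma>). is_mle n p Z A \<theta> \<gamma>)"

definition mle_theta where "mle_theta n p Z A = fst (mle n p Z A)"
definition mle_gamma where "mle_gamma n p Z A = snd (mle n p Z A)"

text \<open>The Schur complement of the Jacobian of \<open>(F, Q)\<close>.  The data \<open>A\<close> enter \<open>F\<close> and \<open>Q\<close> only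
  additively, so they do not affect its value.  It involves the inverse of the Jacobian of \<open>F\<close> in
  \<open>\<theta>\<close>, which is singular for \<open>n = 2\<close>; hypotheses on it are only meaningful for larger \<open>n\<close>.\<close>

definition info_H ::
  "nat \<Rightarrow> nat \<Rightarrow> (nat \<Rightarrow> nat \<Rightarrow> real vec) \<Rightarrow> (nat \<Rightarrow> nat \<Rightarrow> nat) \<Rightarrow> real vec \<Rightarrow> real vec \<Rightarrow> real mat" where
  "info_H n p Z A \<theta> \<gamma> =
     jacobian p (\<lambda>\<gamma>'. score_Q n p Z A \<theta> \<gamma>') \<gamma>
     - jacobian p (\<lambda>\<theta>'. score_Q n p Z A \<theta>' \<gamma>) \<theta>
       * mat_inv (jacobian (2 * n - 1) (\<lambda>\<theta>'. score_F n Z A \<theta>' \<gamma>) \<theta>)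
       * jacobian (2 * n - 1) (\<lambda>\<gamma>'. score_F n Z A \<theta> \<gamma>') \<gamma>"

text \<open>Only ordered pairs of distinct nodes carry covariates.\<close>

definition cov_bound :: "nat \<Rightarrow> (nat \<Rightarrow> nat \<Rightarrow> real vec) \<Rightarrow> real" where
  "cov_bound n Z = Max {vec_maxnorm (Z i j) | i j. i < n \<and> j < n \<and> i \<noteq> j}"

definition rho ::
  "nat \<Rightarrow> nat \<Rightarrow> (nat \<Rightarrow> nat \<Rightarrow> real vec) \<Rightarrow> real vec \<Rightarrow> real vec \<Rightarrow> real \<Rightarrow> real \<Rightarrow> real" where
  "rho n p Z \<theta> \<gamma> e1 e2 =
     Max {\<bar>out_par \<theta> i + in_par n \<theta> j\<bar> | i j. i < n \<and> j < n \<and> i \<noteq> j} + 2 * e1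
     + real p * cov_bound n Z * vec_maxnorm \<gamma> + real p * cov_bound n Z * e2"

definition poisson_network ::
  "nat \<Rightarrow> (nat \<Rightarrow> nat \<Rightarrow> real vec) \<Rightarrow> real vec \<Rightarrow> real vec \<Rightarrow> 'w measure
    \<Rightarrow> (nat \<Rightarrow> nat \<Rightarrow> 'w \<Rightarrow> nat) \<Rightarrow> bool" where
  "poisson_network n Z \<theta> \<gamma> M a \<longleftrightarrow> prob_space M \<and>
     (\<forall>i<n. \<forall>\<omega>\<in>space M. a i i \<omega> = 0) \<and>
     prob_space.indep_vars M (\<lambda>_. count_space UNIV) (\<lambda>(i, j). a i j)
       {(i, j). i < n \<and> j < n \<and> i \<noteq> j} \<and>
     (\<forall>i<n. \<forall>j<n. i \<noteq> j \<longrightarrow>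
        distr M (count_space UNIV) (a i j) = measure_pmf (poisson_pmf (pmean n Z \<theta> \<gamma> i j)))"

section \<open>Stochastic order symbols\<close>

text \<open>The probability space may change with \<open>n\<close>.  Measurability is part of the notions, since the
  measure of a nonmeasurable set is \<open>0\<close> by convention.\<close>

definition bigO_prob :: "(nat \<Rightarrow> 'w measure) \<Rightarrow> (nat \<Rightarrow> 'w \<Rightarrow> real) \<Rightarrow> (nat \<Rightarrow> real) \<Rightarrow> bool" where
  "bigO_prob M X r \<longleftrightarrow> (\<forall>\<^sub>F n in sequentially. X n \<in> borel_measurable (M n)) \<and>
     (\<forall>e>0. \<exists>C>0. \<forall>\<^sub>F n in sequentially.
        measure (M n) {\<omega> \<in> space (M n). \<bar>X n \<omega>\<bar> > C * \<bar>r n\<bar>} \<le> e)"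

definition smallo_prob :: "(nat \<Rightarrow> 'w measure) \<Rightarrow> (nat \<Rightarrow> 'w \<Rightarrow> real) \<Rightarrow> (nat \<Rightarrow> real) \<Rightarrow> bool" where
  "smallo_prob M X r \<longleftrightarrow> (\<forall>\<^sub>F n in sequentially. X n \<in> borel_measurable (M n)) \<and>
     (\<forall>c>0. (\<lambda>n. measure (M n) {\<omega> \<in> space (M n). \<bar>X n \<omega>\<bar> > c * \<bar>r n\<bar>}) \<longlonglongrightarrow> 0)"

end

theory Submission
  imports Defs "Jordan_Normal_Form.Determinant"
begin

text \<open>Write \<open>e = (i, j)\<close> for an ordered pair of distinct nodes, \<open>l e\<close> for its true intensity and
\<open>w e\<close> for its weight minus \<open>l e\<close>.  The model is a Poisson regression over these pairs whose log
intensity is linear in \<open>(\<theta>, \<gamma>)\<close>: a node effect \<open>\<alpha>\<^sub>i + \<beta>\<^sub>j\<close> plus a combination of the covariates.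

\<^emph>\<open>Uniqueness.\<close>  Let \<open>y e\<close> be the change of the log intensity between two solutions.  Subtracting the
two systems of score equations and pairing with the difference of the solutions gives
\<open>\<Sum> l e * y e * (exp (y e) - 1) = 0\<close>, a sum of nonnegative terms, so \<open>y\<close> vanishes on every pair.
Then \<open>H\<close> annihilates the difference of the two values of \<open>\<gamma>\<close>, which is therefore \<open>0\<close>, and node
effects that vanish on all pairs belong to \<open>\<theta> = 0\<close> when there are at least three nodes
(\<open>is_mle_unique\<close>).

\<^emph>\<open>Existence and rates.\<close>  Let \<open>x e\<close> be the change of the log intensity relative to the truth.  The score
equations say that \<open>l e * x e - h e\<close> is orthogonal to all regressors, where
\<open>h e = w e - l e * (exp (x e) - 1 - x e)\<close>.  Solving these linear equations for a given \<open>h\<close> turns the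
score equations into a fixed point equation for \<open>x\<close>, and the map is a contraction in the maximum norm
on a small box (\<open>score_solution\<close>).  Everything rests on two bounds for the linear equations, where
\<open>E = exp \<rho>\<close> bounds the intensities and their inverses.

  \<^item> The part of the node parameters is a discrete Laplace equation on a nearly complete bipartite graph.
    A maximum principle bounds the node effects by \<open>E^3 / n\<close> times the largest row or column sum of
    \<open>h\<close>, up to a constant (\<open>potential_spread\<close>).

  \<^item> Subtracting from each covariate its weighted projection onto the node effects decouples \<open>\<gamma>\<close>
    from \<open>\<theta>\<close> and turns the Gram matrix into \<open>H\<close> (\<open>info_H_residual\<close>).  So \<open>\<gamma>\<close> is bounded by
    \<open>\<kappa> / n^2\<close> times the sums of \<open>h\<close> against the residualised covariates, and these covariates are
    of order \<open>E^4\<close> by the first bound (\<open>zt_bound\<close>).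

Put \<open>\<eta> = sqrt (ln n / n)\<close>.  A Chernoff bound for weighted Poisson sums shows that, outside an event of
probability \<open>O(1/n)\<close>, the row and column sums of \<open>w\<close> are at most \<open>3 E n \<eta>\<close>, while each sum of \<open>w\<close> against
a residualised covariate is of order \<open>E^5 n sqrt (ln n)\<close>, hence at most of order \<open>E^5 n^2 \<eta>^2\<close>
(\<open>poisson_tail\<close>).  The box can then have radius \<open>54 E^4 \<eta>\<close>, the remainder of the exponential is
quadratic in it, and the error of \<open>\<gamma>\<close> comes out as \<open>O(\<kappa> E^13 \<eta>^2)\<close> and that of \<open>\<theta>\<close> as
\<open>O(E^4 \<eta>)\<close> (\<open>mle_exists_near_truth\<close>).  The fixed point argument needs \<open>E^8 \<eta>\<close> and \<open>\<kappa> E^13 \<eta>\<close> to be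
small.  The rate hypothesis says precisely that \<open>\<kappa> E^20 \<eta>\<close> tends to \<open>0\<close>; as the inverse of \<open>H\<close>
cannot be smaller than the size of \<open>H\<close> permits, \<open>\<kappa> E^5\<close> is bounded below, so \<open>E^15 \<eta>\<close> tends to
\<open>0\<close> as well (\<open>rate_consequences\<close>).\<close>

section \<open>The model as a regression over ordered pairs of nodes\<close>

definition pairs :: "nat \<Rightarrow> (nat \<times> nat) set" where
  "pairs n = {(i, j). i < n \<and> j < n \<and> i \<noteq> j}"

text \<open>The derivative of the log intensity of the pair \<open>e\<close> in the \<open>r\<close>-th coordinate of \<open>\<theta>\<close>.\<close>

definition incidence :: "nat \<Rightarrow> nat \<Rightarrow> nat \<times> nat \<Rightarrow> real" where
  "incidence n r e = (if r < n then of_bool (fst e = r) else of_bool (snd e = r - n))"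

text \<open>Parameters are plain functions here, of which only the values below \<open>2 * n - 1\<close> matter.  This makes
sums and differences of parameters independent of vector dimensions.\<close>

definition node_effect :: "nat \<Rightarrow> (nat \<Rightarrow> real) \<Rightarrow> nat \<times> nat \<Rightarrow> real" where
  "node_effect n x e = (\<Sum>r<2 * n - 1. x r * incidence n r e)"

definition intensity :: "nat \<Rightarrow> (nat \<Rightarrow> nat \<Rightarrow> real vec) \<Rightarrow> real vec \<Rightarrow> real vec \<Rightarrow> nat \<times> nat \<Rightarrow> real" where
  "intensity n Z \<theta> \<gamma> e = pmean n Z \<theta> \<gamma> (fst e) (snd e)"

definition covariate :: "(nat \<Rightarrow> nat \<Rightarrow> real vec) \<Rightarrow> nat \<Rightarrow> nat \<times> nat \<Rightarrow> real" where
  "covariate Z k e = Z (fst e) (snd e) $ k"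

definition weight :: "(nat \<Rightarrow> nat \<Rightarrow> nat) \<Rightarrow> nat \<times> nat \<Rightarrow> real" where
  "weight A e = real (A (fst e) (snd e))"

lemma finite_pairs [simp, intro]: "finite (pairs n)"
  by (rule finite_subset[of _ "{..<n} \<times> {..<n}"]) (auto simp: pairs_def)

lemma sum_pairs: "(\<Sum>e\<in>pairs n. f e) = (\<Sum>i<n. \<Sum>j\<in>{..<n} - {i}. f (i, j))"
proof -
  have "pairs n = (SIGMA i:{..<n}. {..<n} - {i})" by (auto simp: pairs_def)
  then show ?thesis by (simp add: sum.Sigma)
qed

lemma sum_pairs_fst:
  assumes "i < n"
  shows "(\<Sum>e\<in>pairs n. of_bool (fst e = i) * f e) = (\<Sum>j\<in>{..<n} - {i}. f (i, j) :: real)"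
proof -
  have "(\<Sum>e\<in>pairs n. of_bool (fst e = i) * f e) = (\<Sum>e\<in>pairs n. if fst e = i then f e else 0)"
    by (intro sum.cong) auto
  also have "\<dots> = (\<Sum>e\<in>{e \<in> pairs n. fst e = i}. f e)"
    by (simp only: sum.inter_filter[OF finite_pairs])
  also have "\<dots> = (\<Sum>j\<in>{..<n} - {i}. f (i, j))"
    using assms by (intro sum.reindex_bij_witness[of _ "\<lambda>j. (i, j)" snd]) (auto simp: pairs_def)
  finally show ?thesis .
qed

lemma sum_pairs_snd:
  assumes "j < n"
  shows "(\<Sum>e\<in>pairs n. of_bool (snd e = j) * f e) = (\<Sum>i\<in>{..<n} - {j}. f (i, j) :: real)"
proof -
  have "(\<Sum>e\<in>pairs n. of_bool (snd e = j) * f e) = (\<Sum>e\<in>pairs n. if snd e = j then f e else 0)"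
    by (intro sum.cong) auto
  also have "\<dots> = (\<Sum>e\<in>{e \<in> pairs n. snd e = j}. f e)"
    by (simp only: sum.inter_filter[OF finite_pairs])
  also have "\<dots> = (\<Sum>i\<in>{..<n} - {j}. f (i, j))"
    using assms by (intro sum.reindex_bij_witness[of _ "\<lambda>i. (i, j)" fst]) (auto simp: pairs_def)
  finally show ?thesis .
qed

text \<open>Summing against an incidence function produces the row sums, and for the later coordinates the column
sums, of a function on pairs.\<close>

lemma sum_incidence_row:
  assumes "i < n"
  shows "(\<Sum>e\<in>pairs n. incidence n i e * f e) = (\<Sum>j\<in>{..<n} - {i}. f (i, j))"
  unfolding sum_pairs_fst[OF assms, symmetric] using assms by (simp only: incidence_def if_True)

lemma sum_incidence_col:
  assumes "j < n"
  shows "(\<Sum>e\<in>pairs n. incidence n (n + j) e * f e) = (\<Sum>i\<in>{..<n} - {j}. f (i, j))"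
  unfolding sum_pairs_snd[OF assms, symmetric] by (simp add: incidence_def del: of_bool_eq)

lemma node_effect_pair:
  assumes "i < n" "j < n"
  shows "node_effect n x (i, j) = x i + (if j < n - 1 then x (n + j) else 0)"
proof -
  have "node_effect n x (i, j) = (\<Sum>r<2 * n - 1. (if r = i then x i else 0) + (if r = n + j then x (n + j) else 0))"
    unfolding node_effect_def using assms by (intro sum.cong refl) (auto simp: incidence_def)
  also have "\<dots> = x i + (if j < n - 1 then x (n + j) else 0)"
    using assms by (auto simp: sum.distrib)
  finally show ?thesis .
qed

lemma node_effect_add: "node_effect n (\<lambda>r. x r + y r) e = node_effect n x e + node_effect n y e"
  by (simp add: node_effect_def sum.distrib algebra_simps)

lemma node_effect_diff: "node_effect n (\<lambda>r. x r - y r) e = node_effect n x e - node_effect n y e"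
  by (simp add: node_effect_def sum_subtractf algebra_simps)

lemma node_effect_scale: "node_effect n (\<lambda>r. c * x r) e = c * node_effect n x e"
  by (simp add: node_effect_def sum_distrib_left mult.assoc)

lemma node_effect_sum: "node_effect n (\<lambda>r. \<Sum>k\<in>S. x k r) e = (\<Sum>k\<in>S. node_effect n (x k) e)"
  unfolding node_effect_def sum_distrib_right by (rule sum.swap)

text \<open>The in-parameter of the last node is \<open>0\<close>, so the pairs \<open>(i, n - 1)\<close> bound the out-parameters of the
other nodes.  A third node then bounds each in-parameter, and the out-parameter of the last node comes
last: one further triangle inequality at each stage.\<close>

lemma node_effect_coord_bound:
  assumes n: "n \<ge> 3" and t: "\<And>e. e \<in> pairs n \<Longrightarrow> \<bar>node_effect n x e\<bar> \<le> t" and r: "r < 2 * n - 1"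
  shows "\<bar>x r\<bar> \<le> 3 * t"
proof -
  define b where "b j = (if j < n - 1 then x (n + j) else 0)" for j
  have s: "\<bar>x i + b j\<bar> \<le> t" if "i < n" "j < n" "i \<noteq> j" for i j
    using t[of "(i, j)"] that by (simp add: pairs_def node_effect_pair b_def)
  have bn: "b (n - 1) = 0" by (simp add: b_def)
  have t0: "t \<ge> 0" using s[of 0 1] n by auto
  have a: "\<bar>x i\<bar> \<le> t" if "i < n - 1" for i
    using s[of i "n - 1"] that bn n by auto
  have b: "\<bar>b j\<bar> \<le> 2 * t" if j: "j < n" for j
  proof -
    obtain i where "i < n - 1" "i \<noteq> j"
    proof (cases "j = 0")
      case True then show ?thesis using that[of 1] n by auto
    next
      case False then show ?thesis using that[of 0] n by auto
    qed
    moreover have "i < n" using \<open>i < n - 1\<close> by simp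
    ultimately show ?thesis using s[of i j] a[of i] j by linarith
  qed
  have an: "\<bar>x (n - 1)\<bar> \<le> 3 * t" using s[of "n - 1" 0] b[of 0] n by auto
  show ?thesis
  proof (cases "r < n")
    case True
    then have "r = n - 1 \<or> r < n - 1" by linarith
    then show ?thesis using a[of r] an t0 by auto
  next
    case False
    then have "r - n < n - 1" "n + (r - n) = r" "r - n < n" using r by auto
    then show ?thesis using b[of "r - n"] t0 by (simp add: b_def)
  qed
qed

lemma node_effect_eq_0:
  assumes "n \<ge> 3" "\<And>e. e \<in> pairs n \<Longrightarrow> node_effect n x e = 0" "r < 2 * n - 1"
  shows "x r = 0"
  using node_effect_coord_bound[of n x 0 r] assms by simp

lemma node_effect_update:
  assumes "c < 2 * n - 1" "dim_vec \<theta> = 2 * n - 1"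
  shows "node_effect n (\<lambda>r. (\<theta> |\<^sub>v c \<mapsto> t) $ r) e = node_effect n (\<lambda>r. \<theta> $ r) e + (t - \<theta> $ c) * incidence n c e"
proof -
  have "node_effect n (\<lambda>r. (\<theta> |\<^sub>v c \<mapsto> t) $ r) e
      = (\<Sum>r<2 * n - 1. \<theta> $ r * incidence n r e + (if r = c then (t - \<theta> $ c) * incidence n c e else 0))"
    unfolding node_effect_def using assms by (intro sum.cong refl) (auto simp: algebra_simps)
  also have "\<dots> = node_effect n (\<lambda>r. \<theta> $ r) e + (t - \<theta> $ c) * incidence n c e"
    using assms by (simp add: sum.distrib node_effect_def)
  finally show ?thesis .
qed

lemma intensity_exp:
  assumes e: "e \<in> pairs n" and Z: "dim_vec \<gamma> = p"
  shows "intensity n Z \<theta> \<gamma> e = exp (node_effect n (\<lambda>r. \<theta> $ r) e + (\<Sum>k<p. covariate Z k e * \<gamma> $ k))"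
proof -
  obtain i j where ij: "e = (i, j)" "i < n" "j < n" using e by (auto simp: pairs_def)
  show ?thesis using ij Z
    by (simp add: intensity_def pmean_def node_effect_pair out_par_def in_par_def scalar_prod_def covariate_def atLeast0LessThan)
qed

lemma score_F_index:
  assumes "r < 2 * n - 1"
  shows "score_F n Z A \<theta> \<gamma> $ r = (\<Sum>e\<in>pairs n. incidence n r e * (intensity n Z \<theta> \<gamma> e - weight A e))"
proof (cases "r < n")
  case True
  show ?thesis unfolding sum_incidence_row[OF True] using True assms
    by (simp add: score_F_def intensity_def weight_def sum_subtractf out_degree_def)
next
  case False
  then have "r - n < n" "n + (r - n) = r" using assms by auto
  then show ?thesis using sum_incidence_col[of "r - n" n "\<lambda>e. intensity n Z \<theta> \<gamma> e - weight A e"] False assms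
    by (simp add: score_F_def intensity_def weight_def sum_subtractf in_degree_def)
qed

lemma score_Q_index:
  assumes "k < p"
  shows "score_Q n p Z A \<theta> \<gamma> $ k = (\<Sum>e\<in>pairs n. covariate Z k e * (intensity n Z \<theta> \<gamma> e - weight A e))"
  using assms by (simp add: score_Q_def sum_pairs covariate_def intensity_def weight_def)

text \<open>The score equations say that the vector of differences between intensities and weights is orthogonal to
every regressor, that is, to the incidence functions and the covariates.\<close>

lemma is_mle_iff:
  "is_mle n p Z A \<theta> \<gamma> \<longleftrightarrow> \<theta> \<in> carrier_vec (2 * n - 1) \<and> \<gamma> \<in> carrier_vec p \<and>
     (\<forall>r<2 * n - 1. (\<Sum>e\<in>pairs n. incidence n r e * (intensity n Z \<theta> \<gamma> e - weight A e)) = 0) \<and>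
     (\<forall>k<p. (\<Sum>e\<in>pairs n. covariate Z k e * (intensity n Z \<theta> \<gamma> e - weight A e)) = 0)"
proof -
  have d: "dim_vec (score_F n Z A \<theta> \<gamma>) = 2 * n - 1" "dim_vec (score_Q n p Z A \<theta> \<gamma>) = p"
    by (simp_all add: score_F_def score_Q_def)
  have "score_F n Z A \<theta> \<gamma> = 0\<^sub>v (2 * n - 1) \<longleftrightarrow> (\<forall>r<2 * n - 1. score_F n Z A \<theta> \<gamma> $ r = 0)"
    using d by (auto simp: vec_eq_iff)
  moreover have "score_Q n p Z A \<theta> \<gamma> = 0\<^sub>v p \<longleftrightarrow> (\<forall>k<p. score_Q n p Z A \<theta> \<gamma> $ k = 0)"
    using d by (auto simp: vec_eq_iff)
  ultimately show ?thesis
    unfolding is_mle_def by (auto simp: score_F_index score_Q_index)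
qed

section \<open>Inverses and maximum norms\<close>

lemma mat_inv_of_trivial_kernel:
  assumes A: "A \<in> carrier_mat m m"
    and ker: "\<And>v. v \<in> carrier_vec m \<Longrightarrow> A *\<^sub>v v = 0\<^sub>v m \<Longrightarrow> v = 0\<^sub>v m"
  shows "mat_inv A \<in> carrier_mat m m" "A * mat_inv A = 1\<^sub>m m" "mat_inv A * A = 1\<^sub>m m"
proof -
  have "det A \<noteq> 0" using det_0_iff_vec_prod_zero[OF A] ker by blast
  then have "A \<in> Units (ring_mat TYPE(real) m ())" by (rule det_non_zero_imp_unit[OF A])
  then obtain B where B: "mat_inverse A = Some B"
    using mat_inverse(1)[OF A, where b = "()"] by (cases "mat_inverse A") auto
  then have "mat_inv A = B" by (simp add: mat_inv_def)
  then show "mat_inv A \<in> carrier_mat m m" "A * mat_inv A = 1\<^sub>m m" "mat_inv A * A = 1\<^sub>m m"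
    using mat_inverse(2)[OF A B] by auto
qed

lemma pos_def_mat_inv:
  assumes H: "H \<in> carrier_mat m m" and pd: "pos_def_mat H"
  shows "mat_inv H \<in> carrier_mat m m" "H * mat_inv H = 1\<^sub>m m" "mat_inv H * H = 1\<^sub>m m"
proof -
  have ker: "v = 0\<^sub>v m" if v: "v \<in> carrier_vec m" "H *\<^sub>v v = 0\<^sub>v m" for v
  proof (rule ccontr)
    assume "v \<noteq> 0\<^sub>v m"
    then have "v \<bullet> (H *\<^sub>v v) > 0" using pd v H by (auto simp: pos_def_mat_def)
    then show False using v by simp
  qed
  note inv = mat_inv_of_trivial_kernel[OF H ker]
  show "mat_inv H \<in> carrier_mat m m" "H * mat_inv H = 1\<^sub>m m" "mat_inv H * H = 1\<^sub>m m"
    using inv by blast+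
qed

lemma vec_maxnorm_le:
  assumes "dim_vec v > 0" "\<And>k. k < dim_vec v \<Longrightarrow> \<bar>v $ k\<bar> \<le> t"
  shows "vec_maxnorm v \<le> t"
  using assms unfolding vec_maxnorm_def by (subst Max_le_iff) auto

lemma vec_maxnorm_ge: "k < dim_vec v \<Longrightarrow> \<bar>v $ k\<bar> \<le> vec_maxnorm v"
  unfolding vec_maxnorm_def by (intro Max_ge) auto

lemma mat_maxnorm_row:
  assumes "A \<in> carrier_mat m m'" "r < m"
  shows "(\<Sum>c<m'. \<bar>A $$ (r, c)\<bar>) \<le> mat_maxnorm A"
  using assms unfolding mat_maxnorm_def by (intro Max_ge) auto

section \<open>Jacobians of the score functions\<close>

text \<open>Changing one coordinate multiplies each intensity by an exponential in that coordinate, so all four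
Jacobians below are instances of this derivative.\<close>

lemma deriv_exp_sum:
  fixes u l w b :: "'e \<Rightarrow> real"
  assumes "\<And>t. f t = (\<Sum>e\<in>S. w e * (l e * exp ((t - x) * u e) - b e))"
  shows "deriv f x = (\<Sum>e\<in>S. w e * l e * u e)"
proof -
  have "f = (\<lambda>t. \<Sum>e\<in>S. w e * (l e * exp ((t - x) * u e) - b e))"
    using assms by auto
  moreover have "((\<lambda>t. \<Sum>e\<in>S. w e * (l e * exp ((t - x) * u e) - b e))
      has_real_derivative (\<Sum>e\<in>S. w e * l e * u e)) (at x)"
    by (auto intro!: derivative_eq_intros sum.cong)
  ultimately show ?thesis by (simp add: DERIV_imp_deriv)
qed

lemma intensity_update_theta:
  assumes "e \<in> pairs n" "c < 2 * n - 1" "dim_vec \<theta> = 2 * n - 1"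
  shows "intensity n Z (\<theta> |\<^sub>v c \<mapsto> t) \<gamma> e = intensity n Z \<theta> \<gamma> e * exp ((t - \<theta> $ c) * incidence n c e)"
  using assms by (simp add: intensity_exp[OF _ refl] node_effect_update mult_exp_exp algebra_simps)

lemma intensity_update_gamma:
  assumes "e \<in> pairs n" "k < p" "dim_vec \<gamma> = p"
  shows "intensity n Z \<theta> (\<gamma> |\<^sub>v k \<mapsto> t) e = intensity n Z \<theta> \<gamma> e * exp ((t - \<gamma> $ k) * covariate Z k e)"
proof -
  have "(\<Sum>l<p. covariate Z l e * (\<gamma> |\<^sub>v k \<mapsto> t) $ l)
      = (\<Sum>l<p. covariate Z l e * \<gamma> $ l + (if l = k then (t - \<gamma> $ k) * covariate Z k e else 0))"
    using assms by (intro sum.cong refl) (auto simp: algebra_simps)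
  also have "\<dots> = (\<Sum>l<p. covariate Z l e * \<gamma> $ l) + (t - \<gamma> $ k) * covariate Z k e"
    using assms by (simp add: sum.distrib)
  finally show ?thesis
    using assms by (simp add: intensity_exp[where p = p] mult_exp_exp algebra_simps)
qed

lemma jacobians:
  fixes Z :: "nat \<Rightarrow> nat \<Rightarrow> real vec"
  assumes \<theta>: "\<theta> \<in> carrier_vec (2 * n - 1)" and \<gamma>: "\<gamma> \<in> carrier_vec p"
  defines "l \<equiv> intensity n Z \<theta> \<gamma>"
  shows "jacobian (2 * n - 1) (\<lambda>\<theta>'. score_F n Z A \<theta>' \<gamma>) \<theta>
      = mat (2 * n - 1) (2 * n - 1) (\<lambda>(r, c). \<Sum>e\<in>pairs n. incidence n r e * l e * incidence n c e)"
    and "jacobian (2 * n - 1) (\<lambda>\<gamma>'. score_F n Z A \<theta> \<gamma>') \<gamma>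
      = mat (2 * n - 1) p (\<lambda>(r, c). \<Sum>e\<in>pairs n. incidence n r e * l e * covariate Z c e)"
    and "jacobian p (\<lambda>\<theta>'. score_Q n p Z A \<theta>' \<gamma>) \<theta>
      = mat p (2 * n - 1) (\<lambda>(r, c). \<Sum>e\<in>pairs n. covariate Z r e * l e * incidence n c e)"
    and "jacobian p (\<lambda>\<gamma>'. score_Q n p Z A \<theta> \<gamma>') \<gamma>
      = mat p p (\<lambda>(r, c). \<Sum>e\<in>pairs n. covariate Z r e * l e * covariate Z c e)"
proof -
  have dt: "dim_vec \<theta> = 2 * n - 1" and dg: "dim_vec \<gamma> = p" using \<theta> \<gamma> by auto
  show "jacobian (2 * n - 1) (\<lambda>\<theta>'. score_F n Z A \<theta>' \<gamma>) \<theta>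
      = mat (2 * n - 1) (2 * n - 1) (\<lambda>(r, c). \<Sum>e\<in>pairs n. incidence n r e * l e * incidence n c e)"
    unfolding jacobian_def dt
    by (rule cong_mat)
      (auto simp: score_F_index l_def intensity_update_theta dt intro!: deriv_exp_sum[where b = "weight A"] sum.cong)
  show "jacobian (2 * n - 1) (\<lambda>\<gamma>'. score_F n Z A \<theta> \<gamma>') \<gamma>
      = mat (2 * n - 1) p (\<lambda>(r, c). \<Sum>e\<in>pairs n. incidence n r e * l e * covariate Z c e)"
    unfolding jacobian_def dg
    by (rule cong_mat)
      (auto simp: score_F_index l_def intensity_update_gamma dg intro!: deriv_exp_sum[where b = "weight A"] sum.cong)
  show "jacobian p (\<lambda>\<theta>'. score_Q n p Z A \<theta>' \<gamma>) \<theta>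
      = mat p (2 * n - 1) (\<lambda>(r, c). \<Sum>e\<in>pairs n. covariate Z r e * l e * incidence n c e)"
    unfolding jacobian_def dt
    by (rule cong_mat)
      (auto simp: score_Q_index l_def intensity_update_theta dt intro!: deriv_exp_sum[where b = "weight A"] sum.cong)
  show "jacobian p (\<lambda>\<gamma>'. score_Q n p Z A \<theta> \<gamma>') \<gamma>
      = mat p p (\<lambda>(r, c). \<Sum>e\<in>pairs n. covariate Z r e * l e * covariate Z c e)"
    unfolding jacobian_def dg
    by (rule cong_mat)
      (auto simp: score_Q_index l_def intensity_update_gamma dg intro!: deriv_exp_sum[where b = "weight A"] sum.cong)
qed

lemma intensity_pos: "intensity n Z \<theta> \<gamma> e > 0"
  by (simp add: intensity_def pmean_def)

section \<open>Node equations and residualised covariates\<close>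

text \<open>The Fisher information of the node parameters for the intensities \<open>l\<close>.\<close>

definition node_info :: "nat \<Rightarrow> (nat \<times> nat \<Rightarrow> real) \<Rightarrow> real mat" where
  "node_info n l = mat (2 * n - 1) (2 * n - 1) (\<lambda>(r, c). \<Sum>e\<in>pairs n. incidence n r e * l e * incidence n c e)"

lemma node_info_carrier [simp]: "node_info n l \<in> carrier_mat (2 * n - 1) (2 * n - 1)"
  by (simp add: node_info_def)

lemma node_info_mult:
  assumes "r < 2 * n - 1" "v \<in> carrier_vec (2 * n - 1)"
  shows "(node_info n l *\<^sub>v v) $ r = (\<Sum>e\<in>pairs n. incidence n r e * l e * node_effect n (\<lambda>c. v $ c) e)"
proof -
  have "(node_info n l *\<^sub>v v) $ r = (\<Sum>c<2 * n - 1. (\<Sum>e\<in>pairs n. incidence n r e * l e * incidence n c e) * v $ c)"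
    using assms by (simp add: node_info_def scalar_prod_def atLeast0LessThan)
  also have "\<dots> = (\<Sum>e\<in>pairs n. incidence n r e * l e * node_effect n (\<lambda>c. v $ c) e)"
    unfolding node_effect_def sum_distrib_left sum_distrib_right
    by (subst sum.swap) (simp add: algebra_simps)
  finally show ?thesis .
qed

text \<open>A function with vanishing sums against all incidence functions is orthogonal to every node effect.\<close>

lemma sum_incidence_node_effect:
  "(\<Sum>r<2 * n - 1. x r * (\<Sum>e\<in>pairs n. incidence n r e * f e)) = (\<Sum>e\<in>pairs n. node_effect n x e * f e)"
  unfolding node_effect_def sum_distrib_left sum_distrib_right
  by (subst sum.swap) (simp add: algebra_simps)

text \<open>The quadratic form of the matrix at \<open>x\<close> is the sum of \<open>l e\<close> times the squared node effect of \<open>x\<close>,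
so a kernel vector has no node effect on any pair and is \<open>0\<close>.\<close>

lemma node_info_inv:
  assumes n: "n \<ge> 3" and l: "\<And>e. e \<in> pairs n \<Longrightarrow> l e > 0"
  shows "mat_inv (node_info n l) \<in> carrier_mat (2 * n - 1) (2 * n - 1)"
    "node_info n l * mat_inv (node_info n l) = 1\<^sub>m (2 * n - 1)" "mat_inv (node_info n l) * node_info n l = 1\<^sub>m (2 * n - 1)"
proof -
  have ker: "v = 0\<^sub>v (2 * n - 1)" if v: "v \<in> carrier_vec (2 * n - 1)" "node_info n l *\<^sub>v v = 0\<^sub>v (2 * n - 1)" for v
  proof -
    let ?x = "\<lambda>c. v $ c"
    have "0 = (\<Sum>r<2 * n - 1. v $ r * (node_info n l *\<^sub>v v) $ r)" using v by simp
    also have "\<dots> = (\<Sum>r<2 * n - 1. v $ r * (\<Sum>e\<in>pairs n. incidence n r e * (l e * node_effect n ?x e)))"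
      using v(1) by (intro sum.cong refl) (simp add: node_info_mult mult.assoc)
    also have "\<dots> = (\<Sum>e\<in>pairs n. l e * (node_effect n ?x e)\<^sup>2)"
      by (subst sum_incidence_node_effect) (simp add: power2_eq_square algebra_simps)
    finally have "(\<Sum>e\<in>pairs n. l e * (node_effect n ?x e)\<^sup>2) = 0" by simp
    moreover have "\<forall>e\<in>pairs n. l e * (node_effect n ?x e)\<^sup>2 \<ge> 0" using l by (auto simp: less_imp_le)
    ultimately have "\<forall>e\<in>pairs n. l e * (node_effect n ?x e)\<^sup>2 = 0"
      by (subst (asm) sum_nonneg_eq_0_iff) auto
    then have "node_effect n ?x e = 0" if "e \<in> pairs n" for e using l[OF that] that by auto
    then have "v $ r = 0" if "r < 2 * n - 1" for r using node_effect_eq_0[OF n _ that, of ?x] by blast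
    then show ?thesis using v by (auto simp: vec_eq_iff)
  qed
  note inv = mat_inv_of_trivial_kernel[OF node_info_carrier ker]
  show "mat_inv (node_info n l) \<in> carrier_mat (2 * n - 1) (2 * n - 1)"
    "node_info n l * mat_inv (node_info n l) = 1\<^sub>m (2 * n - 1)" "mat_inv (node_info n l) * node_info n l = 1\<^sub>m (2 * n - 1)"
    using inv by blast+
qed

lemma node_equations_solvable:
  assumes n: "n \<ge> 3" and l: "\<And>e. e \<in> pairs n \<Longrightarrow> l e > 0"
  shows "\<exists>x. \<forall>r<2 * n - 1. (\<Sum>e\<in>pairs n. incidence n r e * (l e * node_effect n x e - h e)) = 0"
proof -
  define f where "f = vec (2 * n - 1) (\<lambda>r. \<Sum>e\<in>pairs n. incidence n r e * h e)"
  define v where "v = mat_inv (node_info n l) *\<^sub>v f"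
  note inv = node_info_inv[of n l, OF n l]
  have f: "f \<in> carrier_vec (2 * n - 1)" by (simp add: f_def)
  have v: "v \<in> carrier_vec (2 * n - 1)" unfolding v_def using inv(1) f by (rule mult_mat_vec_carrier)
  have "node_info n l *\<^sub>v v = f"
    unfolding v_def using inv(2) f by (simp add: assoc_mult_mat_vec[symmetric, OF node_info_carrier inv(1) f])
  then have "(\<Sum>e\<in>pairs n. incidence n r e * l e * node_effect n (\<lambda>c. v $ c) e) = (\<Sum>e\<in>pairs n. incidence n r e * h e)"
    if "r < 2 * n - 1" for r
    using node_info_mult[OF that v, of l] that by (simp add: f_def)
  then show ?thesis
    by (intro exI[of _ "\<lambda>c. v $ c"]) (simp add: algebra_simps sum_subtractf)
qed

text \<open>Row \<open>k\<close> of the product of the mixed block with the inverse node information holds the coefficients of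
the weighted projection of the \<open>k\<close>-th covariate onto the node effects.  The Schur complement
therefore pairs the projection residuals with the covariates.\<close>

lemma info_H_residual:
  fixes Z :: "nat \<Rightarrow> nat \<Rightarrow> real vec"
  assumes n: "n \<ge> 3" and \<theta>: "\<theta> \<in> carrier_vec (2 * n - 1)" and \<gamma>: "\<gamma> \<in> carrier_vec p"
  defines "l \<equiv> intensity n Z \<theta> \<gamma>"
  shows "\<exists>c. (\<forall>k<p. \<forall>r<2 * n - 1.
        (\<Sum>e\<in>pairs n. incidence n r e * (l e * (covariate Z k e - node_effect n (c k) e))) = 0) \<and>
      info_H n p Z A \<theta> \<gamma> \<in> carrier_mat p p \<and>
      (\<forall>k<p. \<forall>m<p. info_H n p Z A \<theta> \<gamma> $$ (k, m)
        = (\<Sum>e\<in>pairs n. l e * (covariate Z k e - node_effect n (c k) e) * covariate Z m e))"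
proof -
  define N where "N = 2 * n - 1"
  define V where "V = node_info n l"
  define W where "W = mat N p (\<lambda>(r, c). \<Sum>e\<in>pairs n. incidence n r e * l e * covariate Z c e)"
  define W' where "W' = mat p N (\<lambda>(r, c). \<Sum>e\<in>pairs n. covariate Z r e * l e * incidence n c e)"
  define U where "U = mat p p (\<lambda>(r, c). \<Sum>e\<in>pairs n. covariate Z r e * l e * covariate Z c e)"
  have lpos: "l e > 0" for e by (simp add: l_def intensity_pos)
  note inv = node_info_inv[of n l, OF n lpos, folded V_def N_def]
  have V: "V \<in> carrier_mat N N" unfolding V_def N_def by (rule node_info_carrier)
  define C where "C = W' * mat_inv V"
  have W: "W \<in> carrier_mat N p" "W' \<in> carrier_mat p N" "U \<in> carrier_mat p p"
    by (auto simp: W_def W'_def U_def)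
  have C: "C \<in> carrier_mat p N" unfolding C_def using W inv by auto
  have CV: "C * V = W'"
    unfolding C_def using W inv V by (subst assoc_mult_mat[OF _ inv(1) V]) auto
  have H: "info_H n p Z A \<theta> \<gamma> = U - C * W"
    unfolding info_H_def jacobians[OF \<theta> \<gamma>] C_def U_def W_def W'_def V_def N_def node_info_def l_def ..
  define c where "c k r = C $$ (k, r)" for k r
  have 1: "(\<Sum>e\<in>pairs n. incidence n r e * (l e * (covariate Z k e - node_effect n (c k) e))) = 0" if k: "k < p" and r: "r < N" for k r
  proof -
    have "(\<Sum>e\<in>pairs n. covariate Z k e * l e * incidence n r e) = W' $$ (k, r)" using k r by (simp add: W'_def)
    also have "\<dots> = (C * V) $$ (k, r)" by (simp add: CV)
    also have "\<dots> = (\<Sum>s<N. c k s * (\<Sum>e\<in>pairs n. incidence n s e * l e * incidence n r e))"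
      using k r C V by (simp add: scalar_prod_def c_def V_def node_info_def N_def atLeast0LessThan)
    also have "\<dots> = (\<Sum>s<2 * n - 1. c k s * (\<Sum>e\<in>pairs n. incidence n s e * (l e * incidence n r e)))"
      by (simp add: N_def mult.assoc)
    also have "\<dots> = (\<Sum>e\<in>pairs n. node_effect n (c k) e * (l e * incidence n r e))" by (rule sum_incidence_node_effect)
    finally show ?thesis by (simp add: algebra_simps sum_subtractf)
  qed
  have 2: "info_H n p Z A \<theta> \<gamma> $$ (k, m) = (\<Sum>e\<in>pairs n. l e * (covariate Z k e - node_effect n (c k) e) * covariate Z m e)"
    if k: "k < p" and m: "m < p" for k m
  proof -
    have "(C * W) $$ (k, m) = (\<Sum>s<2 * n - 1. c k s * (\<Sum>e\<in>pairs n. incidence n s e * (l e * covariate Z m e)))"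
      using k m C W by (simp add: scalar_prod_def c_def W_def N_def atLeast0LessThan mult.assoc)
    also have "\<dots> = (\<Sum>e\<in>pairs n. node_effect n (c k) e * (l e * covariate Z m e))" by (rule sum_incidence_node_effect)
    finally show ?thesis unfolding H using k m C W
      by (simp add: U_def algebra_simps sum_subtractf)
  qed
  have "U - C * W \<in> carrier_mat p p" using C W by auto
  then show ?thesis using 1 2 H unfolding N_def by (intro exI[of _ c]) auto
qed

section \<open>Maximum-norm bound for the node equations\<close>

text \<open>For the vertex of highest potential all currents flow outwards, so its net current controls the average
potential drop to its neighbours.\<close>

lemma potential_top:
  fixes l :: "nat \<Rightarrow> real" and m s P :: real
  assumes "finite S" "\<And>j. j \<in> S \<Longrightarrow> m \<le> l j" "\<And>j. j \<in> S \<Longrightarrow> B j \<le> P"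
    and "\<bar>\<Sum>j\<in>S. l j * (P - B j)\<bar> \<le> s"
  shows "m * (\<Sum>j\<in>S. P - B j) \<le> s"
proof -
  have "m * (\<Sum>j\<in>S. P - B j) \<le> (\<Sum>j\<in>S. l j * (P - B j))"
    unfolding sum_distrib_left using assms by (intro sum_mono mult_right_mono) auto
  then show ?thesis using assms(4) by linarith
qed

lemma potential_bottom:
  fixes l :: "nat \<Rightarrow> real" and m s L :: real
  assumes "finite S" "\<And>j. j \<in> S \<Longrightarrow> m \<le> l j" "\<And>j. j \<in> S \<Longrightarrow> L \<le> A j"
    and "\<bar>\<Sum>j\<in>S. l j * (A j - L)\<bar> \<le> s"
  shows "m * (\<Sum>j\<in>S. A j - L) \<le> s"
proof -
  have "m * (\<Sum>j\<in>S. A j - L) \<le> (\<Sum>j\<in>S. l j * (A j - L))"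
    unfolding sum_distrib_left using assms by (intro sum_mono mult_right_mono) auto
  then show ?thesis using assms(4) by linarith
qed

text \<open>The neighbours are on average close to the maximum, and also close to the minimum.  The two vertices have
\<open>n - 2\<close> common neighbours or more, so maximum and minimum are close.\<close>

lemma potential_same_side:
  fixes l :: "nat \<Rightarrow> nat \<Rightarrow> real" and A B :: "nat \<Rightarrow> real"
  assumes n: "n \<ge> 3" and m: "m > 0"
    and l: "\<And>i j. i < n \<Longrightarrow> j < n \<Longrightarrow> i \<noteq> j \<Longrightarrow> m \<le> l i j"
    and row: "\<And>i. i < n \<Longrightarrow> \<bar>\<Sum>j\<in>{..<n} - {i}. l i j * (A i - B j)\<bar> \<le> s"
    and i0: "i0 < n" "\<And>j. j < n \<Longrightarrow> B j \<le> A i0"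
    and i1: "i1 < n" "\<And>j. j < n \<Longrightarrow> A i1 \<le> B j"
  shows "m * (real n - 2) * (A i0 - A i1) \<le> 2 * s"
proof -
  \<comment> \<open>the common neighbours of the two extreme vertices\<close>
  define S where "S = {..<n} - {i0, i1}"
  have card: "real n - 2 \<le> real (card S)"
    using i0 i1 card_Diff_subset[of "{i0, i1}" "{..<n}"] card_insert_le_m1[of 2 "{i1}" i0]
    by (simp add: S_def card_insert_if split: if_splits)
  have D: "A i1 \<le> A i0" using i0(2)[of 0] i1(2)[of 0] n by linarith
  have 0: "m * (\<Sum>j\<in>{..<n} - {i0}. A i0 - B j) \<le> s"
    using l i0 row by (intro potential_top[where l = "l i0"]) auto
  have "(\<Sum>j\<in>{..<n} - {i1}. l i1 j * (B j - A i1)) = - (\<Sum>j\<in>{..<n} - {i1}. l i1 j * (A i1 - B j))"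
    by (simp add: sum_negf[symmetric] algebra_simps)
  then have 1: "m * (\<Sum>j\<in>{..<n} - {i1}. B j - A i1) \<le> s"
    using l i1 row[of i1] by (intro potential_bottom[where l = "l i1"]) auto
  have "m * (real n - 2) * (A i0 - A i1) \<le> m * (real (card S) * (A i0 - A i1))"
    using card D m unfolding mult.assoc by (intro mult_left_mono mult_right_mono) auto
  also have "real (card S) * (A i0 - A i1) = (\<Sum>j\<in>S. A i0 - B j) + (\<Sum>j\<in>S. B j - A i1)"
    by (simp add: sum_subtractf algebra_simps)
  also have "m * \<dots> \<le> m * ((\<Sum>j\<in>{..<n} - {i0}. A i0 - B j) + (\<Sum>j\<in>{..<n} - {i1}. B j - A i1))"
    using i0 i1 m by (intro mult_left_mono add_mono sum_mono2) (auto simp: S_def)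
  also have "\<dots> \<le> 2 * s" using 0 1 by (simp add: distrib_left)
  finally show ?thesis .
qed

text \<open>Here the vertex of highest potential has all its neighbours on one side and the vertex of lowest
potential all of its neighbours on the other.  So one side sits near the top and the other near the
bottom, and the potential falls by nearly the total drop along almost every edge from the first to the
second, which makes for a current of about \<open>m\<close> times that drop or more.  The net currents of the low side, which are at most \<open>s\<close> each, have to make up for this.\<close>

lemma potential_opposite_sides:
  fixes l :: "nat \<Rightarrow> nat \<Rightarrow> real" and A B :: "nat \<Rightarrow> real"
  assumes n: "n \<ge> 3" and m: "m > 0"
    and l: "\<And>i j. i < n \<Longrightarrow> j < n \<Longrightarrow> i \<noteq> j \<Longrightarrow> m \<le> l i j \<and> l i j \<le> M"
    and row: "\<And>i. i < n \<Longrightarrow> \<bar>\<Sum>j\<in>{..<n} - {i}. l i j * (A i - B j)\<bar> \<le> s"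
    and col: "\<And>j. j < n \<Longrightarrow> \<bar>\<Sum>i\<in>{..<n} - {j}. l i j * (A i - B j)\<bar> \<le> s"
    and i0: "i0 < n" "\<And>j. j < n \<Longrightarrow> B j \<le> A i0" "\<And>i. i < n \<Longrightarrow> A i \<le> A i0"
    and j1: "j1 < n" "\<And>j. j < n \<Longrightarrow> B j1 \<le> B j" "\<And>i. i < n \<Longrightarrow> B j1 \<le> A i"
  shows "m * (m * (real n - 2) * (A i0 - B j1)) \<le> m * s + 2 * M * s"
proof -
  define P L D where "P = A i0" and "L = B j1" and "D = P - L"
  define X Y where "X = (\<Sum>j\<in>{..<n} - {i0}. P - B j)" and "Y = (\<Sum>i\<in>{..<n} - {j1}. A i - L)"
  have D: "D \<ge> 0" using j1(3)[OF i0(1)] by (simp add: D_def P_def L_def)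
  have M: "M \<ge> m" using l[of 0 1] n by auto
  have X: "m * X \<le> s"
    unfolding X_def P_def using l i0 row by (intro potential_top[where l = "l i0"]) auto
  have Y: "m * Y \<le> s"
    unfolding Y_def L_def using l j1 col by (intro potential_bottom[where l = "\<lambda>i. l i j1"]) auto
  \<comment> \<open>a drop of at least \<open>D\<close> along each edge, corrected by the distances of its ends from bottom and top\<close>
  have "- s \<le> M * ((real n - 1) * (A i - L)) + M * X - m * ((real n - 2) * D)" if i: "i < n" for i
  proof -
    define S where "S = {..<n} - {i, i0}"
    have card: "real n - 2 \<le> real (card S)"
      using i i0 card_Diff_subset[of "{i, i0}" "{..<n}"]
      by (simp add: S_def card_insert_if split: if_splits)
    have AL: "A i - L \<ge> 0" using j1(3)[OF i] by (simp add: L_def)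
    have "- s \<le> (\<Sum>j\<in>{..<n} - {i}. l i j * (A i - B j))" using row[OF i] by linarith
    also have "\<dots> \<le> (\<Sum>j\<in>{..<n} - {i}. M * (A i - L) + (if j \<noteq> i0 then M * (P - B j) - m * D else 0))"
    proof (rule sum_mono)
      fix j assume j: "j \<in> {..<n} - {i}"
      then have lij: "m \<le> l i j" "l i j \<le> M" using l i by auto
      have PB: "P - B j \<ge> 0" "L \<le> B j" using i0 j1 j by (auto simp: P_def L_def)
      show "l i j * (A i - B j) \<le> M * (A i - L) + (if j \<noteq> i0 then M * (P - B j) - m * D else 0)"
      proof (cases "j = i0")
        case True
        have "l i j * (A i - B j) \<le> l i j * (A i - L)" using lij m PB by (intro mult_left_mono) auto
        also have "\<dots> \<le> M * (A i - L)" using lij AL by (intro mult_right_mono)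
        finally show ?thesis using True by simp
      next
        case False
        have "l i j * (A i - B j) = l i j * (A i - L) + l i j * (P - B j) - l i j * D"
          by (simp add: D_def algebra_simps)
        also have "\<dots> \<le> M * (A i - L) + M * (P - B j) - m * D"
          using lij AL PB D by (intro diff_mono add_mono mult_right_mono) auto
        finally show ?thesis using False by simp
      qed
    qed
    also have "\<dots> = M * ((real n - 1) * (A i - L)) + (\<Sum>j\<in>S. M * (P - B j) - m * D)"
    proof -
      have "(\<Sum>j\<in>{..<n} - {i}. if j \<noteq> i0 then M * (P - B j) - m * D else 0)
          = (\<Sum>j\<in>{j \<in> {..<n} - {i}. j \<noteq> i0}. M * (P - B j) - m * D)"
        by (subst sum.inter_filter) auto
      also have "{j \<in> {..<n} - {i}. j \<noteq> i0} = S" by (auto simp: S_def)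
      finally show ?thesis using i by (simp add: sum.distrib of_nat_diff)
    qed
    also have "(\<Sum>j\<in>S. M * (P - B j) - m * D) = M * (\<Sum>j\<in>S. P - B j) - m * (real (card S) * D)"
      unfolding sum_subtractf sum_distrib_left[symmetric] by simp
    also have "\<dots> \<le> M * X - m * ((real n - 2) * D)"
    proof (rule diff_mono)
      show "M * (\<Sum>j\<in>S. P - B j) \<le> M * X"
        unfolding X_def using M m i0 by (intro mult_left_mono sum_mono2) (auto simp: S_def P_def)
      show "m * ((real n - 2) * D) \<le> m * (real (card S) * D)"
        using card m D by (intro mult_left_mono mult_right_mono) auto
    qed
    finally show ?thesis by linarith
  qed
  then have "(\<Sum>i\<in>{..<n} - {j1}. - s) \<le> (\<Sum>i\<in>{..<n} - {j1}. M * ((real n - 1) * (A i - L)) + (M * X - m * ((real n - 2) * D)))"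
    by (intro sum_mono) (auto simp: algebra_simps)
  also have "\<dots> = (real n - 1) * (M * Y + M * X - m * ((real n - 2) * D))"
  proof -
    have "(\<Sum>i\<in>{..<n} - {j1}. M * ((real n - 1) * (A i - L))) = M * ((real n - 1) * Y)"
      unfolding Y_def by (simp only: sum_distrib_left)
    then show ?thesis using j1 n by (simp add: sum.distrib of_nat_diff) (simp add: algebra_simps)
  qed
  finally have "(real n - 1) * (- s) \<le> (real n - 1) * (M * Y + M * X - m * ((real n - 2) * D))"
    using j1 n by (simp add: of_nat_diff)
  then have "- s \<le> M * Y + M * X - m * ((real n - 2) * D)"
    using n by (subst (asm) mult_le_cancel_left_pos) auto
  then have "m * (m * ((real n - 2) * D)) \<le> m * (s + (M * Y + M * X))"
    using m by (intro mult_left_mono) auto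
  also have "\<dots> = m * s + M * (m * Y) + M * (m * X)" by (simp add: algebra_simps)
  also have "\<dots> \<le> m * s + M * s + M * s"
    using X Y M m by (intro add_mono mult_left_mono) auto
  finally show ?thesis by (simp add: D_def P_def L_def algebra_simps)
qed

text \<open>An estimate for a resistor network on the complete bipartite graph without a perfect matching, with
conductances between \<open>m\<close> and \<open>M\<close>: net currents of size \<open>s\<close> at all vertices force potential
differences of order \<open>s / n\<close>.  It matters that the net current is bounded at every vertex; grounding
one vertex and leaving its current free would lose a factor \<open>n\<close>.\<close>

lemma potential_spread:
  fixes l :: "nat \<Rightarrow> nat \<Rightarrow> real" and A B :: "nat \<Rightarrow> real"
  assumes n: "n \<ge> 3" and m: "m > 0"
    and l: "\<And>i j. i < n \<Longrightarrow> j < n \<Longrightarrow> i \<noteq> j \<Longrightarrow> m \<le> l i j \<and> l i j \<le> M"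
    and row: "\<And>i. i < n \<Longrightarrow> \<bar>\<Sum>j\<in>{..<n} - {i}. l i j * (A i - B j)\<bar> \<le> s"
    and col: "\<And>j. j < n \<Longrightarrow> \<bar>\<Sum>i\<in>{..<n} - {j}. l i j * (A i - B j)\<bar> \<le> s"
    and ij: "i < n" "j < n"
  shows "m\<^sup>2 * (real n - 2) * \<bar>A i - B j\<bar> \<le> 3 * M * s"
proof -
  define V where "V = A ` {..<n} \<union> B ` {..<n}"
  have V: "finite V" "V \<noteq> {}" using n by (auto simp: V_def lessThan_empty_iff)
  have hi: "A k \<le> Max V" "B k \<le> Max V" if "k < n" for k using V that by (auto simp: V_def)
  have lo: "Min V \<le> A k" "Min V \<le> B k" if "k < n" for k using V that by (auto simp: V_def)
  have s: "s \<ge> 0" using row[of 0] n by auto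
  have M: "m \<le> M" using l[of 0 1] n by auto
  have row': "\<bar>\<Sum>j\<in>{..<n} - {i}. l i j * (B j - A i)\<bar> \<le> s" if "i < n" for i
    using row[OF that] by (simp add: right_diff_distrib sum_subtractf abs_minus_commute)
  have col': "\<bar>\<Sum>i\<in>{..<n} - {j}. l i j * (B j - A i)\<bar> \<le> s" if "j < n" for j
    using col[OF that] by (simp add: right_diff_distrib sum_subtractf abs_minus_commute)
  have same: "m\<^sup>2 * (real n - 2) * D \<le> 3 * M * s" if "m * (real n - 2) * D \<le> 2 * s" for D
  proof -
    have "m * (m * (real n - 2) * D) \<le> m * (2 * s)" using that m by (intro mult_left_mono) auto
    also have "\<dots> \<le> M * (3 * s)" using M m s by (intro mult_mono) auto
    finally show ?thesis by (simp add: power2_eq_square algebra_simps)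
  qed
  have opp: "m\<^sup>2 * (real n - 2) * D \<le> 3 * M * s" if "m * (m * (real n - 2) * D) \<le> m * s + 2 * M * s" for D
  proof -
    have "m * s \<le> M * s" using M s by (rule mult_right_mono)
    then show ?thesis using that by (simp add: power2_eq_square algebra_simps)
  qed
  have spread: "m\<^sup>2 * (real n - 2) * (Max V - Min V) \<le> 3 * M * s"
  proof -
    have "Max V \<in> V" "Min V \<in> V" using V by auto
    then obtain x y where x: "x < n" "Max V = A x \<or> Max V = B x" and y: "y < n" "Min V = A y \<or> Min V = B y"
      by (auto simp: V_def)
    consider "Max V = A x" "Min V = A y" | "Max V = A x" "Min V = B y"
      | "Max V = B x" "Min V = A y" | "Max V = B x" "Min V = B y"
      using x y by auto
    then show ?thesis
    proof cases
      case 1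
      show ?thesis unfolding 1
        by (rule same[OF potential_same_side[where l = l and B = B]])
          (use n m l row x y hi lo 1 in auto)
    next
      case 2
      show ?thesis unfolding 2
        by (rule opp[OF potential_opposite_sides[where l = l]])
          (use n m l row col x y hi lo 2 in auto)
    next
      case 3
      show ?thesis unfolding 3
        by (rule opp[OF potential_opposite_sides[where l = "\<lambda>i j. l j i"]])
          (use n m l row' col' x y hi lo 3 in auto)
    next
      case 4
      show ?thesis unfolding 4
        by (rule same[OF potential_same_side[where l = "\<lambda>i j. l j i" and B = A]])
          (use n m l col' x y hi lo 4 in auto)
    qed
  qed
  have "\<bar>A i - B j\<bar> \<le> Max V - Min V" using hi[OF ij(1)] hi[OF ij(2)] lo[OF ij(1)] lo[OF ij(2)] by auto
  then have "m\<^sup>2 * (real n - 2) * \<bar>A i - B j\<bar> \<le> m\<^sup>2 * (real n - 2) * (Max V - Min V)"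
    using n m by (intro mult_left_mono) auto
  then show ?thesis using spread by linarith
qed

text \<open>Only \<open>2 * n - 1\<close> node equations are imposed.  The one for the in-degree of the last node follows from
the others, as row sums and column sums have the same total.\<close>

lemma row_col_sums_eq_0:
  assumes w: "\<And>r. r < 2 * n - 1 \<Longrightarrow> (\<Sum>e\<in>pairs n. incidence n r e * w e) = 0" and k: "k < n"
  shows "(\<Sum>j\<in>{..<n} - {k}. w (k, j)) = 0" "(\<Sum>i\<in>{..<n} - {k}. w (i, k)) = 0"
proof -
  have row: "(\<Sum>j\<in>{..<n} - {i}. w (i, j)) = 0" if "i < n" for i
    using w[of i] sum_incidence_row[OF that, of w] that by simp
  then show "(\<Sum>j\<in>{..<n} - {k}. w (k, j)) = 0" using k by simp
  have col: "(\<Sum>i\<in>{..<n} - {j}. w (i, j)) = 0" if "j < n - 1" for j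
    using w[of "n + j"] sum_incidence_col[of j n w] that by simp
  have tot: "0 = (\<Sum>e\<in>pairs n. w e)" using row by (simp add: sum_pairs)
  also have "\<dots> = (\<Sum>e\<in>pairs n. \<Sum>j<n. of_bool (snd e = j) * w e)"
    by (intro sum.cong refl) (auto simp: pairs_def)
  also have "\<dots> = (\<Sum>j<n. \<Sum>e\<in>pairs n. of_bool (snd e = j) * w e)" by (rule sum.swap)
  also have "\<dots> = (\<Sum>j<n. \<Sum>i\<in>{..<n} - {j}. w (i, j))"
    by (intro sum.cong refl sum_pairs_snd) auto
  also have "\<dots> = (\<Sum>j\<in>insert (n - 1) {..<n - 1}. \<Sum>i\<in>{..<n} - {j}. w (i, j))"
    using k by (intro sum.cong) auto
  also have "\<dots> = (\<Sum>i\<in>{..<n} - {n - 1}. w (i, n - 1))"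
    using col by (subst sum.insert) auto
  finally show "(\<Sum>i\<in>{..<n} - {k}. w (i, k)) = 0"
    using col[of k] k by (cases "k = n - 1") auto
qed

text \<open>With the sign of the in-parameters reversed, the node equations are Kirchhoff equations.\<close>

lemma node_equations_bound:
  assumes n: "n \<ge> 3" and m: "m > 0"
    and l: "\<And>e. e \<in> pairs n \<Longrightarrow> m \<le> l e \<and> l e \<le> M"
    and eq: "\<And>r. r < 2 * n - 1 \<Longrightarrow> (\<Sum>e\<in>pairs n. incidence n r e * (l e * node_effect n x e - h e)) = 0"
    and row: "\<And>i. i < n \<Longrightarrow> \<bar>\<Sum>j\<in>{..<n} - {i}. h (i, j)\<bar> \<le> s"
    and col: "\<And>j. j < n \<Longrightarrow> \<bar>\<Sum>i\<in>{..<n} - {j}. h (i, j)\<bar> \<le> s"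
    and e: "e \<in> pairs n"
  shows "m\<^sup>2 * (real n - 2) * \<bar>node_effect n x e\<bar> \<le> 3 * M * s"
proof -
  define B where "B j = - (if j < n - 1 then x (n + j) else 0)" for j
  have node_effect: "node_effect n x (i, j) = x i - B j" if "i < n" "j < n" for i j
    using that by (simp add: node_effect_pair B_def)
  obtain i j where ij: "e = (i, j)" "i < n" "j < n" using e by (auto simp: pairs_def)
  have "m\<^sup>2 * (real n - 2) * \<bar>x i - B j\<bar> \<le> 3 * M * s"
  proof (rule potential_spread[OF n m, where l = "\<lambda>i j. l (i, j)"])
    show "m \<le> l (i, j) \<and> l (i, j) \<le> M" if "i < n" "j < n" "i \<noteq> j" for i j
      using l that by (auto simp: pairs_def)
    show "\<bar>\<Sum>j\<in>{..<n} - {i}. l (i, j) * (x i - B j)\<bar> \<le> s" if i: "i < n" for i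
      using row_col_sums_eq_0(1)[OF eq i] row[OF i] i by (simp add: sum_subtractf node_effect)
    show "\<bar>\<Sum>i\<in>{..<n} - {j}. l (i, j) * (x i - B j)\<bar> \<le> s" if j: "j < n" for j
      using row_col_sums_eq_0(2)[OF eq j] col[OF j] j by (simp add: sum_subtractf node_effect)
  qed (use ij in auto)
  then show ?thesis using ij node_effect by simp
qed

section \<open>A fixed point principle and the exponential remainder\<close>

text \<open>The contraction principle for the maximum norm over a finite index set that is not the universe of a
type; the map may look at the other coordinates only as far as the two hypotheses allow.\<close>

lemma maxnorm_contraction_fixpoint:
  fixes T :: "('e \<Rightarrow> real) \<Rightarrow> 'e \<Rightarrow> real"
  assumes fin: "finite S" and r: "r \<ge> 0"
    and box: "\<And>x. (\<And>e. e \<in> S \<Longrightarrow> \<bar>x e\<bar> \<le> r) \<Longrightarrow> (\<And>e. e \<in> S \<Longrightarrow> \<bar>T x e\<bar> \<le> r)"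
    and contr: "\<And>x y d. (\<And>e. e \<in> S \<Longrightarrow> \<bar>x e\<bar> \<le> r) \<Longrightarrow> (\<And>e. e \<in> S \<Longrightarrow> \<bar>y e\<bar> \<le> r) \<Longrightarrow>
      d \<ge> 0 \<Longrightarrow> (\<And>e. e \<in> S \<Longrightarrow> \<bar>x e - y e\<bar> \<le> d) \<Longrightarrow> (\<And>e. e \<in> S \<Longrightarrow> \<bar>T x e - T y e\<bar> \<le> d / 2)"
  shows "\<exists>x. \<forall>e\<in>S. \<bar>x e\<bar> \<le> r \<and> T x e = x e"
proof -
  define X where "X k = (T ^^ k) (\<lambda>_. 0)" for k
  have X0: "X 0 e = 0" and XS: "X (Suc k) = T (X k)" for e k by (simp_all add: X_def)
  have Xr: "\<bar>X k e\<bar> \<le> r" if "e \<in> S" for k e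
    using that
  proof (induction k arbitrary: e)
    case 0 then show ?case using r by (simp add: X0)
  next
    case (Suc k) then show ?case unfolding XS by (intro box)
  qed
  have step: "\<bar>X (Suc k) e - X k e\<bar> \<le> r * (1/2) ^ k" if "e \<in> S" for k e
    using that
  proof (induction k arbitrary: e)
    case 0 then show ?case using Xr[of e 1] by (simp add: X0)
  next
    case (Suc k)
    then have "\<bar>T (X (Suc k)) e - T (X k) e\<bar> \<le> (r * (1/2) ^ k) / 2"
      using r by (intro contr Xr) auto
    then show ?case by (simp add: XS)
  qed
  define x where "x e = lim (\<lambda>k. X k e)" for e
  have conv: "(\<lambda>k. X k e) \<longlonglongrightarrow> x e" if e: "e \<in> S" for e
  proof -
    have "summable (\<lambda>k. X (Suc k) e - X k e)"
      by (rule summable_comparison_test'[where g = "\<lambda>k. r * (1/2) ^ k" and N = 0])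
        (use step[OF e] in \<open>auto intro!: summable_mult summable_geometric\<close>)
    then have "convergent (\<lambda>k. X k e)"
      using sum_lessThan_telescope[of "\<lambda>k. X k e"] by (simp add: summable_iff_convergent X0)
    then show ?thesis unfolding x_def by (simp add: convergent_LIMSEQ_iff)
  qed
  have xr: "\<bar>x e\<bar> \<le> r" if e: "e \<in> S" for e
    by (rule LIMSEQ_le_const2[OF tendsto_rabs[OF conv[OF e]]]) (use Xr[OF e] in auto)
  have "T x e = x e" if e: "e \<in> S" for e
  proof -
    have "(\<lambda>k. X (Suc k) e) \<longlonglongrightarrow> T x e"
    proof (rule tendstoI)
      fix d :: real assume d: "d > 0"
      have "\<forall>\<^sub>F k in sequentially. \<forall>e\<in>S. dist (X k e) (x e) < d"
        using conv d by (intro eventually_ball_finite fin) (auto simp: tendsto_iff)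
      then show "\<forall>\<^sub>F k in sequentially. dist (X (Suc k) e) (T x e) < d"
      proof eventually_elim
        case (elim k)
        have "\<bar>T (X k) e - T x e\<bar> \<le> d / 2"
          using elim d e xr Xr by (intro contr) (auto simp: dist_real_def less_imp_le)
        then show ?case using d by (simp add: XS dist_real_def)
      qed
    qed
    moreover have "(\<lambda>k. X (Suc k) e) \<longlonglongrightarrow> x e" using conv[OF e] by (rule LIMSEQ_Suc)
    ultimately show ?thesis by (rule LIMSEQ_unique)
  qed
  then show ?thesis using xr by blast
qed

lemma exp_remainder_lipschitz:
  fixes x y r :: real
  assumes "\<bar>x\<bar> \<le> r" "\<bar>y\<bar> \<le> r" "r \<le> 1"
  shows "\<bar>(exp x - 1 - x) - (exp y - 1 - y)\<bar> \<le> 2 * r * \<bar>x - y\<bar>"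
proof -
  have bd: "\<bar>exp t - 1\<bar> \<le> 2 * r" if t: "\<bar>t\<bar> \<le> r" for t
  proof (cases "t \<ge> 0")
    case True
    then have "exp t \<le> 1 + t + t\<^sup>2" using t assms by (intro exp_bound) auto
    moreover have "t\<^sup>2 \<le> t * 1" unfolding power2_eq_square using True t assms by (intro mult_left_mono) auto
    moreover have "exp t \<ge> 1" using True by simp
    ultimately show ?thesis using True t by simp
  next
    case False
    then have "exp t \<le> 1" by simp
    then show ?thesis using exp_ge_add_one_self[of t] t by linarith
  qed
  have "norm ((exp x - 1 - x) - (exp y - 1 - y)) \<le> (2 * r) * norm (x - y)"
  proof (rule field_differentiable_bound[where S = "{-r..r}" and f' = "\<lambda>t. exp t - 1"])
    show "((\<lambda>t. exp t - 1 - t) has_field_derivative exp z - 1) (at z within {-r..r})" for z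
      by (auto intro!: derivative_eq_intros)
    show "norm (exp z - 1) \<le> 2 * r" if "z \<in> {-r..r}" for z :: real
      using bd[of z] that by auto
  qed (use assms in auto)
  then show ?thesis by simp
qed

section \<open>Solving the score equations for given data\<close>

text \<open>The coefficient family \<open>c\<close> is meant to be the weighted projection of the covariates \<open>z\<close> onto the node
effects, as in \<open>info_H_residual\<close>; \<open>gram\<close> is then the Schur complement.\<close>

definition residual :: "nat \<Rightarrow> (nat \<Rightarrow> nat \<times> nat \<Rightarrow> real) \<Rightarrow> (nat \<Rightarrow> nat \<Rightarrow> real) \<Rightarrow> nat \<Rightarrow> nat \<times> nat \<Rightarrow> real" where
  "residual n z c k e = z k e - node_effect n (c k) e"

definition gram :: "nat \<Rightarrow> (nat \<times> nat \<Rightarrow> real) \<Rightarrow> (nat \<Rightarrow> nat \<times> nat \<Rightarrow> real) \<Rightarrow> (nat \<Rightarrow> nat \<Rightarrow> real) \<Rightarrow> nat \<Rightarrow> nat \<Rightarrow> real" where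
  "gram n l z c k m = (\<Sum>e\<in>pairs n. l e * residual n z c k e * z m e)"

definition node_sums_le :: "nat \<Rightarrow> (nat \<times> nat \<Rightarrow> real) \<Rightarrow> real \<Rightarrow> bool" where
  "node_sums_le n h s \<longleftrightarrow> (\<forall>i<n. \<bar>\<Sum>j\<in>{..<n} - {i}. h (i, j)\<bar> \<le> s) \<and> (\<forall>j<n. \<bar>\<Sum>i\<in>{..<n} - {j}. h (i, j)\<bar> \<le> s)"

lemma node_sums_le_add:
  "node_sums_le n g s \<Longrightarrow> node_sums_le n h t \<Longrightarrow> node_sums_le n (\<lambda>e. g e + h e) (s + t)"
  unfolding node_sums_le_def sum.distrib by (meson abs_triangle_ineq add_mono order_trans)

lemma node_sums_le_pointwise:
  assumes "\<And>e. e \<in> pairs n \<Longrightarrow> \<bar>h e\<bar> \<le> b" "b \<ge> 0"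
  shows "node_sums_le n h (real n * b)"
proof -
  have *: "\<bar>\<Sum>j\<in>{..<n} - {i}. f j\<bar> \<le> real n * b" if "\<And>j. j < n \<Longrightarrow> j \<noteq> i \<Longrightarrow> \<bar>f j\<bar> \<le> b" for i f
  proof -
    have "\<bar>\<Sum>j\<in>{..<n} - {i}. f j\<bar> \<le> (\<Sum>j\<in>{..<n} - {i}. \<bar>f j\<bar>)" by (rule sum_abs)
    also have "\<dots> \<le> real (card ({..<n} - {i})) * b" using that by (intro sum_bounded_above) auto
    also have "\<dots> \<le> real n * b"
      using assms(2) card_mono[of "{..<n}" "{..<n} - {i}"] by (intro mult_right_mono) auto
    finally show ?thesis .
  qed
  show ?thesis unfolding node_sums_le_def
    using * assms by (auto simp: pairs_def intro!: *)
qed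

lemma card_pairs_le: "real (card (pairs n)) \<le> (real n)\<^sup>2"
proof -
  have "card (pairs n) \<le> card ({..<n} \<times> {..<n})" by (intro card_mono) (auto simp: pairs_def)
  then show ?thesis by (simp add: power2_eq_square flip: of_nat_mult)
qed

lemma abs_sum_pairs_le:
  assumes "\<And>e. e \<in> pairs n \<Longrightarrow> \<bar>f e\<bar> \<le> b" "b \<ge> 0"
  shows "\<bar>\<Sum>e\<in>pairs n. f e\<bar> \<le> (real n)\<^sup>2 * b"
proof -
  have "\<bar>\<Sum>e\<in>pairs n. f e\<bar> \<le> (\<Sum>e\<in>pairs n. \<bar>f e\<bar>)" by (rule sum_abs)
  also have "\<dots> \<le> real (card (pairs n)) * b" using assms by (intro sum_bounded_above) auto
  also have "\<dots> \<le> (real n)\<^sup>2 * b" using card_pairs_le assms by (intro mult_right_mono) auto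
  finally show ?thesis .
qed

text \<open>The deterministic data of the problem: true intensities \<open>l\<close> between \<open>1 / E\<close> and \<open>E\<close>, bounded
covariates \<open>z\<close> with their projections \<open>c\<close> onto the node effects, and the inverse \<open>Gi\<close> of the Schur
complement with its row sum bound.\<close>

locale orthogonalised_network =
  fixes n p :: nat and l :: "nat \<times> nat \<Rightarrow> real"
    and z :: "nat \<Rightarrow> nat \<times> nat \<Rightarrow> real" and c :: "nat \<Rightarrow> nat \<Rightarrow> real"
    and Gi :: "nat \<Rightarrow> nat \<Rightarrow> real" and E q \<kappa> :: real
  assumes n: "n \<ge> 3" and p: "p \<ge> 1" and E: "E \<ge> 1" and q: "q \<ge> 1"
    and l: "\<And>e. e \<in> pairs n \<Longrightarrow> 1 / E \<le> l e \<and> l e \<le> E"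
    and z: "\<And>k e. k < p \<Longrightarrow> e \<in> pairs n \<Longrightarrow> \<bar>z k e\<bar> \<le> q"
    and orth: "\<And>k r. k < p \<Longrightarrow> r < 2 * n - 1 \<Longrightarrow> (\<Sum>e\<in>pairs n. incidence n r e * (l e * residual n z c k e)) = 0"
    and gram_Gi: "\<And>k m. k < p \<Longrightarrow> m < p \<Longrightarrow> (\<Sum>j<p. gram n l z c k j * Gi j m) = of_bool (k = m)"
    and Gi_gram: "\<And>k m. k < p \<Longrightarrow> m < p \<Longrightarrow> (\<Sum>j<p. Gi k j * gram n l z c j m) = of_bool (k = m)"
    and Gi: "\<And>k. k < p \<Longrightarrow> (\<Sum>j<p. \<bar>Gi k j\<bar>) \<le> \<kappa> / (real n)\<^sup>2"
begin

abbreviation "zt \<equiv> residual n z c"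
abbreviation "G \<equiv> gram n l z c"

lemma l_pos: "e \<in> pairs n \<Longrightarrow> l e > 0"
  using l[of e] E by (auto intro: less_le_trans[of 0 "1 / E"])

lemma kappa_nonneg: "\<kappa> \<ge> 0"
proof -
  have "0 \<le> (\<Sum>j<p. \<bar>Gi 0 j\<bar>)" by (intro sum_nonneg) auto
  then have "0 \<le> \<kappa> / (real n)\<^sup>2" using Gi[of 0] p by linarith
  then show ?thesis using n by (simp add: zero_le_divide_iff)
qed

text \<open>The factor \<open>9\<close> is the \<open>3\<close> of the network estimate times a \<open>3\<close> for replacing \<open>n - 2\<close> by
\<open>n\<close>.\<close>

lemma node_bound:
  assumes eq: "\<And>r. r < 2 * n - 1 \<Longrightarrow> (\<Sum>e\<in>pairs n. incidence n r e * (l e * node_effect n x e - h e)) = 0"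
    and h: "node_sums_le n h s" and e: "e \<in> pairs n"
  shows "\<bar>node_effect n x e\<bar> \<le> 9 * E ^ 3 * s / real n"
proof -
  have E0: "E > 0" using E by simp
  have "(1 / E)\<^sup>2 * (real n - 2) * \<bar>node_effect n x e\<bar> \<le> 3 * E * s"
    using n E0 l h e eq by (intro node_equations_bound[where l = l and h = h]) (auto simp: node_sums_le_def)
  then have "E\<^sup>2 * ((1 / E)\<^sup>2 * (real n - 2) * \<bar>node_effect n x e\<bar>) \<le> E\<^sup>2 * (3 * E * s)"
    by (intro mult_left_mono) auto
  also have "E\<^sup>2 * ((1 / E)\<^sup>2 * (real n - 2) * \<bar>node_effect n x e\<bar>) = (real n - 2) * \<bar>node_effect n x e\<bar>"
    using E0 by (simp add: power_divide)
  finally have "(real n - 2) * \<bar>node_effect n x e\<bar> \<le> 3 * E ^ 3 * s" by (simp add: power2_eq_square power3_eq_cube)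
  moreover have "real n / 3 * \<bar>node_effect n x e\<bar> \<le> (real n - 2) * \<bar>node_effect n x e\<bar>"
    using n by (intro mult_right_mono) auto
  ultimately have "real n * \<bar>node_effect n x e\<bar> \<le> 9 * E ^ 3 * s" by linarith
  then show ?thesis using n by (simp add: field_simps)
qed

text \<open>The projection of a covariate solves node equations with right-hand side \<open>l e * z k e\<close>, whose row and
column sums are at most \<open>n * E * q\<close>.\<close>

lemma zt_bound:
  assumes k: "k < p" and e: "e \<in> pairs n"
  shows "\<bar>zt k e\<bar> \<le> 10 * q * E ^ 4"
proof -
  have "node_sums_le n (\<lambda>e. l e * z k e) (real n * (E * q))"
  proof (rule node_sums_le_pointwise)
    show "\<bar>l e * z k e\<bar> \<le> E * q" if "e \<in> pairs n" for e
      unfolding abs_mult using l[OF that] l_pos[OF that] z[OF k that] E by (intro mult_mono) auto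
  qed (use E q in auto)
  moreover have "(\<Sum>e\<in>pairs n. incidence n r e * (l e * node_effect n (c k) e - l e * z k e)) = 0" if "r < 2 * n - 1" for r
    using orth[OF k that] by (simp add: residual_def algebra_simps sum_subtractf)
  ultimately have "\<bar>node_effect n (c k) e\<bar> \<le> 9 * E ^ 3 * (real n * (E * q)) / real n"
    using e by (intro node_bound[where h = "\<lambda>e. l e * z k e"])
  then have "\<bar>node_effect n (c k) e\<bar> \<le> 9 * q * E ^ 4" using n by (simp add: power_numeral_reduce algebra_simps)
  moreover have "\<bar>z k e\<bar> \<le> q * E ^ 4"
  proof -
    have "q * 1 \<le> q * E ^ 4" using q one_le_power[OF E, of 4] by (intro mult_left_mono) auto
    then show ?thesis using z[OF k e] by linarith
  qed
  ultimately show ?thesis by (simp add: residual_def)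
qed

text \<open>The score equations linearised at the truth, with right-hand side \<open>h\<close>.\<close>

definition normal_eqs :: "(nat \<times> nat \<Rightarrow> real) \<Rightarrow> (nat \<Rightarrow> real) \<Rightarrow> (nat \<Rightarrow> real) \<Rightarrow> bool" where
  "normal_eqs h \<theta> \<gamma> \<longleftrightarrow>
     (\<forall>r<2 * n - 1. (\<Sum>e\<in>pairs n. incidence n r e * (l e * (node_effect n \<theta> e + (\<Sum>m<p. z m e * \<gamma> m)) - h e)) = 0) \<and>
     (\<forall>k<p. (\<Sum>e\<in>pairs n. z k e * (l e * (node_effect n \<theta> e + (\<Sum>m<p. z m e * \<gamma> m)) - h e)) = 0)"

text \<open>Shifting \<open>\<theta>\<close> by the projections of the covariates decouples the system: node equations alone for the
shifted parameter, and a system with the Gram matrix alone for \<open>\<gamma>\<close>.\<close>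

lemma normal_eqs_iff:
  defines "x \<equiv> \<lambda>\<theta> \<gamma> r. \<theta> r + (\<Sum>m<p. \<gamma> m * c m r)"
  shows "node_effect n \<theta> e + (\<Sum>m<p. z m e * \<gamma> m) = node_effect n (x \<theta> \<gamma>) e + (\<Sum>m<p. zt m e * \<gamma> m)"
    and "normal_eqs h \<theta> \<gamma> \<longleftrightarrow>
     (\<forall>r<2 * n - 1. (\<Sum>e\<in>pairs n. incidence n r e * (l e * node_effect n (x \<theta> \<gamma>) e - h e)) = 0) \<and>
     (\<forall>k<p. (\<Sum>m<p. G k m * \<gamma> m) = (\<Sum>e\<in>pairs n. zt k e * h e))"
proof -
  define y where "y e = node_effect n \<theta> e + (\<Sum>m<p. z m e * \<gamma> m)" for e
  have y: "y e = node_effect n (x \<theta> \<gamma>) e + (\<Sum>m<p. zt m e * \<gamma> m)" for e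
    by (simp add: y_def x_def node_effect_add node_effect_sum node_effect_scale residual_def algebra_simps sum.distrib sum_subtractf)
  then show "node_effect n \<theta> e + (\<Sum>m<p. z m e * \<gamma> m) = node_effect n (x \<theta> \<gamma>) e + (\<Sum>m<p. zt m e * \<gamma> m)"
    by (simp add: y_def)
  have orth_node_effect: "(\<Sum>e\<in>pairs n. node_effect n t e * (l e * zt k e)) = 0" if "k < p" for t k
    using orth[OF that] by (subst sum_incidence_node_effect[symmetric]) simp
  have node: "(\<Sum>e\<in>pairs n. incidence n r e * (l e * y e - h e)) = (\<Sum>e\<in>pairs n. incidence n r e * (l e * node_effect n (x \<theta> \<gamma>) e - h e))"
    if r: "r < 2 * n - 1" for r
  proof -
    have "(\<Sum>e\<in>pairs n. incidence n r e * (l e * y e - h e))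
        = (\<Sum>e\<in>pairs n. incidence n r e * (l e * node_effect n (x \<theta> \<gamma>) e - h e)) + (\<Sum>e\<in>pairs n. \<Sum>m<p. \<gamma> m * (incidence n r e * (l e * zt m e)))"
      unfolding y by (simp add: algebra_simps sum.distrib sum_subtractf sum_distrib_left)
    also have "(\<Sum>e\<in>pairs n. \<Sum>m<p. \<gamma> m * (incidence n r e * (l e * zt m e))) = (\<Sum>m<p. \<gamma> m * (\<Sum>e\<in>pairs n. incidence n r e * (l e * zt m e)))"
      unfolding sum_distrib_left by (rule sum.swap)
    also have "\<dots> = 0" using orth r by (intro sum.neutral) auto
    finally show ?thesis by simp
  qed
  have covariate: "(\<Sum>e\<in>pairs n. z k e * (l e * y e - h e)) = (\<Sum>m<p. G k m * \<gamma> m) - (\<Sum>e\<in>pairs n. zt k e * h e)"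
    if k: "k < p" and nd: "\<forall>r<2 * n - 1. (\<Sum>e\<in>pairs n. incidence n r e * (l e * y e - h e)) = 0" for k
  proof -
    have "(\<Sum>e\<in>pairs n. node_effect n (c k) e * (l e * y e - h e)) = 0"
      using nd by (subst sum_incidence_node_effect[symmetric]) simp
    then have "(\<Sum>e\<in>pairs n. z k e * (l e * y e - h e)) = (\<Sum>e\<in>pairs n. zt k e * (l e * y e - h e))"
      by (simp add: residual_def left_diff_distrib sum_subtractf)
    also have "\<dots> = (\<Sum>e\<in>pairs n. node_effect n \<theta> e * (l e * zt k e)) + (\<Sum>e\<in>pairs n. \<Sum>m<p. l e * zt k e * z m e * \<gamma> m)
        - (\<Sum>e\<in>pairs n. zt k e * h e)"
      by (simp add: y_def algebra_simps sum.distrib sum_subtractf sum_distrib_left)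
    also have "(\<Sum>e\<in>pairs n. \<Sum>m<p. l e * zt k e * z m e * \<gamma> m) = (\<Sum>m<p. G k m * \<gamma> m)"
      unfolding gram_def sum_distrib_right by (rule sum.swap)
    finally show ?thesis using orth_node_effect[OF k] by simp
  qed
  show "normal_eqs h \<theta> \<gamma> \<longleftrightarrow>
     (\<forall>r<2 * n - 1. (\<Sum>e\<in>pairs n. incidence n r e * (l e * node_effect n (x \<theta> \<gamma>) e - h e)) = 0) \<and>
     (\<forall>k<p. (\<Sum>m<p. G k m * \<gamma> m) = (\<Sum>e\<in>pairs n. zt k e * h e))"
    unfolding normal_eqs_def y_def[symmetric] using node covariate by auto
qed

lemma normal_eqs_solvable: "\<exists>\<theta> \<gamma>. normal_eqs h \<theta> \<gamma>"
proof -
  obtain x where x: "\<forall>r<2 * n - 1. (\<Sum>e\<in>pairs n. incidence n r e * (l e * node_effect n x e - h e)) = 0"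
    using node_equations_solvable[of n l, OF n l_pos] by blast
  define t where "t k = (\<Sum>e\<in>pairs n. zt k e * h e)" for k
  define \<gamma> where "\<gamma> m = (\<Sum>j<p. Gi m j * t j)" for m
  have "(\<Sum>m<p. G k m * \<gamma> m) = t k" if k: "k < p" for k
  proof -
    have "(\<Sum>m<p. G k m * \<gamma> m) = (\<Sum>j<p. (\<Sum>m<p. G k m * Gi m j) * t j)"
      unfolding \<gamma>_def sum_distrib_left sum_distrib_right by (subst sum.swap) (simp add: mult.assoc)
    also have "\<dots> = (\<Sum>j<p. if j = k then t k else 0)" using k by (intro sum.cong) (auto simp: gram_Gi)
    finally show ?thesis using k by simp
  qed
  then have "normal_eqs h (\<lambda>r. x r - (\<Sum>m<p. \<gamma> m * c m r)) \<gamma>"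
    unfolding normal_eqs_iff(2) using x by (simp add: t_def)
  then show ?thesis by blast
qed

lemma normal_eqs_diff:
  assumes "normal_eqs h \<theta> \<gamma>" "normal_eqs h' \<theta>' \<gamma>'"
  shows "normal_eqs (\<lambda>e. h e - h' e) (\<lambda>r. \<theta> r - \<theta>' r) (\<lambda>k. \<gamma> k - \<gamma>' k)"
proof -
  have *: "l e * (node_effect n (\<lambda>r. \<theta> r - \<theta>' r) e + (\<Sum>m<p. z m e * (\<gamma> m - \<gamma>' m))) - (h e - h' e)
     = (l e * (node_effect n \<theta> e + (\<Sum>m<p. z m e * \<gamma> m)) - h e) - (l e * (node_effect n \<theta>' e + (\<Sum>m<p. z m e * \<gamma>' m)) - h' e)" for e
    by (simp add: node_effect_diff algebra_simps sum_subtractf)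
  have split: "(\<Sum>e\<in>pairs n. f e * (l e * (node_effect n (\<lambda>r. \<theta> r - \<theta>' r) e + (\<Sum>m<p. z m e * (\<gamma> m - \<gamma>' m))) - (h e - h' e)))
     = (\<Sum>e\<in>pairs n. f e * (l e * (node_effect n \<theta> e + (\<Sum>m<p. z m e * \<gamma> m)) - h e))
       - (\<Sum>e\<in>pairs n. f e * (l e * (node_effect n \<theta>' e + (\<Sum>m<p. z m e * \<gamma>' m)) - h' e))" for f
    unfolding * right_diff_distrib[of "f _"] sum_subtractf ..
  show ?thesis
    using assms unfolding normal_eqs_def split by simp
qed

lemma normal_eqs_bound:
  assumes eq: "normal_eqs h \<theta> \<gamma>" and h: "node_sums_le n h s"
    and t: "\<And>k. k < p \<Longrightarrow> \<bar>\<Sum>e\<in>pairs n. zt k e * h e\<bar> \<le> t"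
  shows "k < p \<Longrightarrow> \<bar>\<gamma> k\<bar> \<le> \<kappa> / (real n)\<^sup>2 * t"
    and "e \<in> pairs n \<Longrightarrow> \<bar>node_effect n \<theta> e + (\<Sum>m<p. z m e * \<gamma> m)\<bar>
       \<le> 9 * E ^ 3 * s / real n + real p * (10 * q * E ^ 4) * (\<kappa> / (real n)\<^sup>2 * t)"
proof -
  have t0: "t \<ge> 0" using t[of 0] p by linarith
  show g: "\<bar>\<gamma> k\<bar> \<le> \<kappa> / (real n)\<^sup>2 * t" if k: "k < p" for k
  proof -
    have "(\<Sum>j<p. Gi k j * (\<Sum>m<p. G j m * \<gamma> m)) = (\<Sum>m<p. (\<Sum>j<p. Gi k j * G j m) * \<gamma> m)"
      unfolding sum_distrib_left sum_distrib_right by (subst sum.swap) (simp add: mult.assoc)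
    also have "\<dots> = (\<Sum>m<p. if m = k then \<gamma> k else 0)" using k by (intro sum.cong) (auto simp: Gi_gram)
    finally have "\<gamma> k = (\<Sum>j<p. Gi k j * (\<Sum>e\<in>pairs n. zt j e * h e))"
      using k eq by (simp add: normal_eqs_iff(2))
    also have "\<bar>\<dots>\<bar> \<le> (\<Sum>j<p. \<bar>Gi k j\<bar> * t)"
      by (rule order_trans[OF sum_abs]) (auto simp: abs_mult intro!: sum_mono mult_left_mono t)
    also have "\<dots> \<le> \<kappa> / (real n)\<^sup>2 * t"
      unfolding sum_distrib_right[symmetric] using Gi[OF k] t0 by (rule mult_right_mono)
    finally show ?thesis .
  qed
  assume e: "e \<in> pairs n"
  let ?x = "\<lambda>r. \<theta> r + (\<Sum>m<p. \<gamma> m * c m r)"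
  have "\<bar>node_effect n ?x e\<bar> \<le> 9 * E ^ 3 * s / real n"
    using eq h e by (intro node_bound[where h = h]) (auto simp: normal_eqs_iff(2))
  moreover have "\<bar>\<Sum>m<p. zt m e * \<gamma> m\<bar> \<le> real p * ((10 * q * E ^ 4) * (\<kappa> / (real n)\<^sup>2 * t))"
  proof -
    have "\<bar>\<Sum>m<p. zt m e * \<gamma> m\<bar> \<le> (\<Sum>m<p. \<bar>zt m e * \<gamma> m\<bar>)" by (rule sum_abs)
    also have "\<dots> \<le> real (card {..<p}) * ((10 * q * E ^ 4) * (\<kappa> / (real n)\<^sup>2 * t))"
      unfolding abs_mult using zt_bound[OF _ e] g E q by (intro sum_bounded_above mult_mono) auto
    finally show ?thesis by simp
  qed
  ultimately show "\<bar>node_effect n \<theta> e + (\<Sum>m<p. z m e * \<gamma> m)\<bar>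
       \<le> 9 * E ^ 3 * s / real n + real p * (10 * q * E ^ 4) * (\<kappa> / (real n)\<^sup>2 * t)"
    unfolding normal_eqs_iff(1) by (simp add: mult.assoc)
qed

text \<open>A function \<open>x\<close> on pairs is sent to the linear predictor of a solution of the normal equations whose
right-hand side is the noise minus the exponential remainder at \<open>x\<close>.  At a fixed point the linear terms
cancel and the score equations remain.  The noise moves the predictor by at most
\<open>27 * E ^ 4 * \<eta>\<close> through the node equations; the box has twice this radius, and the smallness hypotheses
make all other contributions fit into the second half.\<close>

lemma score_solution:
  fixes w :: "nat \<times> nat \<Rightarrow> real" and \<eta> :: real
  assumes \<eta>: "\<eta> \<ge> 0"
    and w: "node_sums_le n w (3 * E * real n * \<eta>)"
    and weight: "\<And>k. k < p \<Longrightarrow> \<bar>\<Sum>e\<in>pairs n. zt k e * w e\<bar> \<le> 3 * (10 * q * E ^ 4) * E * (real n)\<^sup>2 * \<eta>\<^sup>2"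
    and small1: "E ^ 8 * \<eta> \<le> 1 / (10 ^ 5 * real p * q\<^sup>2)"
    and small2: "\<kappa> * E ^ 13 * \<eta> \<le> 1 / (10 ^ 5 * real p * q\<^sup>2)"
  shows "\<exists>\<theta> \<gamma>. (\<forall>r<2 * n - 1. (\<Sum>e\<in>pairs n. incidence n r e *
          (l e * exp (node_effect n \<theta> e + (\<Sum>m<p. z m e * \<gamma> m)) - (l e + w e))) = 0) \<and>
      (\<forall>k<p. (\<Sum>e\<in>pairs n. z k e *
          (l e * exp (node_effect n \<theta> e + (\<Sum>m<p. z m e * \<gamma> m)) - (l e + w e))) = 0) \<and>
      (\<forall>k<p. \<bar>\<gamma> k\<bar> \<le> 10 ^ 5 * q * (\<kappa> * E ^ 13 * \<eta>\<^sup>2)) \<and>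
      (\<forall>e\<in>pairs n. \<bar>node_effect n \<theta> e + (\<Sum>m<p. z m e * \<gamma> m)\<bar> \<le> 54 * E ^ 4 * \<eta>)"
proof -
  define \<psi> where "\<psi> t = exp t - 1 - t" for t :: real
  define r where "r = 54 * E ^ 4 * \<eta>"
  define b where "b = 10 * q * E ^ 4"
  define h where "h x e = w e - l e * \<psi> (x e)" for x e
  define sol where "sol x = (SOME s. normal_eqs (h x) (fst s) (snd s))" for x
  define T where "T x e = node_effect n (fst (sol x)) e + (\<Sum>m<p. z m e * snd (sol x) m)" for x e
  have sol: "normal_eqs (h x) (fst (sol x)) (snd (sol x))" for x
  proof -
    have "\<exists>s. normal_eqs (h x) (fst s) (snd s)" using normal_eqs_solvable[of "h x"] by auto
    then show ?thesis unfolding sol_def by (rule someI_ex)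
  qed
  have q2: "real p * q\<^sup>2 \<ge> 1"
    using p q mult_mono[of 1 "real p" 1 "q\<^sup>2"] by (simp add: one_le_power)
  have E4: "E ^ 4 \<le> E ^ 8" "1 \<le> E ^ 4" using E by (auto intro: power_increasing one_le_power)
  have "1 / (10 ^ 5 * real p * q\<^sup>2) \<le> 1 / 10 ^ 5"
    using q2 by (intro divide_left_mono) (auto simp: mult.assoc)
  then have s1: "E ^ 8 * \<eta> \<le> 1 / 10 ^ 5" using small1 by linarith
  have s2: "real p * q\<^sup>2 * (\<kappa> * E ^ 13 * \<eta>) \<le> 1 / 10 ^ 5"
    using small2 q2 by (simp add: field_simps)
  have r0: "r \<ge> 0" using E \<eta> by (simp add: r_def)
  have r1: "r \<le> 1"
  proof -
    have "E ^ 4 * \<eta> \<le> E ^ 8 * \<eta>" using E4 \<eta> by (intro mult_right_mono)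
    then show ?thesis using s1 by (simp add: r_def)
  qed
  have rr: "r\<^sup>2 = 2916 * (E ^ 8 * \<eta>\<^sup>2)" by (simp add: r_def power_mult_distrib flip: power_mult)
  have b0: "b \<ge> 0" using E q by (simp add: b_def)
  have \<psi>: "\<bar>\<psi> s - \<psi> t\<bar> \<le> 2 * r * \<bar>s - t\<bar>" if "\<bar>s\<bar> \<le> r" "\<bar>t\<bar> \<le> r" for s t
    unfolding \<psi>_def by (rule exp_remainder_lipschitz[OF that r1])
  have \<psi>0: "\<bar>\<psi> s\<bar> \<le> 2 * r\<^sup>2" if s: "\<bar>s\<bar> \<le> r" for s
  proof -
    have "\<bar>\<psi> s\<bar> \<le> 2 * r * \<bar>s\<bar>" using \<psi>[of s 0] s r0 by (simp add: \<psi>_def)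
    also have "\<dots> \<le> 2 * r * r" using s r0 by (intro mult_left_mono) auto
    finally show ?thesis by (simp add: power2_eq_square)
  qed
  have lb: "\<bar>l e * u\<bar> \<le> E * v" if "e \<in> pairs n" "\<bar>u\<bar> \<le> v" for e u v
    unfolding abs_mult using that l[of e] l_pos[of e] E by (intro mult_mono) auto
  have ztb: "\<bar>\<Sum>e\<in>pairs n. zt k e * (l e * f e)\<bar> \<le> (real n)\<^sup>2 * (b * (E * v))"
    if k: "k < p" and f: "\<And>e. e \<in> pairs n \<Longrightarrow> \<bar>f e\<bar> \<le> v" and v: "v \<ge> 0" for k f v
  proof (rule abs_sum_pairs_le)
    show "\<bar>zt k e * (l e * f e)\<bar> \<le> b * (E * v)" if e: "e \<in> pairs n" for e
      unfolding abs_mult[of "zt k e"] b_def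
      using zt_bound[OF k e] lb[OF e f[OF e]] E q by (intro mult_mono) auto
  qed (use b0 E v in auto)
  have bound: "(\<forall>k<p. \<bar>snd (sol x) k\<bar> \<le> \<kappa> * b * E * (3 * \<eta>\<^sup>2 + 2 * r\<^sup>2)) \<and> (\<forall>e\<in>pairs n. \<bar>T x e\<bar> \<le> r)"
    if x: "\<And>e. e \<in> pairs n \<Longrightarrow> \<bar>x e\<bar> \<le> r" for x
  proof -
    have "node_sums_le n (\<lambda>e. w e + - (l e * \<psi> (x e))) (3 * E * real n * \<eta> + real n * (E * (2 * r\<^sup>2)))"
      using lb \<psi>0 x E by (intro node_sums_le_add w node_sums_le_pointwise) auto
    then have hs: "node_sums_le n (h x) (3 * E * real n * \<eta> + real n * (E * (2 * r\<^sup>2)))"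
      by (simp add: h_def[abs_def])
    have ht: "\<bar>\<Sum>e\<in>pairs n. zt k e * h x e\<bar> \<le> 3 * b * E * (real n)\<^sup>2 * \<eta>\<^sup>2 + (real n)\<^sup>2 * (b * (E * (2 * r\<^sup>2)))"
      if k: "k < p" for k
    proof -
      have "(\<Sum>e\<in>pairs n. zt k e * h x e) = (\<Sum>e\<in>pairs n. zt k e * w e) - (\<Sum>e\<in>pairs n. zt k e * (l e * \<psi> (x e)))"
        by (simp add: h_def right_diff_distrib sum_subtractf)
      moreover have "\<bar>\<Sum>e\<in>pairs n. zt k e * (l e * \<psi> (x e))\<bar> \<le> (real n)\<^sup>2 * (b * (E * (2 * r\<^sup>2)))"
        using \<psi>0 x by (intro ztb[OF k]) auto
      ultimately show ?thesis using weight[OF k] by (simp add: b_def)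
    qed
    have t_eq: "\<kappa> / (real n)\<^sup>2 * (3 * b * E * (real n)\<^sup>2 * \<eta>\<^sup>2 + (real n)\<^sup>2 * (b * (E * (2 * r\<^sup>2)))) = \<kappa> * b * E * (3 * \<eta>\<^sup>2 + 2 * r\<^sup>2)"
      using n by (simp add: field_simps)
    have s_eq: "9 * E ^ 3 * (3 * E * real n * \<eta> + real n * (E * (2 * r\<^sup>2))) / real n = 27 * E ^ 4 * \<eta> + 18 * E ^ 4 * r\<^sup>2"
      using n by (simp add: field_simps power_numeral_reduce)
    have "\<bar>T x e\<bar> \<le> r" if e: "e \<in> pairs n" for e
    proof -
      have "\<bar>T x e\<bar> \<le> 27 * E ^ 4 * \<eta> + 18 * E ^ 4 * r\<^sup>2 + real p * b * (\<kappa> * b * E * (3 * \<eta>\<^sup>2 + 2 * r\<^sup>2))"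
        using normal_eqs_bound(2)[OF sol hs ht e] unfolding t_eq s_eq b_def[symmetric] T_def by simp
      also have "18 * E ^ 4 * r\<^sup>2 = 52488 * (E ^ 8 * \<eta>) * (E ^ 4 * \<eta>)"
        unfolding rr by (simp add: power2_eq_square)
      also have "\<dots> \<le> 52488 * (1 / 10 ^ 5) * (E ^ 4 * \<eta>)"
        using s1 E \<eta> by (intro mult_right_mono mult_left_mono) auto
      also have "real p * b * (\<kappa> * b * E * (3 * \<eta>\<^sup>2 + 2 * r\<^sup>2)) \<le> real p * b * (\<kappa> * b * E * (5835 * (E ^ 8 * \<eta>\<^sup>2)))"
      proof -
        have "1 * \<eta>\<^sup>2 \<le> E ^ 8 * \<eta>\<^sup>2" using E by (intro mult_right_mono one_le_power) auto
        then have "3 * \<eta>\<^sup>2 + 2 * r\<^sup>2 \<le> 5835 * (E ^ 8 * \<eta>\<^sup>2)" unfolding rr by linarith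
        then show ?thesis using b0 E kappa_nonneg by (intro mult_left_mono) auto
      qed
      also have "real p * b * (\<kappa> * b * E * (5835 * (E ^ 8 * \<eta>\<^sup>2))) = 583500 * (real p * q\<^sup>2 * (\<kappa> * E ^ 13 * \<eta>)) * (E ^ 4 * \<eta>)"
        by (simp add: b_def power2_eq_square power_numeral_reduce)
      also have "\<dots> \<le> 583500 * (1 / 10 ^ 5) * (E ^ 4 * \<eta>)"
        using s2 E \<eta> by (intro mult_right_mono mult_left_mono) auto
      finally have "\<bar>T x e\<bar> \<le> 27 * (E ^ 4 * \<eta>) + 52488 * (1 / 10 ^ 5) * (E ^ 4 * \<eta>) + 583500 * (1 / 10 ^ 5) * (E ^ 4 * \<eta>)"
        by simp
      moreover have "E ^ 4 * \<eta> \<ge> 0" using E \<eta> by simp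
      ultimately have "\<bar>T x e\<bar> \<le> 54 * (E ^ 4 * \<eta>)" by (simp add: mult.commute[of \<eta>])
      then show ?thesis by (simp add: r_def)
    qed
    moreover have "\<bar>snd (sol x) k\<bar> \<le> \<kappa> * b * E * (3 * \<eta>\<^sup>2 + 2 * r\<^sup>2)" if "k < p" for k
      using normal_eqs_bound(1)[OF sol hs ht that] unfolding t_eq by simp
    ultimately show ?thesis by blast
  qed
  have contr: "\<bar>T x e - T y e\<bar> \<le> d / 2"
    if x: "\<And>e. e \<in> pairs n \<Longrightarrow> \<bar>x e\<bar> \<le> r" and y: "\<And>e. e \<in> pairs n \<Longrightarrow> \<bar>y e\<bar> \<le> r"
      and d: "d \<ge> 0" "\<And>e. e \<in> pairs n \<Longrightarrow> \<bar>x e - y e\<bar> \<le> d" and e: "e \<in> pairs n" for x y d e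
  proof -
    have f: "\<bar>\<psi> (y e) - \<psi> (x e)\<bar> \<le> 2 * r * d" if e: "e \<in> pairs n" for e
      using \<psi>[OF y[OF e] x[OF e]] d(2)[OF e] r0 mult_left_mono[of "\<bar>y e - x e\<bar>" d "2 * r"]
      by (simp add: abs_minus_commute)
    have hd: "h x e - h y e = l e * (\<psi> (y e) - \<psi> (x e))" for e by (simp add: h_def algebra_simps)
    have hs: "node_sums_le n (\<lambda>e. h x e - h y e) (real n * (E * (2 * r * d)))"
      unfolding hd using lb f E r0 d by (intro node_sums_le_pointwise) auto
    have ht: "\<bar>\<Sum>e\<in>pairs n. zt k e * (h x e - h y e)\<bar> \<le> (real n)\<^sup>2 * (b * (E * (2 * r * d)))" if k: "k < p" for k
      unfolding hd using f r0 d by (intro ztb[OF k]) auto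
    have t_eq: "\<kappa> / (real n)\<^sup>2 * ((real n)\<^sup>2 * (b * (E * (2 * r * d)))) = \<kappa> * b * E * 2 * r * d"
      using n by (simp add: field_simps)
    have s_eq: "9 * E ^ 3 * (real n * (E * (2 * r * d))) / real n = 18 * E ^ 4 * r * d"
      using n by (simp add: field_simps power_numeral_reduce)
    have "T x e - T y e = node_effect n (\<lambda>i. fst (sol x) i - fst (sol y) i) e + (\<Sum>m<p. z m e * (snd (sol x) m - snd (sol y) m))"
      by (simp add: T_def node_effect_diff algebra_simps sum_subtractf)
    then have "\<bar>T x e - T y e\<bar> \<le> 18 * E ^ 4 * r * d + real p * b * (\<kappa> * b * E * 2 * r * d)"
      using normal_eqs_bound(2)[OF normal_eqs_diff[OF sol sol] hs ht e] unfolding t_eq s_eq b_def[symmetric] by simp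
    also have "\<dots> = (972 * (E ^ 8 * \<eta>) + 10800 * (real p * q\<^sup>2 * (\<kappa> * E ^ 13 * \<eta>))) * d"
      by (simp add: r_def b_def power2_eq_square power_numeral_reduce algebra_simps)
    also have "\<dots> \<le> (972 * (1 / 10 ^ 5) + 10800 * (1 / 10 ^ 5)) * d"
      using s1 s2 d by (intro mult_right_mono add_mono mult_left_mono) auto
    also have "\<dots> \<le> d / 2" using d by simp
    finally show ?thesis .
  qed
  obtain x where x: "\<And>e. e \<in> pairs n \<Longrightarrow> \<bar>x e\<bar> \<le> r" "\<And>e. e \<in> pairs n \<Longrightarrow> T x e = x e"
    using maxnorm_contraction_fixpoint[of "pairs n" r T] r0 bound contr by blast
  define \<theta> \<gamma> where "\<theta> = fst (sol x)" and "\<gamma> = snd (sol x)"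
  have y: "node_effect n \<theta> e + (\<Sum>m<p. z m e * \<gamma> m) = x e" if "e \<in> pairs n" for e
    using x(2)[OF that] by (simp add: T_def \<theta>_def \<gamma>_def)
  have res: "l e * (node_effect n \<theta> e + (\<Sum>m<p. z m e * \<gamma> m)) - h x e
      = l e * exp (node_effect n \<theta> e + (\<Sum>m<p. z m e * \<gamma> m)) - (l e + w e)" if "e \<in> pairs n" for e
    unfolding y[OF that] h_def \<psi>_def by (simp add: algebra_simps)
  have ne: "normal_eqs (h x) \<theta> \<gamma>" using sol by (simp add: \<theta>_def \<gamma>_def)
  have \<gamma>: "\<bar>\<gamma> k\<bar> \<le> 10 ^ 5 * q * (\<kappa> * E ^ 13 * \<eta>\<^sup>2)" if k: "k < p" for k
  proof -
    have "\<bar>\<gamma> k\<bar> \<le> \<kappa> * b * E * (3 * \<eta>\<^sup>2 + 2 * r\<^sup>2)" using bound[OF x(1)] k by (auto simp: \<gamma>_def)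
    also have "\<dots> \<le> \<kappa> * b * E * (10000 * (E ^ 8 * \<eta>\<^sup>2))"
    proof -
      have "1 * \<eta>\<^sup>2 \<le> E ^ 8 * \<eta>\<^sup>2" using E by (intro mult_right_mono one_le_power) auto
      then have "3 * \<eta>\<^sup>2 + 2 * r\<^sup>2 \<le> 10000 * (E ^ 8 * \<eta>\<^sup>2)"
        unfolding rr using zero_le_power2[of \<eta>] by linarith
      then show ?thesis using b0 E kappa_nonneg by (intro mult_left_mono) auto
    qed
    also have "\<dots> = 10 ^ 5 * q * (\<kappa> * E ^ 13 * \<eta>\<^sup>2)"
      by (simp add: b_def power_numeral_reduce)
    finally show ?thesis .
  qed
   have "(\<Sum>e\<in>pairs n. incidence n s e * (l e * exp (node_effect n \<theta> e + (\<Sum>m<p. z m e * \<gamma> m)) - (l e + w e))) = 0"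
      if "s < 2 * n - 1" for s
      using ne that unfolding normal_eqs_def by (simp add: res)
  moreover have "(\<Sum>e\<in>pairs n. z k e * (l e * exp (node_effect n \<theta> e + (\<Sum>m<p. z m e * \<gamma> m)) - (l e + w e))) = 0"
      if "k < p" for k
      using ne that unfolding normal_eqs_def by (simp add: res)
  moreover have "\<bar>node_effect n \<theta> e + (\<Sum>m<p. z m e * \<gamma> m)\<bar> \<le> 54 * E ^ 4 * \<eta>" if "e \<in> pairs n" for e
      using x(1)[OF that] unfolding y[OF that] by (simp add: r_def)
  ultimately show ?thesis using \<gamma> by blast
qed

end

section \<open>Verifying the setting for a network\<close>

text \<open>Positive definiteness makes \<open>H\<close> invertible, so that its unspecified inverse is a genuine one.\<close>

lemma orthogonalised_networkI:
  assumes n: "n \<ge> 3" and p: "p \<ge> 1" and q: "q \<ge> 1"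
    and \<theta>: "\<theta> \<in> carrier_vec (2 * n - 1)" and \<gamma>: "\<gamma> \<in> carrier_vec p"
    and l: "\<And>e. e \<in> pairs n \<Longrightarrow> exp (- \<rho>) \<le> intensity n Z \<theta> \<gamma> e \<and> intensity n Z \<theta> \<gamma> e \<le> exp \<rho>" and \<rho>: "\<rho> \<ge> 0"
    and z: "\<And>k e. k < p \<Longrightarrow> e \<in> pairs n \<Longrightarrow> \<bar>covariate Z k e\<bar> \<le> q"
    and pd: "pos_def_mat (info_H n p Z A \<theta> \<gamma>)"
    and \<kappa>: "mat_maxnorm (mat_inv (info_H n p Z A \<theta> \<gamma>)) \<le> \<kappa> / (real n)\<^sup>2"
  shows "\<exists>c Gi. orthogonalised_network n p (intensity n Z \<theta> \<gamma>) (covariate Z) c Gi (exp \<rho>) q \<kappa>"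
proof -
  define H where "H = info_H n p Z A \<theta> \<gamma>"
  obtain c where c: "\<forall>k<p. \<forall>r<2 * n - 1. (\<Sum>e\<in>pairs n. incidence n r e * (intensity n Z \<theta> \<gamma> e * (covariate Z k e - node_effect n (c k) e))) = 0"
    and H: "H \<in> carrier_mat p p"
    and Hc: "\<forall>k<p. \<forall>m<p. H $$ (k, m) = (\<Sum>e\<in>pairs n. intensity n Z \<theta> \<gamma> e * (covariate Z k e - node_effect n (c k) e) * covariate Z m e)"
    unfolding H_def using info_H_residual[OF n \<theta> \<gamma>] by blast
  note inv = pos_def_mat_inv[OF H pd[folded H_def]]
  have G: "gram n (intensity n Z \<theta> \<gamma>) (covariate Z) c k m = H $$ (k, m)" if "k < p" "m < p" for k m
    using Hc that by (simp add: gram_def residual_def)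
  have "orthogonalised_network n p (intensity n Z \<theta> \<gamma>) (covariate Z) c (\<lambda>k j. mat_inv H $$ (k, j)) (exp \<rho>) q \<kappa>"
  proof
    show "(\<Sum>e\<in>pairs n. incidence n r e * (intensity n Z \<theta> \<gamma> e * residual n (covariate Z) c k e)) = 0" if "k < p" "r < 2 * n - 1" for k r
      using c that by (simp add: residual_def)
    show "(\<Sum>j<p. gram n (intensity n Z \<theta> \<gamma>) (covariate Z) c k j * mat_inv H $$ (j, m)) = of_bool (k = m)" if k: "k < p" and m: "m < p" for k m
    proof -
      have "(H * mat_inv H) $$ (k, m) = (\<Sum>j<p. H $$ (k, j) * mat_inv H $$ (j, m))"
        using k m H inv(1) by (simp add: scalar_prod_def atLeast0LessThan)
      then show ?thesis using k m by (cases "k = m") (simp_all add: inv(2) G)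
    qed
    show "(\<Sum>j<p. mat_inv H $$ (k, j) * gram n (intensity n Z \<theta> \<gamma>) (covariate Z) c j m) = of_bool (k = m)" if k: "k < p" and m: "m < p" for k m
    proof -
      have "(mat_inv H * H) $$ (k, m) = (\<Sum>j<p. mat_inv H $$ (k, j) * H $$ (j, m))"
        using k m H inv(1) by (simp add: scalar_prod_def atLeast0LessThan)
      then show ?thesis using k m by (cases "k = m") (simp_all add: inv(3) G)
    qed
    show "(\<Sum>j<p. \<bar>mat_inv H $$ (k, j)\<bar>) \<le> \<kappa> / (real n)\<^sup>2" if "k < p" for k
      using mat_maxnorm_row[OF inv(1) that] \<kappa>[folded H_def] by linarith
  qed (use n p q l \<rho> z in \<open>auto simp: exp_minus field_simps\<close>)
  then show ?thesis by blast
qed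

text \<open>Comparing the upper left entries of \<open>Gi * G = 1\<close>: the entries of \<open>G\<close> are at most of order
\<open>n^2 * E^5\<close>, so the row sums of the inverse cannot be too small.\<close>

lemma (in orthogonalised_network) kappa_lower_bound: "1 \<le> 10 * q\<^sup>2 * (\<kappa> * E ^ 5)"
proof -
  have G: "\<bar>G j 0\<bar> \<le> (real n)\<^sup>2 * (E * (10 * q * E ^ 4) * q)" if j: "j < p" for j
    unfolding gram_def
  proof (rule abs_sum_pairs_le)
    show "\<bar>l e * zt j e * z 0 e\<bar> \<le> E * (10 * q * E ^ 4) * q" if e: "e \<in> pairs n" for e
      unfolding abs_mult using l[OF e] l_pos[OF e] zt_bound[OF j e] z[of 0 e] e p E q
      by (intro mult_mono) auto
  qed (use E q in auto)
  have "1 = (\<Sum>j<p. Gi 0 j * G j 0)" using Gi_gram[of 0 0] p by simp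
  also have "\<dots> \<le> (\<Sum>j<p. \<bar>Gi 0 j\<bar> * ((real n)\<^sup>2 * (E * (10 * q * E ^ 4) * q)))"
  proof (rule sum_mono)
    fix j assume "j \<in> {..<p}"
    then have "\<bar>Gi 0 j * G j 0\<bar> \<le> \<bar>Gi 0 j\<bar> * ((real n)\<^sup>2 * (E * (10 * q * E ^ 4) * q))"
      unfolding abs_mult using G by (intro mult_left_mono) auto
    then show "Gi 0 j * G j 0 \<le> \<bar>Gi 0 j\<bar> * ((real n)\<^sup>2 * (E * (10 * q * E ^ 4) * q))" by linarith
  qed
  also have "\<dots> \<le> \<kappa> / (real n)\<^sup>2 * ((real n)\<^sup>2 * (E * (10 * q * E ^ 4) * q))"
    unfolding sum_distrib_right[symmetric] using Gi[of 0] p E q by (intro mult_right_mono) auto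
  also have "\<dots> = 10 * q\<^sup>2 * (\<kappa> * E ^ 5)"
    using n by (simp add: power2_eq_square power_numeral_reduce)
  finally show ?thesis .
qed

lemma rho_bounds_log_intensity:
  assumes p: "p \<ge> 1" and n: "n \<ge> 2" and \<gamma>: "\<gamma> \<in> carrier_vec p"
    and Z: "\<And>i j. i < n \<Longrightarrow> j < n \<Longrightarrow> i \<noteq> j \<Longrightarrow> Z i j \<in> carrier_vec p"
    and eps: "e1 > 0" "e2 > 0"
  shows "rho n p Z \<theta> \<gamma> e1 e2 \<ge> 0"
    and "e \<in> pairs n \<Longrightarrow> \<bar>node_effect n (\<lambda>r. \<theta> $ r) e + (\<Sum>k<p. covariate Z k e * \<gamma> $ k)\<bar> \<le> rho n p Z \<theta> \<gamma> e1 e2"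
proof -
  define S where "S = {\<bar>out_par \<theta> i + in_par n \<theta> j\<bar> | i j. i < n \<and> j < n \<and> i \<noteq> j}"
  define C where "C = {vec_maxnorm (Z i j) | i j. i < n \<and> j < n \<and> i \<noteq> j}"
  have S: "S = (\<lambda>(i, j). \<bar>out_par \<theta> i + in_par n \<theta> j\<bar>) ` pairs n"
    and C: "C = (\<lambda>(i, j). vec_maxnorm (Z i j)) ` pairs n"
    by (auto simp: S_def C_def pairs_def image_def)
  have fin: "finite S" "finite C" unfolding S C by auto
  have cb: "vec_maxnorm (Z i j) \<le> cov_bound n Z" if "(i, j) \<in> pairs n" for i j
    unfolding cov_bound_def C_def[symmetric] using that fin by (intro Max_ge) (auto simp: C)
  have zb: "\<bar>covariate Z k e\<bar> \<le> cov_bound n Z" if "k < p" "e \<in> pairs n" for k e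
  proof -
    obtain i j where e: "e = (i, j)" by (cases e)
    have "Z i j \<in> carrier_vec p" using Z that e by (auto simp: pairs_def)
    then have "\<bar>Z i j $ k\<bar> \<le> vec_maxnorm (Z i j)" using that by (intro vec_maxnorm_ge) auto
    then show ?thesis using cb[of i j] that by (simp add: covariate_def e)
  qed
  have g0: "vec_maxnorm \<gamma> \<ge> 0" using vec_maxnorm_ge[of 0 \<gamma>] \<gamma> p by auto
  have e0: "(0, 1) \<in> pairs n" using n by (auto simp: pairs_def)
  have c0: "cov_bound n Z \<ge> 0" using zb[OF _ e0, of 0] p by auto
  have S0: "\<bar>out_par \<theta> i + in_par n \<theta> j\<bar> \<le> Max S" if "(i, j) \<in> pairs n" for i j
    using that fin by (intro Max_ge) (auto simp: S)
  have rho: "Max S + real p * cov_bound n Z * vec_maxnorm \<gamma> \<le> rho n p Z \<theta> \<gamma> e1 e2"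
    unfolding rho_def S_def[symmetric] using eps c0 by simp
  have "Max S \<ge> 0" using S0[OF e0] by linarith
  then show "rho n p Z \<theta> \<gamma> e1 e2 \<ge> 0"
    using rho c0 g0 by (meson add_nonneg_nonneg mult_nonneg_nonneg of_nat_0_le_iff order_trans)
  assume e: "e \<in> pairs n"
  obtain i j where ij: "e = (i, j)" by (cases e)
  have l: "node_effect n (\<lambda>r. \<theta> $ r) e = out_par \<theta> i + in_par n \<theta> j"
    using e ij by (simp add: pairs_def node_effect_pair out_par_def in_par_def)
  have "\<bar>\<Sum>k<p. covariate Z k e * \<gamma> $ k\<bar> \<le> (\<Sum>k<p. \<bar>covariate Z k e * \<gamma> $ k\<bar>)" by (rule sum_abs)
  also have "\<dots> \<le> real (card {..<p}) * (cov_bound n Z * vec_maxnorm \<gamma>)"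
    unfolding abs_mult using zb e vec_maxnorm_ge[of _ \<gamma>] \<gamma> c0 by (intro sum_bounded_above mult_mono) auto
  finally show "\<bar>node_effect n (\<lambda>r. \<theta> $ r) e + (\<Sum>k<p. covariate Z k e * \<gamma> $ k)\<bar> \<le> rho n p Z \<theta> \<gamma> e1 e2"
    using S0[of i j] e ij rho unfolding l by (simp add: mult.assoc)
qed

section \<open>Uniqueness of the estimator\<close>

text \<open>The log-likelihood is strictly concave along every direction that changes some intensity; positive
definiteness of the Schur complement excludes the other directions.\<close>

lemma is_mle_unique:
  assumes n: "n \<ge> 3" and mle: "is_mle n p Z A \<theta> \<gamma>" "is_mle n p Z A \<theta>' \<gamma>'"
    and pd: "pos_def_mat (info_H n p Z A \<theta> \<gamma>)"
  shows "\<theta>' = \<theta> \<and> \<gamma>' = \<gamma>"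
proof -
  have \<theta>: "\<theta> \<in> carrier_vec (2 * n - 1)" "\<theta>' \<in> carrier_vec (2 * n - 1)"
    and \<gamma>: "\<gamma> \<in> carrier_vec p" "\<gamma>' \<in> carrier_vec p"
    using mle by (auto simp: is_mle_iff)
  define u g where "u r = \<theta>' $ r - \<theta> $ r" and "g k = \<gamma>' $ k - \<gamma> $ k" for r k
  define y where "y e = node_effect n u e + (\<Sum>k<p. covariate Z k e * g k)" for e
  define l where "l = intensity n Z \<theta> \<gamma>"
  have lu: "node_effect n u e = node_effect n (\<lambda>r. \<theta>' $ r) e - node_effect n (\<lambda>r. \<theta> $ r) e" for e
    unfolding u_def[abs_def] node_effect_diff ..
  have l': "intensity n Z \<theta>' \<gamma>' e = l e * exp (y e)" if e: "e \<in> pairs n" for e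
    using e \<theta> \<gamma> unfolding l_def
    by (simp add: intensity_exp[where p = p] mult_exp_exp y_def lu g_def algebra_simps sum_subtractf)
  have lpos: "l e > 0" for e by (simp add: l_def intensity_pos)
  have node: "(\<Sum>e\<in>pairs n. incidence n r e * (l e * (exp (y e) - 1))) = 0" if "r < 2 * n - 1" for r
  proof -
    have "(\<Sum>e\<in>pairs n. incidence n r e * (l e * (exp (y e) - 1)))
        = (\<Sum>e\<in>pairs n. incidence n r e * (intensity n Z \<theta>' \<gamma>' e - weight A e)) - (\<Sum>e\<in>pairs n. incidence n r e * (l e - weight A e))"
      unfolding sum_subtractf[symmetric] by (intro sum.cong) (auto simp: l' algebra_simps)
    then show ?thesis using mle that by (simp add: is_mle_iff l_def)
  qed
  have covq: "(\<Sum>e\<in>pairs n. covariate Z k e * (l e * (exp (y e) - 1))) = 0" if "k < p" for k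
  proof -
    have "(\<Sum>e\<in>pairs n. covariate Z k e * (l e * (exp (y e) - 1)))
        = (\<Sum>e\<in>pairs n. covariate Z k e * (intensity n Z \<theta>' \<gamma>' e - weight A e)) - (\<Sum>e\<in>pairs n. covariate Z k e * (l e - weight A e))"
      unfolding sum_subtractf[symmetric] by (intro sum.cong) (auto simp: l' algebra_simps)
    then show ?thesis using mle that by (simp add: is_mle_iff l_def)
  qed
  have y_times: "y e * W = node_effect n u e * W + (\<Sum>k<p. g k * (covariate Z k e * W))" for e W
    by (simp add: y_def algebra_simps sum_distrib_left)
  have "(\<Sum>e\<in>pairs n. y e * (l e * (exp (y e) - 1)))
      = (\<Sum>e\<in>pairs n. node_effect n u e * (l e * (exp (y e) - 1))) + (\<Sum>e\<in>pairs n. \<Sum>k<p. g k * (covariate Z k e * (l e * (exp (y e) - 1))))"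
    unfolding y_times sum.distrib ..
  also have "(\<Sum>e\<in>pairs n. node_effect n u e * (l e * (exp (y e) - 1))) = 0"
    using node by (subst sum_incidence_node_effect[symmetric]) simp
  also have "(\<Sum>e\<in>pairs n. \<Sum>k<p. g k * (covariate Z k e * (l e * (exp (y e) - 1)))) = (\<Sum>k<p. g k * (\<Sum>e\<in>pairs n. covariate Z k e * (l e * (exp (y e) - 1))))"
    unfolding sum_distrib_left by (rule sum.swap)
  also have "\<dots> = 0" using covq by simp
  finally have "(\<Sum>e\<in>pairs n. y e * (l e * (exp (y e) - 1))) = 0" by simp
  moreover have "y e * (l e * (exp (y e) - 1)) \<ge> 0" for e
    using lpos[of e] by (cases "y e \<ge> 0") (auto simp: zero_le_mult_iff mult_le_0_iff)
  ultimately have "\<forall>e\<in>pairs n. y e * (l e * (exp (y e) - 1)) = 0"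
    by (subst (asm) sum_nonneg_eq_0_iff) auto
  then have y0: "y e = 0" if "e \<in> pairs n" for e using that lpos[of e] by auto
  define H where "H = info_H n p Z A \<theta> \<gamma>"
  obtain c where c: "\<forall>k<p. \<forall>r<2 * n - 1. (\<Sum>e\<in>pairs n. incidence n r e * (l e * (covariate Z k e - node_effect n (c k) e))) = 0"
    and H: "H \<in> carrier_mat p p"
    and Hc: "\<forall>k<p. \<forall>m<p. H $$ (k, m) = (\<Sum>e\<in>pairs n. l e * (covariate Z k e - node_effect n (c k) e) * covariate Z m e)"
    unfolding H_def l_def using info_H_residual[OF n \<theta>(1) \<gamma>(1)] by blast
  have "H *\<^sub>v (\<gamma>' - \<gamma>) = 0\<^sub>v p"
  proof (rule eq_vecI)
    fix k assume "k < dim_vec (0\<^sub>v p :: real vec)"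
    then have k: "k < p" by simp
    have "(H *\<^sub>v (\<gamma>' - \<gamma>)) $ k = (\<Sum>m<p. H $$ (k, m) * g m)"
      using k H \<gamma> by (simp add: scalar_prod_def atLeast0LessThan g_def)
    also have "\<dots> = (\<Sum>m<p. \<Sum>e\<in>pairs n. l e * (covariate Z k e - node_effect n (c k) e) * (covariate Z m e * g m))"
      using Hc k by (simp add: sum_distrib_right mult.assoc)
    also have "\<dots> = (\<Sum>e\<in>pairs n. l e * (covariate Z k e - node_effect n (c k) e) * (y e - node_effect n u e))"
      by (subst sum.swap) (simp add: y_def sum_distrib_left)
    also have "\<dots> = - (\<Sum>e\<in>pairs n. node_effect n u e * (l e * (covariate Z k e - node_effect n (c k) e)))"
      by (simp add: y0 sum_negf[symmetric] mult_ac)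
    also have "\<dots> = 0" using c k by (subst sum_incidence_node_effect[symmetric]) simp
    finally show "(H *\<^sub>v (\<gamma>' - \<gamma>)) $ k = 0\<^sub>v p $ k" using k by simp
  qed (use H in simp)
  then have "\<gamma>' - \<gamma> = 0\<^sub>v p"
    using pd[folded H_def] \<gamma> H unfolding pos_def_mat_def
    by (metis carrier_matD(1) minus_carrier_vec less_irrefl scalar_prod_right_zero)
  then have g0: "g k = 0" if "k < p" for k
    using that \<gamma> by (metis g_def carrier_vecD index_minus_vec(1) index_zero_vec(1))
  then have "node_effect n u e = 0" if "e \<in> pairs n" for e using y0[OF that] by (simp add: y_def)
  then have "u r = 0" if "r < 2 * n - 1" for r using node_effect_eq_0[OF n _ that] by blast
  then show ?thesis using g0 \<theta> \<gamma> by (auto simp: u_def g_def vec_eq_iff)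
qed

text \<open>Uniqueness identifies the chosen solution with any solution at hand, so bounds for one solution carry over
to the estimator.\<close>

lemma mle_eq:
  assumes n: "n \<ge> 3" and mle: "is_mle n p Z A \<theta> \<gamma>"
    and pd: "pos_def_mat (info_H n p Z A \<theta> \<gamma>)"
  shows "mle_theta n p Z A = \<theta>" "mle_gamma n p Z A = \<gamma>"
proof -
  have "case mle n p Z A of (\<theta>, \<gamma>) \<Rightarrow> is_mle n p Z A \<theta> \<gamma>"
    unfolding mle_def by (rule someI[where x = "(\<theta>, \<gamma>)"]) (use mle in simp)
  then have "is_mle n p Z A (fst (mle n p Z A)) (snd (mle n p Z A))" by (simp add: case_prod_beta)
  then show "mle_theta n p Z A = \<theta>" "mle_gamma n p Z A = \<gamma>"
    using is_mle_unique[OF n mle _ pd] by (auto simp: mle_theta_def mle_gamma_def)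
qed

section \<open>Tails of weighted Poisson sums\<close>

lemma exp_le_quadratic:
  fixes u :: real
  assumes "\<bar>u\<bar> \<le> 1"
  shows "exp u \<le> 1 + u + u\<^sup>2"
proof (cases "u \<ge> 0")
  case True
  then show ?thesis using assms by (intro exp_bound) auto
next
  case False
  define v where "v = - u"
  have v: "0 < v" using False by (simp add: v_def)
  have "(1 + u + u\<^sup>2) * exp v \<ge> (1 - v + v\<^sup>2) * (1 + v)"
    using exp_ge_add_one_self[of v] v zero_le_power2[of "u + 1 / 2"]
    by (intro mult_mono) (auto simp: v_def power2_eq_square algebra_simps)
  also have "(1 - v + v\<^sup>2) * (1 + v) = 1 + v ^ 3" by (simp add: power2_eq_square power3_eq_cube algebra_simps)
  finally have "1 \<le> (1 + u + u\<^sup>2) * exp v" using zero_less_power[OF v, of 3] by linarith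
  then show ?thesis by (simp add: v_def exp_minus field_simps)
qed

text \<open>The moment generating function of a centred Poisson variable.\<close>

lemma nn_integral_poisson_exp:
  assumes r: "r > 0"
  shows "(\<integral>\<^sup>+ x. ennreal (exp (u * (real x - r))) \<partial>measure_pmf (poisson_pmf r)) = ennreal (exp (r * (exp u - 1 - u)))"
proof -
  define f where "f k = exp (- r - u * r) * ((r * exp u) ^ k / fact k)" for k :: nat
  have f: "pmf (poisson_pmf r) k * exp (u * (real k - r)) = f k" for k
    using r by (simp add: f_def power_mult_distrib exp_of_nat_mult[symmetric] algebra_simps mult_exp_exp exp_diff)
  have sums: "f sums (exp (- r - u * r) * exp (r * exp u))"
    unfolding f_def using exp_converges[of "r * exp u"]
    by (intro sums_mult) (simp add: field_simps scaleR_conv_of_real)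
  have "(\<integral>\<^sup>+ x. ennreal (exp (u * (real x - r))) \<partial>measure_pmf (poisson_pmf r)) = (\<Sum>k. ennreal (f k))"
    unfolding nn_integral_measure_pmf nn_integral_count_space_nat
    using r by (intro suminf_cong) (simp only: f[symmetric] ennreal_mult' pmf_nonneg)
  also have "\<dots> = ennreal (exp (- r - u * r) * exp (r * exp u))"
    using r by (intro suminf_ennreal_eq[OF _ sums]) (auto simp: f_def)
  also have "exp (- r - u * r) * exp (r * exp u) = exp (r * (exp u - 1 - u))"
    by (simp add: mult_exp_exp algebra_simps)
  finally show ?thesis .
qed

text \<open>Chernoff's method: for arguments of modulus at most \<open>1\<close>, the logarithm of the moment generating
function of a centred Poisson variable is at most the rate times the squared argument.\<close>

lemma (in prob_space) poisson_upper_tail: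
  fixes X :: "'i \<Rightarrow> 'a \<Rightarrow> nat"
  assumes I: "finite I" and indep: "indep_vars (\<lambda>_. count_space UNIV) X I"
    and X: "\<And>i. i \<in> I \<Longrightarrow> distr M (count_space UNIV) (X i) = measure_pmf (poisson_pmf (r i))"
    and r: "\<And>i. i \<in> I \<Longrightarrow> r i > 0"
    and t: "t > 0" "\<And>i. i \<in> I \<Longrightarrow> t * \<bar>c i\<bar> \<le> 1" and v: "(\<Sum>i\<in>I. (c i)\<^sup>2 * r i) \<le> v"
  shows "prob {\<omega> \<in> space M. (\<Sum>i\<in>I. c i * (real (X i \<omega>) - r i)) \<ge> s} \<le> exp (t\<^sup>2 * v - t * s)"
proof -
  let ?S = "\<lambda>\<omega>. \<Sum>i\<in>I. c i * (real (X i \<omega>) - r i)"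
  have meas: "X i \<in> measurable M (count_space UNIV)" if "i \<in> I" for i
    using indep that by (auto simp: indep_vars_def)
  have [measurable]: "(\<lambda>\<omega>. g (X i \<omega>)) \<in> borel_measurable M" if "i \<in> I" for i and g :: "nat \<Rightarrow> real"
    by (rule measurable_compose[OF meas[OF that]]) simp
  have "ennreal (prob {\<omega> \<in> space M. ?S \<omega> \<ge> s}) = emeasure M {\<omega> \<in> space M. ?S \<omega> \<ge> s}"
    by (simp add: emeasure_eq_measure)
  also have "\<dots> \<le> ennreal (exp (- t * s)) * (\<integral>\<^sup>+\<omega>\<in>space M. exp (t * ?S \<omega>) \<partial>M)"
    using t by (intro Chernoff_ineq_nn_integral_ge) auto
  also have "(\<integral>\<^sup>+\<omega>\<in>space M. exp (t * ?S \<omega>) \<partial>M) = (\<integral>\<^sup>+\<omega>. (\<Prod>i\<in>I. ennreal (exp (t * c i * (real (X i \<omega>) - r i)))) \<partial>M)"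
    by (intro nn_integral_cong) (simp add: sum_distrib_left exp_sum I prod_ennreal mult.assoc)
  also have "\<dots> = (\<Prod>i\<in>I. \<integral>\<^sup>+\<omega>. ennreal (exp (t * c i * (real (X i \<omega>) - r i))) \<partial>M)"
    by (intro indep_vars_nn_integral I indep_vars_compose2[OF indep]) auto
  also have "\<dots> \<le> (\<Prod>i\<in>I. ennreal (exp (t\<^sup>2 * ((c i)\<^sup>2 * r i))))"
  proof (intro prod_mono_ennreal)
    fix i assume i: "i \<in> I"
    have "(\<integral>\<^sup>+\<omega>. ennreal (exp (t * c i * (real (X i \<omega>) - r i))) \<partial>M)
        = (\<integral>\<^sup>+x. ennreal (exp (t * c i * (real x - r i))) \<partial>distr M (count_space UNIV) (X i))"
      by (rule nn_integral_distr[symmetric]) (use meas[OF i] in auto)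
    also have "\<dots> = ennreal (exp (r i * (exp (t * c i) - 1 - t * c i)))"
      unfolding X[OF i] by (rule nn_integral_poisson_exp[OF r[OF i]])
    also have "\<dots> \<le> ennreal (exp (r i * (t * c i)\<^sup>2))"
    proof -
      have "\<bar>t * c i\<bar> \<le> 1" using t i by (simp add: abs_mult)
      then have "exp (t * c i) - 1 - t * c i \<le> (t * c i)\<^sup>2" using exp_le_quadratic[of "t * c i"] by linarith
      then show ?thesis using r[OF i] by (intro ennreal_leI) (simp add: mult_left_mono)
    qed
    finally show "(\<integral>\<^sup>+\<omega>. ennreal (exp (t * c i * (real (X i \<omega>) - r i))) \<partial>M) \<le> ennreal (exp (t\<^sup>2 * ((c i)\<^sup>2 * r i)))"
      by (simp add: power_mult_distrib mult_ac)
  qed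
  also have "\<dots> = ennreal (exp (t\<^sup>2 * (\<Sum>i\<in>I. (c i)\<^sup>2 * r i)))"
    by (simp add: prod_ennreal exp_sum I sum_distrib_left)
  also have "\<dots> \<le> ennreal (exp (t\<^sup>2 * v))"
    using v by (intro ennreal_leI) (simp add: mult_left_mono)
  also have "ennreal (exp (- t * s)) * \<dots> = ennreal (exp (t\<^sup>2 * v - t * s))"
    by (simp add: ennreal_mult'[symmetric] mult_exp_exp)
  finally show ?thesis by (simp add: mult_left_mono)
qed

text \<open>The exponential parameter is \<open>sqrt (ln N) / \<sigma>\<close>.  It makes the exponent \<open>ln N - 3 * ln N\<close>, and the
hypothesis on \<open>\<sigma>\<close> and the coefficients says that it is admissible for the Chernoff bound.\<close>

lemma (in prob_space) poisson_tail:
  fixes X :: "'i \<Rightarrow> 'a \<Rightarrow> nat"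
  assumes I: "finite I" and indep: "indep_vars (\<lambda>_. count_space UNIV) X I"
    and X: "\<And>i. i \<in> I \<Longrightarrow> distr M (count_space UNIV) (X i) = measure_pmf (poisson_pmf (r i))"
    and r: "\<And>i. i \<in> I \<Longrightarrow> r i > 0"
    and N: "N > 1" and \<sigma>: "\<sigma> > 0" "\<And>i. i \<in> I \<Longrightarrow> sqrt (ln N) * \<bar>c i\<bar> \<le> \<sigma>"
    and v: "(\<Sum>i\<in>I. (c i)\<^sup>2 * r i) \<le> \<sigma>\<^sup>2"
  shows "{\<omega> \<in> space M. \<bar>\<Sum>i\<in>I. c i * (real (X i \<omega>) - r i)\<bar> \<ge> 3 * \<sigma> * sqrt (ln N)} \<in> events"
    and "prob {\<omega> \<in> space M. \<bar>\<Sum>i\<in>I. c i * (real (X i \<omega>) - r i)\<bar> \<ge> 3 * \<sigma> * sqrt (ln N)} \<le> 2 / N\<^sup>2"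
proof -
  define t where "t = sqrt (ln N) / \<sigma>"
  define s where "s = 3 * \<sigma> * sqrt (ln N)"
  let ?S = "\<lambda>c \<omega>. \<Sum>i\<in>I. c i * (real (X i \<omega>) - r i)"
  have meas: "X i \<in> measurable M (count_space UNIV)" if "i \<in> I" for i
    using indep that by (auto simp: indep_vars_def)
  have rv [measurable]: "?S c \<in> borel_measurable M" for c :: "'i \<Rightarrow> real"
    by (intro borel_measurable_sum measurable_compose[OF meas]) auto
  have t: "t > 0" using N \<sigma> by (simp add: t_def)
  have tc: "t * \<bar>c i\<bar> \<le> 1" if "i \<in> I" for i using \<sigma>(1) \<sigma>(2)[OF that] by (simp add: t_def field_simps)
  have "t\<^sup>2 * \<sigma>\<^sup>2 - t * s = - 2 * ln N"
    using N \<sigma> by (simp add: t_def s_def power_divide)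
  then have e: "exp (t\<^sup>2 * \<sigma>\<^sup>2 - t * s) = 1 / N\<^sup>2"
  proof -
    have "exp (- 2 * ln N) = N powr (- 2)" using N by (simp add: powr_def)
    also have "\<dots> = 1 / N\<^sup>2" using N by (simp add: powr_minus_divide powr_numeral)
    finally show ?thesis using \<open>t\<^sup>2 * \<sigma>\<^sup>2 - t * s = - 2 * ln N\<close> by simp
  qed
  have "{\<omega> \<in> space M. \<bar>?S c \<omega>\<bar> \<ge> s} = {\<omega> \<in> space M. ?S c \<omega> \<ge> s} \<union> {\<omega> \<in> space M. ?S (\<lambda>i. - c i) \<omega> \<ge> s}"
    by (auto simp: sum_negf abs_if)
  moreover have "prob {\<omega> \<in> space M. ?S c \<omega> \<ge> s} \<le> exp (t\<^sup>2 * \<sigma>\<^sup>2 - t * s)"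
    using tc v by (intro poisson_upper_tail I indep X r t) auto
  moreover have "prob {\<omega> \<in> space M. ?S (\<lambda>i. - c i) \<omega> \<ge> s} \<le> exp (t\<^sup>2 * \<sigma>\<^sup>2 - t * s)"
    using tc v by (intro poisson_upper_tail I indep X r t) auto
  moreover have "prob ({\<omega> \<in> space M. ?S c \<omega> \<ge> s} \<union> {\<omega> \<in> space M. ?S (\<lambda>i. - c i) \<omega> \<ge> s})
      \<le> prob {\<omega> \<in> space M. ?S c \<omega> \<ge> s} + prob {\<omega> \<in> space M. ?S (\<lambda>i. - c i) \<omega> \<ge> s}"
    by (intro measure_Un_le) measurable
  ultimately show "prob {\<omega> \<in> space M. \<bar>?S c \<omega>\<bar> \<ge> 3 * \<sigma> * sqrt (ln N)} \<le> 2 / N\<^sup>2"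
    unfolding s_def[symmetric] e by simp
  show "{\<omega> \<in> space M. \<bar>?S c \<omega>\<bar> \<ge> 3 * \<sigma> * sqrt (ln N)} \<in> events" by measurable
qed

section \<open>The estimator is close to the truth with high probability\<close>

text \<open>There are \<open>2 * n + p\<close> weighted Poisson sums to control: rows, columns and residualised covariates.
Each exceeds its bound with probability at most \<open>2 / n^2\<close>.  Off their union the deterministic result
applies.\<close>

lemma mle_exists_near_truth:
  assumes net: "poisson_network n Z \<theta> \<gamma> M a"
    and ortho: "orthogonalised_network n p (intensity n Z \<theta> \<gamma>) (covariate Z) c Gi E q \<kappa>"
    and \<theta>: "\<theta> \<in> carrier_vec (2 * n - 1)" and \<gamma>: "\<gamma> \<in> carrier_vec p"
    and \<eta>: "\<eta> = sqrt (ln (real n) / real n)"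
    and small1: "E ^ 8 * \<eta> \<le> 1 / (10 ^ 5 * real p * q\<^sup>2)"
    and small2: "\<kappa> * E ^ 13 * \<eta> \<le> 1 / (10 ^ 5 * real p * q\<^sup>2)"
  shows "\<exists>B\<in>sets M. measure M B \<le> (4 + 2 * real p) / real n \<and> (\<forall>\<omega>\<in>space M - B.
    \<exists>\<theta>' \<gamma>'. is_mle n p Z (\<lambda>i j. a i j \<omega>) \<theta>' \<gamma>' \<and>
      (\<forall>k<p. \<bar>\<gamma>' $ k - \<gamma> $ k\<bar> \<le> 10 ^ 5 * q * (\<kappa> * E ^ 13 * \<eta>\<^sup>2)) \<and>
      (\<forall>r<2 * n - 1. \<bar>\<theta>' $ r - \<theta> $ r\<bar> \<le> 165 * (E ^ 4 * \<eta>)))"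
proof -
  define l where "l = intensity n Z \<theta> \<gamma>"
  interpret N: orthogonalised_network n p l "covariate Z" c Gi E q \<kappa> using ortho by (simp add: l_def)
  interpret prob_space M using net by (simp add: poisson_network_def)
  note n = N.n and E = N.E and q = N.q and p = N.p
  define X where "X e = a (fst e) (snd e)" for e
  have wtX: "weight (\<lambda>i j. a i j \<omega>) e = real (X e \<omega>)" for e \<omega> by (simp add: weight_def X_def)
  have indep: "indep_vars (\<lambda>_. count_space UNIV) X (pairs n)"
    using net by (simp add: poisson_network_def X_def[abs_def] pairs_def case_prod_beta')
  have X: "distr M (count_space UNIV) (X e) = measure_pmf (poisson_pmf (l e))" if "e \<in> pairs n" for e
    using net that by (auto simp: poisson_network_def X_def pairs_def l_def intensity_def)
  have ln1: "ln (real n) \<ge> 1"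
  proof -
    have "exp 1 \<le> real n" using n exp_le by linarith
    then show ?thesis using n by (subst ln_ge_iff) auto
  qed
  have lnn: "ln (real n) \<le> real n" using n ln_bound[of "real n"] by simp
  have sln: "sqrt (ln (real n)) \<le> sqrt (real n)" "1 \<le> sqrt (ln (real n))" using lnn ln1 by auto
  have sn: "sqrt (real n) \<le> real n" using n by (intro real_le_lsqrt) (auto simp: power2_eq_square)
  have \<eta>0: "\<eta> \<ge> 0" and \<eta>2: "\<eta>\<^sup>2 = ln (real n) / real n" using ln1 by (auto simp: \<eta>)
  \<comment> \<open>converts the deviations of the form \<open>3 * sd m * sqrt (ln n)\<close> into multiples of \<open>\<eta>\<close>\<close>
  have n\<eta>: "sqrt (real n) * sqrt (ln (real n)) = real n * \<eta>"
    using n by (simp add: \<eta> real_sqrt_divide field_simps)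
  define b where "b = 10 * q * E ^ 4"
  have b: "b > 0" using E q by (simp add: b_def)
  \<comment> \<open>rows for \<open>m < n\<close>, columns for \<open>n \<le> m < 2 * n\<close>, then the residualised covariates; \<open>sd m\<close> bounds the standard deviation of the \<open>m\<close>-th sum\<close>
  define coef where "coef m = (if m < n then (\<lambda>e. of_bool (fst e = m)) else if m < 2 * n then (\<lambda>e. of_bool (snd e = m - n))
     else residual n (covariate Z) c (m - 2 * n))" for m
  define sd where "sd m = (if m < 2 * n then sqrt (real n) * E else real n * E * b)" for m
  define B where "B m = {\<omega> \<in> space M. \<bar>\<Sum>e\<in>pairs n. coef m e * (real (X e \<omega>) - l e)\<bar> \<ge> 3 * sd m * sqrt (ln (real n))}" for m
  have Bm: "B m \<in> events \<and> prob (B m) \<le> 2 / (real n)\<^sup>2" if m: "m < 2 * n + p" for m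
  proof -
    have 1: "sqrt (ln (real n)) * \<bar>coef m e\<bar> \<le> sd m" if e: "e \<in> pairs n" for e
    proof (cases "m < 2 * n")
      case True
      have "sqrt (ln (real n)) * \<bar>coef m e\<bar> \<le> sqrt (real n) * 1"
        using True sln by (intro mult_mono) (auto simp: coef_def)
      also have "\<dots> \<le> sqrt (real n) * E" using E by (intro mult_left_mono) auto
      finally show ?thesis using True by (simp add: sd_def)
    next
      case False
      then have "\<bar>coef m e\<bar> \<le> b" using N.zt_bound[of "m - 2 * n" e] m e by (simp add: coef_def b_def)
      moreover have "sqrt (ln (real n)) \<le> real n" using sln(1) sn by linarith
      ultimately have "sqrt (ln (real n)) * \<bar>coef m e\<bar> \<le> (real n * 1) * b"
        using ln1 by (intro mult_mono) auto
      also have "\<dots> \<le> (real n * E) * b" using E b by (intro mult_left_mono mult_right_mono) auto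
      finally show ?thesis using False by (simp add: sd_def)
    qed
    have 2: "(\<Sum>e\<in>pairs n. (coef m e)\<^sup>2 * l e) \<le> (sd m)\<^sup>2"
    proof (cases "m < 2 * n")
      case True
      have EE: "real n * E \<le> (sqrt (real n) * E)\<^sup>2"
        using E self_le_power[of E 2] by (simp add: power_mult_distrib mult_left_mono)
      have ns: "node_sums_le n l (real n * E)"
        using N.l N.l_pos E by (intro node_sums_le_pointwise) (auto simp: less_imp_le)
      have "(\<Sum>e\<in>pairs n. (coef m e)\<^sup>2 * l e) \<le> real n * E"
      proof (cases "m < n")
        case True
        have "(\<Sum>e\<in>pairs n. (coef m e)\<^sup>2 * l e) = (\<Sum>e\<in>pairs n. of_bool (fst e = m) * l e)"
          using True by (intro sum.cong) (auto simp: coef_def)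
        then show ?thesis unfolding sum_pairs_fst[OF True] using ns True by (auto simp: node_sums_le_def)
      next
        case False
        then have m': "m - n < n" using \<open>m < 2 * n\<close> by auto
        have "(\<Sum>e\<in>pairs n. (coef m e)\<^sup>2 * l e) = (\<Sum>e\<in>pairs n. of_bool (snd e = m - n) * l e)"
          using False \<open>m < 2 * n\<close> by (intro sum.cong) (auto simp: coef_def)
        then show ?thesis unfolding sum_pairs_snd[OF m'] using ns m' by (auto simp: node_sums_le_def)
      qed
      then show ?thesis using True EE by (simp add: sd_def)
    next
      case False
      have "(coef m e)\<^sup>2 * l e \<le> b\<^sup>2 * E" if e: "e \<in> pairs n" for e
      proof -
        have "\<bar>coef m e\<bar> \<le> b" using N.zt_bound[of "m - 2 * n" e] m e False by (simp add: coef_def b_def)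
        then have "(coef m e)\<^sup>2 \<le> b\<^sup>2" using power_mono[of "\<bar>coef m e\<bar>" b 2] by simp
        then show ?thesis using N.l[OF e] N.l_pos[OF e] by (intro mult_mono) auto
      qed
      then have "\<bar>\<Sum>e\<in>pairs n. (coef m e)\<^sup>2 * l e\<bar> \<le> (real n)\<^sup>2 * (b\<^sup>2 * E)"
        using N.l_pos E by (intro abs_sum_pairs_le) (auto simp: less_imp_le abs_mult)
      also have "\<dots> \<le> (real n)\<^sup>2 * (b\<^sup>2 * E\<^sup>2)"
        using E by (intro mult_left_mono) (auto simp: power2_eq_square)
      also have "\<dots> = (sd m)\<^sup>2" using False by (simp add: sd_def power_mult_distrib)
      finally show ?thesis by linarith
    qed
    have 3: "sd m > 0" using n E b by (auto simp: sd_def)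
    show ?thesis unfolding B_def
      by (intro conjI poisson_tail[OF finite_pairs indep X N.l_pos _ 3 1 2]) (use n in auto)
  qed
  define U where "U = (\<Union>m<2 * n + p. B m)"
  have U: "U \<in> events" using Bm by (auto simp: U_def)
  have "prob U \<le> (\<Sum>m<2 * n + p. prob (B m))"
    unfolding U_def using Bm by (intro finite_measure_subadditive_finite) auto
  also have "\<dots> \<le> real (card {..<2 * n + p}) * (2 / (real n)\<^sup>2)"
    using Bm by (intro sum_bounded_above) auto
  also have "\<dots> = (4 * real n + 2 * real p) / (real n)\<^sup>2" by (simp add: field_simps)
  also have "\<dots> \<le> (4 * real n + 2 * real p * real n) / (real n)\<^sup>2"
    using n by (intro divide_right_mono add_mono) (auto simp: mult_le_cancel_left1)
  also have "\<dots> = (4 + 2 * real p) / real n" using n by (simp add: field_simps power2_eq_square)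
  finally have PU: "prob U \<le> (4 + 2 * real p) / real n" .
  have good: "\<exists>\<theta>' \<gamma>'. is_mle n p Z (\<lambda>i j. a i j \<omega>) \<theta>' \<gamma>' \<and>
      (\<forall>k<p. \<bar>\<gamma>' $ k - \<gamma> $ k\<bar> \<le> 10 ^ 5 * q * (\<kappa> * E ^ 13 * \<eta>\<^sup>2)) \<and>
      (\<forall>r<2 * n - 1. \<bar>\<theta>' $ r - \<theta> $ r\<bar> \<le> 165 * (E ^ 4 * \<eta>))" if \<omega>: "\<omega> \<in> space M - U" for \<omega>
  proof -
    define w where "w e = real (X e \<omega>) - l e" for e
    have wB: "\<bar>\<Sum>e\<in>pairs n. coef m e * w e\<bar> \<le> 3 * sd m * sqrt (ln (real n))" if "m < 2 * n + p" for m
      using \<omega> that by (auto simp: U_def B_def w_def not_le intro: less_imp_le)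
    have s_eq: "3 * (sqrt (real n) * E) * sqrt (ln (real n)) = 3 * E * real n * \<eta>"
      using n\<eta> by (simp add: mult_ac)
    have ws: "node_sums_le n w (3 * E * real n * \<eta>)"
      unfolding node_sums_le_def
    proof (intro conjI allI impI)
      fix i assume i: "i < n"
      show "\<bar>\<Sum>j\<in>{..<n} - {i}. w (i, j)\<bar> \<le> 3 * E * real n * \<eta>"
        using wB[of i] i unfolding sum_pairs_fst[OF i, of w, symmetric] s_eq[symmetric]
        by (simp add: coef_def sd_def del: of_bool_eq)
      show "\<bar>\<Sum>j\<in>{..<n} - {i}. w (j, i)\<bar> \<le> 3 * E * real n * \<eta>"
        using wB[of "n + i"] i unfolding sum_pairs_snd[OF i, of w, symmetric] s_eq[symmetric]
        by (simp add: coef_def sd_def del: of_bool_eq)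
    qed
    have weight: "\<bar>\<Sum>e\<in>pairs n. residual n (covariate Z) c k e * w e\<bar> \<le> 3 * (10 * q * E ^ 4) * E * (real n)\<^sup>2 * \<eta>\<^sup>2" if k: "k < p" for k
    proof -
      have "\<bar>\<Sum>e\<in>pairs n. residual n (covariate Z) c k e * w e\<bar> \<le> 3 * (real n * E * b) * sqrt (ln (real n))"
        using wB[of "2 * n + k"] k by (simp add: coef_def sd_def)
      also have "\<dots> \<le> 3 * (real n * E * b) * ln (real n)"
        using ln1 E b by (intro mult_left_mono real_le_lsqrt) (auto simp: power2_eq_square)
      also have "\<dots> = 3 * (10 * q * E ^ 4) * E * (real n)\<^sup>2 * \<eta>\<^sup>2"
        using n unfolding \<eta>2 by (simp add: b_def power2_eq_square)
      finally show ?thesis .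
    qed
    obtain u g where
      u: "\<And>r. r < 2 * n - 1 \<Longrightarrow> (\<Sum>e\<in>pairs n. incidence n r e * (l e * exp (node_effect n u e + (\<Sum>m<p. covariate Z m e * g m)) - (l e + w e))) = 0"
      and g: "\<And>k. k < p \<Longrightarrow> (\<Sum>e\<in>pairs n. covariate Z k e * (l e * exp (node_effect n u e + (\<Sum>m<p. covariate Z m e * g m)) - (l e + w e))) = 0"
      and gb: "\<And>k. k < p \<Longrightarrow> \<bar>g k\<bar> \<le> 10 ^ 5 * q * (\<kappa> * E ^ 13 * \<eta>\<^sup>2)"
      and yb: "\<And>e. e \<in> pairs n \<Longrightarrow> \<bar>node_effect n u e + (\<Sum>m<p. covariate Z m e * g m)\<bar> \<le> 54 * E ^ 4 * \<eta>"
      using N.score_solution[OF \<eta>0 ws weight small1 small2] by blast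
    define \<theta>' where "\<theta>' = vec (2 * n - 1) (\<lambda>r. \<theta> $ r + u r)"
    define \<gamma>' where "\<gamma>' = vec p (\<lambda>k. \<gamma> $ k + g k)"
    have "node_effect n (\<lambda>r. \<theta>' $ r) e = node_effect n (\<lambda>r. \<theta> $ r + u r) e" for e
      unfolding node_effect_def by (intro sum.cong) (auto simp: \<theta>'_def)
    then have l': "intensity n Z \<theta>' \<gamma>' e = l e * exp (node_effect n u e + (\<Sum>m<p. covariate Z m e * g m))" if "e \<in> pairs n" for e
      using that \<gamma> unfolding l_def
      by (simp add: intensity_exp[where p = p] \<gamma>'_def node_effect_add mult_exp_exp algebra_simps sum.distrib)
    have lw: "weight (\<lambda>i j. a i j \<omega>) e = l e + w e" for e by (simp add: wtX w_def)
    have "is_mle n p Z (\<lambda>i j. a i j \<omega>) \<theta>' \<gamma>'"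
    proof -
      have "\<theta>' \<in> carrier_vec (2 * n - 1)" "\<gamma>' \<in> carrier_vec p" by (simp_all add: \<theta>'_def \<gamma>'_def)
      then show ?thesis unfolding is_mle_iff lw using u g by (simp add: l')
    qed
    moreover have "\<bar>\<gamma>' $ k - \<gamma> $ k\<bar> \<le> 10 ^ 5 * q * (\<kappa> * E ^ 13 * \<eta>\<^sup>2)" if "k < p" for k
      using gb[OF that] that by (simp add: \<gamma>'_def)
    moreover have "\<bar>\<theta>' $ r - \<theta> $ r\<bar> \<le> 165 * (E ^ 4 * \<eta>)" if r: "r < 2 * n - 1" for r
    proof -
      have "\<bar>node_effect n u e\<bar> \<le> 55 * (E ^ 4 * \<eta>)" if e: "e \<in> pairs n" for e
      proof -
        have "\<bar>\<Sum>m<p. covariate Z m e * g m\<bar> \<le> (\<Sum>m<p. \<bar>covariate Z m e * g m\<bar>)" by (rule sum_abs)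
        also have "\<dots> \<le> real (card {..<p}) * (q * (10 ^ 5 * q * (\<kappa> * E ^ 13 * \<eta>\<^sup>2)))"
          unfolding abs_mult using N.z e gb q by (intro sum_bounded_above mult_mono) auto
        also have "\<dots> = (10 ^ 5 * real p * q\<^sup>2) * (\<kappa> * E ^ 13 * \<eta>) * \<eta>"
          by (simp add: power2_eq_square)
        also have "\<dots> \<le> 1 * \<eta>"
        proof (rule mult_right_mono[OF _ \<eta>0])
          have "(10 ^ 5 * real p * q\<^sup>2) * (\<kappa> * E ^ 13 * \<eta>) \<le> (10 ^ 5 * real p * q\<^sup>2) * (1 / (10 ^ 5 * real p * q\<^sup>2))"
            using small2 by (intro mult_left_mono) auto
          also have "\<dots> = 1" using p q by simp
          finally show "(10 ^ 5 * real p * q\<^sup>2) * (\<kappa> * E ^ 13 * \<eta>) \<le> 1" .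
        qed
        also have "1 * \<eta> \<le> E ^ 4 * \<eta>" using E \<eta>0 by (intro mult_right_mono one_le_power)
        finally show ?thesis using yb[OF e] by linarith
      qed
      then have "\<bar>u r\<bar> \<le> 3 * (55 * (E ^ 4 * \<eta>))" by (rule node_effect_coord_bound[OF n _ r])
      then show ?thesis using r by (simp add: \<theta>'_def)
    qed
    ultimately show ?thesis by blast
  qed
  show ?thesis using U PU good by blast
qed

section \<open>Measurability\<close>

lemma measurable_map_list:
  fixes X :: "'i \<Rightarrow> 'a \<Rightarrow> 'c :: countable"
  assumes "\<And>i. i \<in> set xs \<Longrightarrow> X i \<in> measurable M (count_space UNIV)"
  shows "(\<lambda>\<omega>. map (\<lambda>i. X i \<omega>) xs) \<in> measurable M (count_space UNIV)"
  using assms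
proof (induction xs)
  case Nil
  then show ?case by simp
next
  case (Cons i xs)
  have "(\<lambda>\<omega>. (\<lambda>c \<omega>. c # map (\<lambda>i. X i \<omega>) xs) (X i \<omega>) \<omega>) \<in> measurable M (count_space UNIV)"
  proof (rule measurable_compose_countable[where f = "\<lambda>c \<omega>. c # map (\<lambda>i. X i \<omega>) xs" and g = "X i"])
    show "(\<lambda>\<omega>. c # map (\<lambda>i. X i \<omega>) xs) \<in> measurable M (count_space UNIV)" for c
      by (rule measurable_compose[OF Cons.IH, where g = "(#) c"]) (use Cons.prems in auto)
    show "X i \<in> measurable M (count_space UNIV)" using Cons.prems by simp
  qed
  then show ?case by simp
qed

text \<open>Finitely many observations with countably many values generate a discrete random variable, of which every
function is measurable.  This covers the estimator, which is defined by choice.\<close>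

lemma measurable_finitely_determined:
  fixes X :: "'i \<Rightarrow> 'a \<Rightarrow> 'c :: countable"
  assumes I: "finite I" and X: "\<And>i. i \<in> I \<Longrightarrow> X i \<in> measurable M (count_space UNIV)"
    and f: "\<And>x y. (\<And>i. i \<in> I \<Longrightarrow> x i = y i) \<Longrightarrow> f x = f y" and N: "space N = UNIV"
  shows "(\<lambda>\<omega>. f (\<lambda>i. X i \<omega>)) \<in> measurable M N"
proof -
  obtain xs where xs: "set xs = I" using I finite_list by blast
  define F where "F ys = f (\<lambda>i. the (map_of (zip xs ys) i))" for ys
  have "(\<lambda>\<omega>. F (map (\<lambda>i. X i \<omega>) xs)) \<in> measurable M N"
    by (rule measurable_compose[OF measurable_map_list]) (use xs X N in auto)
  moreover have "F (map (\<lambda>i. X i \<omega>) xs) = f (\<lambda>i. X i \<omega>)" for \<omega>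
    unfolding F_def by (rule f) (simp add: map_of_zip_map xs)
  ultimately show ?thesis by simp
qed

text \<open>The diagonal weights and those outside the node range do not enter the score equations, so only finitely
many observations do.\<close>

lemma is_mle_cong:
  assumes "\<And>e. e \<in> pairs n \<Longrightarrow> weight A e = weight A' e"
  shows "is_mle n p Z A = is_mle n p Z A'"
proof (intro ext)
  fix \<theta> \<gamma>
  have "(\<Sum>e\<in>pairs n. f e * (intensity n Z \<theta> \<gamma> e - weight A e)) = (\<Sum>e\<in>pairs n. f e * (intensity n Z \<theta> \<gamma> e - weight A' e))" for f
    using assms by (intro sum.cong) auto
  then show "is_mle n p Z A \<theta> \<gamma> = is_mle n p Z A' \<theta> \<gamma>" by (simp add: is_mle_iff)
qed
section \<open>Rates\<close>

text \<open>A bound with one constant off events of vanishing probability is stronger than boundedness in probability,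
where the constant may depend on the probability allowed.\<close>

lemma stochastic_order_symbols:
  assumes prob: "\<forall>\<^sub>F n in sequentially. prob_space (M n)"
    and meas: "\<forall>\<^sub>F n in sequentially. X n \<in> borel_measurable (M n)"
    and bound: "\<forall>\<^sub>F n in sequentially. \<exists>B\<in>sets (M n). measure (M n) B \<le> b n \<and> (\<forall>\<omega>\<in>space (M n) - B. \<bar>X n \<omega>\<bar> \<le> K * \<bar>r n\<bar>)"
    and b: "b \<longlonglongrightarrow> 0" and K: "K > 0"
  shows "bigO_prob M X r" and "r \<longlonglongrightarrow> 0 \<Longrightarrow> smallo_prob M X (\<lambda>_. 1)"
proof -
  have tail: "\<forall>\<^sub>F n in sequentially. \<forall>t\<ge>K * \<bar>r n\<bar>. measure (M n) {\<omega> \<in> space (M n). \<bar>X n \<omega>\<bar> > t} \<le> b n"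
    using prob bound
  proof eventually_elim
    case (elim n)
    interpret prob_space "M n" by (rule elim)
    obtain B where B: "B \<in> events" "prob B \<le> b n" "\<And>\<omega>. \<omega> \<in> space (M n) - B \<Longrightarrow> \<bar>X n \<omega>\<bar> \<le> K * \<bar>r n\<bar>"
      using elim by blast
    show ?case
    proof (intro allI impI)
      fix t assume t: "K * \<bar>r n\<bar> \<le> t"
      have "prob {\<omega> \<in> space (M n). \<bar>X n \<omega>\<bar> > t} \<le> prob B"
        using B(3) t by (intro finite_measure_mono[OF _ B(1)]) force
      then show "prob {\<omega> \<in> space (M n). \<bar>X n \<omega>\<bar> > t} \<le> b n" using B(2) by linarith
    qed
  qed
  show "bigO_prob M X r"
    unfolding bigO_prob_def
  proof (intro conjI allI impI meas exI[of _ K] K)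
    fix e :: real assume "e > 0"
    then have "\<forall>\<^sub>F n in sequentially. b n < e" using b by (auto dest: order_tendstoD(2))
    with tail show "\<forall>\<^sub>F n in sequentially. measure (M n) {\<omega> \<in> space (M n). K * \<bar>r n\<bar> < \<bar>X n \<omega>\<bar>} \<le> e"
      by eventually_elim force
  qed
  assume r: "r \<longlonglongrightarrow> 0"
  show "smallo_prob M X (\<lambda>_. 1)"
    unfolding smallo_prob_def
  proof (intro conjI allI impI meas)
    fix c :: real assume c: "c > 0"
    have "(\<lambda>n. K * \<bar>r n\<bar>) \<longlonglongrightarrow> 0" using tendsto_mult_right_zero[OF tendsto_rabs_zero[OF r]] by blast
    then have "\<forall>\<^sub>F n in sequentially. K * \<bar>r n\<bar> < c" using c by (auto dest: order_tendstoD(2))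
    with tail have "\<forall>\<^sub>F n in sequentially. measure (M n) {\<omega> \<in> space (M n). c * \<bar>1\<bar> < \<bar>X n \<omega>\<bar>} \<le> b n"
      by eventually_elim (auto simp: less_imp_le)
    then show "(\<lambda>n. measure (M n) {\<omega> \<in> space (M n). c * \<bar>1\<bar> < \<bar>X n \<omega>\<bar>}) \<longlonglongrightarrow> 0"
      by (intro tendsto_sandwich[OF _ _ tendsto_const b]) auto
  qed
qed

text \<open>The rate hypothesis is the square of the first limit.  The lower bound for \<open>\<kappa> n * E n ^ 5\<close> removes
\<open>\<kappa>\<close> from it at the cost of five powers of \<open>E n\<close>.\<close>

lemma rate_consequences:
  fixes \<kappa> \<rho> :: "nat \<Rightarrow> real" and q :: real
  defines "E \<equiv> \<lambda>n. exp (\<rho> n)" and "\<eta> \<equiv> \<lambda>n. sqrt (ln (real n) / real n)"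
  assumes rate: "(\<lambda>n. (\<kappa> n)\<^sup>2 * exp (40 * \<rho> n)) \<in> o(\<lambda>n. real n / ln (real n))"
    and lower: "\<forall>\<^sub>F n in sequentially. \<rho> n \<ge> 0 \<and> \<kappa> n \<ge> 0 \<and> 1 \<le> 10 * q\<^sup>2 * (\<kappa> n * E n ^ 5)"
  shows "(\<lambda>n. \<kappa> n * E n ^ 20 * \<eta> n) \<longlonglongrightarrow> 0" and "(\<lambda>n. E n ^ 15 * \<eta> n) \<longlonglongrightarrow> 0"
proof -
  have "(\<lambda>n. ((\<kappa> n)\<^sup>2 * exp (40 * \<rho> n)) / (real n / ln (real n))) \<longlonglongrightarrow> 0"
    using rate by (rule smalloD_tendsto)
  then have "(\<lambda>n. sqrt (((\<kappa> n)\<^sup>2 * exp (40 * \<rho> n)) / (real n / ln (real n)))) \<longlonglongrightarrow> sqrt 0"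
    by (rule tendsto_real_sqrt)
  moreover have "sqrt (((\<kappa> n)\<^sup>2 * exp (40 * \<rho> n)) / (real n / ln (real n))) = \<bar>\<kappa> n * E n ^ 20 * \<eta> n\<bar>" for n
  proof -
    have "(\<kappa> n)\<^sup>2 * exp (40 * \<rho> n) = (\<kappa> n * E n ^ 20)\<^sup>2"
      using exp_of_nat_mult[of 40 "\<rho> n"] by (simp add: E_def power_mult_distrib flip: power_mult)
    then have "((\<kappa> n)\<^sup>2 * exp (40 * \<rho> n)) / (real n / ln (real n)) = (\<kappa> n * E n ^ 20)\<^sup>2 * (ln (real n) / real n)"
      by simp
    moreover have "\<eta> n \<ge> 0" by (cases "n = 0") (simp_all add: \<eta>_def)
    ultimately show ?thesis by (simp only: real_sqrt_mult real_sqrt_abs \<eta>_def abs_mult abs_of_nonneg)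
  qed
  ultimately show 1: "(\<lambda>n. \<kappa> n * E n ^ 20 * \<eta> n) \<longlonglongrightarrow> 0"
    by (simp add: tendsto_rabs_zero_iff)
  have 2: "(\<lambda>n. 10 * q\<^sup>2 * (\<kappa> n * E n ^ 20 * \<eta> n)) \<longlonglongrightarrow> 0"
    using tendsto_mult_right_zero[OF 1] by blast
  have "\<forall>\<^sub>F n in sequentially. E n ^ 15 * \<eta> n \<le> 10 * q\<^sup>2 * (\<kappa> n * E n ^ 20 * \<eta> n)"
    using lower eventually_gt_at_top[of 0]
  proof eventually_elim
    case (elim n)
    have "0 \<le> E n ^ 15 * \<eta> n" using elim by (simp add: E_def \<eta>_def)
    then have "1 * (E n ^ 15 * \<eta> n) \<le> (10 * q\<^sup>2 * (\<kappa> n * E n ^ 5)) * (E n ^ 15 * \<eta> n)"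
      using elim by (intro mult_right_mono) auto
    also have "\<dots> = 10 * q\<^sup>2 * (\<kappa> n * E n ^ 20 * \<eta> n)" by (simp add: power_numeral_reduce)
    finally show ?case by simp
  qed
  moreover have "\<forall>\<^sub>F n in sequentially. 0 \<le> E n ^ 15 * \<eta> n"
    using eventually_gt_at_top[of 0] by eventually_elim (simp add: E_def \<eta>_def)
  ultimately show "(\<lambda>n. E n ^ 15 * \<eta> n) \<longlonglongrightarrow> 0"
    by (intro tendsto_sandwich[OF _ _ tendsto_const 2]) auto
qed

theorem theorem1:
  fixes p :: nat
    and K :: "real set"
    and Z :: "nat \<Rightarrow> nat \<Rightarrow> nat \<Rightarrow> real vec"
    and \<theta>s \<gamma>s :: "nat \<Rightarrow> real vec"
    and M :: "nat \<Rightarrow> 'w measure"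
    and a :: "nat \<Rightarrow> nat \<Rightarrow> nat \<Rightarrow> 'w \<Rightarrow> nat"
    and \<epsilon>1 \<epsilon>2 \<rho> \<kappa> :: "nat \<Rightarrow> real"
  defines "\<rho> \<equiv> \<lambda>n. rho n p (Z n) (\<theta>s n) (\<gamma>s n) (\<epsilon>1 n) (\<epsilon>2 n)"
    and "obs \<equiv> \<lambda>n \<omega> i j. a n i j \<omega>"
  assumes p: "p \<ge> 1"
    and K: "compact K"
    and Z: "\<And>n i j. n \<ge> 2 \<Longrightarrow> i < n \<Longrightarrow> j < n \<Longrightarrow> i \<noteq> j \<Longrightarrow>
              Z n i j \<in> carrier_vec p \<and> (\<forall>k<p. Z n i j $ k \<in> K)"
    and \<theta>s: "\<And>n. n \<ge> 2 \<Longrightarrow> \<theta>s n \<in> carrier_vec (2 * n - 1)"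
    and \<gamma>s: "\<And>n. n \<ge> 2 \<Longrightarrow> \<gamma>s n \<in> carrier_vec p"
    and model: "\<And>n. n \<ge> 2 \<Longrightarrow> poisson_network n (Z n) (\<theta>s n) (\<gamma>s n) (M n) (a n)"
    and eps: "\<And>n. n \<ge> 2 \<Longrightarrow> \<epsilon>1 n > 0 \<and> \<epsilon>2 n > 0"
    and H_pos_def: "\<forall>\<^sub>F n in sequentially. \<forall>\<omega>\<in>space (M n).
              \<forall>\<theta>\<in>carrier_vec (2 * n - 1). \<forall>\<gamma>\<in>carrier_vec p.
                pos_def_mat (info_H n p (Z n) (obs n \<omega>) \<theta> \<gamma>)"
    and \<kappa>: "\<forall>\<^sub>F n in sequentially. \<forall>\<omega>\<in>space (M n). \<forall>\<theta>\<in>maxnorm_ball (\<theta>s n) (\<epsilon>1 n).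
              mat_maxnorm (mat_inv (info_H n p (Z n) (obs n \<omega>) \<theta> (\<gamma>s n))) \<le> \<kappa> n / (real n)\<^sup>2"
    and rate: "(\<lambda>n. (\<kappa> n)\<^sup>2 * exp (40 * \<rho> n)) \<in> o(\<lambda>n. real n / ln (real n))"
  shows "(\<exists>C. \<forall>n\<ge>2. measure (M n)
            {\<omega> \<in> space (M n). \<exists>\<theta> \<gamma>. is_mle n p (Z n) (obs n \<omega>) \<theta> \<gamma>} \<ge> 1 - C / real n)
       \<and> bigO_prob M (\<lambda>n \<omega>. vec_maxnorm (mle_gamma n p (Z n) (obs n \<omega>) - \<gamma>s n))
           (\<lambda>n. \<kappa> n * exp (21 * \<rho> n) * ln (real n) / real n)
       \<and> smallo_prob M (\<lambda>n \<omega>. vec_maxnorm (mle_gamma n p (Z n) (obs n \<omega>) - \<gamma>s n)) (\<lambda>_. 1)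
       \<and> bigO_prob M (\<lambda>n \<omega>. vec_maxnorm (mle_theta n p (Z n) (obs n \<omega>) - \<theta>s n))
           (\<lambda>n. exp (7 * \<rho> n) * sqrt (ln (real n) / real n))
       \<and> smallo_prob M (\<lambda>n \<omega>. vec_maxnorm (mle_theta n p (Z n) (obs n \<omega>) - \<theta>s n)) (\<lambda>_. 1)
       \<and> (\<forall>\<^sub>F n in sequentially. \<forall>\<omega>\<in>space (M n). \<forall>\<theta> \<gamma> \<theta>' \<gamma>'.
            is_mle n p (Z n) (obs n \<omega>) \<theta> \<gamma> \<and> is_mle n p (Z n) (obs n \<omega>) \<theta>' \<gamma>'
              \<longrightarrow> \<theta>' = \<theta> \<and> \<gamma>' = \<gamma>)"
proof -
  note \<rho>_def = assms(1) and obs_def = assms(2)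
  define E \<eta> where "E n = exp (\<rho> n)" and "\<eta> n = sqrt (ln (real n) / real n)" for n
  obtain q where q: "q \<ge> 1" "\<And>x. x \<in> K \<Longrightarrow> \<bar>x\<bar> \<le> q"
  proof -
    obtain b where "\<forall>x\<in>K. norm x \<le> b" using compact_imp_bounded[OF K] by (auto simp: bounded_iff)
    then show ?thesis using that[of "max 1 b"] by (auto simp: le_max_iff_disj)
  qed
  have prob: "prob_space (M n)" if "n \<ge> 2" for n using model[OF that] by (simp add: poisson_network_def)
  have \<rho>: "\<rho> n \<ge> 0" if n: "n \<ge> 2" for n
    unfolding \<rho>_def using n p \<gamma>s[OF n] Z[OF n] eps[OF n] by (intro rho_bounds_log_intensity(1)) auto
  have intensity_bounds: "exp (- \<rho> n) \<le> intensity n (Z n) (\<theta>s n) (\<gamma>s n) e \<and> intensity n (Z n) (\<theta>s n) (\<gamma>s n) e \<le> exp (\<rho> n)"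
    if n: "n \<ge> 2" and e: "e \<in> pairs n" for n e
  proof -
    have "\<bar>node_effect n (\<lambda>r. \<theta>s n $ r) e + (\<Sum>k<p. covariate (Z n) k e * \<gamma>s n $ k)\<bar> \<le> \<rho> n"
      unfolding \<rho>_def using n p \<gamma>s[OF n] Z[OF n] eps[OF n] e by (intro rho_bounds_log_intensity(2)) auto
    then show ?thesis using e \<gamma>s[OF n] by (simp add: intensity_exp[where p = p] abs_le_iff)
  qed
  have covq: "\<bar>covariate (Z n) k e\<bar> \<le> q" if "n \<ge> 2" "k < p" "e \<in> pairs n" for n k e
    using that Z[of n "fst e" "snd e"] by (intro q) (auto simp: covariate_def pairs_def)
  have pd: "\<forall>\<^sub>F n in sequentially. n \<ge> 3 \<and> (\<forall>\<omega>\<in>space (M n). \<forall>\<theta>\<in>carrier_vec (2 * n - 1). \<forall>\<gamma>\<in>carrier_vec p.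
                pos_def_mat (info_H n p (Z n) (obs n \<omega>) \<theta> \<gamma>))"
    using H_pos_def eventually_ge_at_top[of 3] by eventually_elim blast
  have ortho: "\<forall>\<^sub>F n in sequentially. n \<ge> 3 \<and> (\<exists>c Gi. orthogonalised_network n p (intensity n (Z n) (\<theta>s n) (\<gamma>s n)) (covariate (Z n)) c Gi (E n) q (\<kappa> n))"
    using pd \<kappa>
  proof eventually_elim
    case (elim n)
    then have n: "n \<ge> 3" "n \<ge> 2" by auto
    obtain \<omega> where \<omega>: "\<omega> \<in> space (M n)" using prob_space.not_empty[OF prob[OF n(2)]] by blast
    have "vec_maxnorm (\<theta>s n - \<theta>s n) \<le> 0"
      by (rule vec_maxnorm_le) (use \<theta>s[OF n(2)] n in auto)
    then have "\<theta>s n \<in> maxnorm_ball (\<theta>s n) (\<epsilon>1 n)"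
      using eps[OF n(2)] by (auto simp: maxnorm_ball_def)
    then have "mat_maxnorm (mat_inv (info_H n p (Z n) (obs n \<omega>) (\<theta>s n) (\<gamma>s n))) \<le> \<kappa> n / (real n)\<^sup>2"
      and "pos_def_mat (info_H n p (Z n) (obs n \<omega>) (\<theta>s n) (\<gamma>s n))"
      using elim \<omega> \<theta>s[OF n(2)] \<gamma>s[OF n(2)] by auto
    then have "\<exists>c Gi. orthogonalised_network n p (intensity n (Z n) (\<theta>s n) (\<gamma>s n)) (covariate (Z n)) c Gi (exp (\<rho> n)) q (\<kappa> n)"
      using n p q(1) \<theta>s[OF n(2)] \<gamma>s[OF n(2)] intensity_bounds[OF n(2)] \<rho>[OF n(2)] covq[OF n(2)]
      by (intro orthogonalised_networkI[where A = "obs n \<omega>"]) auto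
    then show ?case using n by (simp add: E_def)
  qed
  have lower: "\<forall>\<^sub>F n in sequentially. \<rho> n \<ge> 0 \<and> \<kappa> n \<ge> 0 \<and> 1 \<le> 10 * q\<^sup>2 * (\<kappa> n * exp (\<rho> n) ^ 5)"
    using ortho
  proof eventually_elim
    case (elim n)
    then obtain c Gi where "orthogonalised_network n p (intensity n (Z n) (\<theta>s n) (\<gamma>s n)) (covariate (Z n)) c Gi (E n) q (\<kappa> n)" by blast
    then show ?case
      using orthogonalised_network.kappa_nonneg orthogonalised_network.kappa_lower_bound \<rho>[of n] elim
      by (fastforce simp: E_def)
  qed
  have lim1: "(\<lambda>n. \<kappa> n * E n ^ 20 * \<eta> n) \<longlonglongrightarrow> 0" and lim2: "(\<lambda>n. E n ^ 15 * \<eta> n) \<longlonglongrightarrow> 0"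
    using rate_consequences[OF rate lower] by (simp_all add: E_def \<eta>_def)
  have E1: "E n \<ge> 1" if "n \<ge> 2" for n using \<rho>[OF that] by (simp add: E_def)
  have \<eta>0: "\<eta> n \<ge> 0" if "n \<ge> 2" for n using that by (simp add: \<eta>_def)
  define bad where "bad n = (4 + 2 * real p) / real n" for n
  define r\<gamma> r\<theta> where "r\<gamma> n = \<kappa> n * exp (21 * \<rho> n) * ln (real n) / real n"
    and "r\<theta> n = exp (7 * \<rho> n) * sqrt (ln (real n) / real n)" for n
  have r\<gamma>: "r\<gamma> n = \<kappa> n * E n ^ 21 * (\<eta> n)\<^sup>2" if "n \<ge> 2" for n
    using that exp_of_nat_mult[of 21 "\<rho> n"] by (simp add: r\<gamma>_def E_def \<eta>_def)
  have r\<theta>: "r\<theta> n = E n ^ 7 * \<eta> n" for n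
    using exp_of_nat_mult[of 7 "\<rho> n"] by (simp add: r\<theta>_def E_def \<eta>_def)
  define near where "near n \<omega> \<theta> \<gamma> \<longleftrightarrow> is_mle n p (Z n) (obs n \<omega>) \<theta> \<gamma> \<and>
      vec_maxnorm (\<gamma> - \<gamma>s n) \<in> {0..10 ^ 5 * q * r\<gamma> n} \<and> vec_maxnorm (\<theta> - \<theta>s n) \<in> {0..165 * r\<theta> n}" for n \<omega> \<theta> \<gamma>
  \<comment> \<open>the threshold in the two smallness conditions of the fixed point argument\<close>
  define \<delta> where "\<delta> = 1 / (10 ^ 5 * real p * q\<^sup>2)"
  have \<delta>: "\<delta> > 0" using p q(1) by (simp add: \<delta>_def)
  have exists_near: "\<forall>\<^sub>F n in sequentially. \<exists>B\<in>sets (M n). measure (M n) B \<le> bad n \<and>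
      (\<forall>\<omega>\<in>space (M n) - B. \<exists>\<theta> \<gamma>. near n \<omega> \<theta> \<gamma>)"
    using ortho lower order_tendstoD(2)[OF lim1 \<delta>] order_tendstoD(2)[OF lim2 \<delta>]
  proof eventually_elim
    case (elim n)
    then have n: "n \<ge> 2" by auto
    note E = E1[OF n] and \<eta> = \<eta>0[OF n]
    obtain c Gi where net: "orthogonalised_network n p (intensity n (Z n) (\<theta>s n) (\<gamma>s n)) (covariate (Z n)) c Gi (E n) q (\<kappa> n)"
      using elim by blast
    have "E n ^ 8 * \<eta> n \<le> E n ^ 15 * \<eta> n" using E \<eta> by (intro mult_right_mono power_increasing) auto
    then have small1: "E n ^ 8 * \<eta> n \<le> \<delta>" using elim by linarith
    have "\<kappa> n * E n ^ 13 * \<eta> n \<le> \<kappa> n * E n ^ 20 * \<eta> n"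
      using E \<eta> elim by (intro mult_right_mono mult_left_mono power_increasing) auto
    then have small2: "\<kappa> n * E n ^ 13 * \<eta> n \<le> \<delta>" using elim by linarith
    have b\<gamma>: "10 ^ 5 * q * (\<kappa> n * E n ^ 13 * (\<eta> n)\<^sup>2) \<le> 10 ^ 5 * q * r\<gamma> n"
      unfolding r\<gamma>[OF n] using E elim q(1) by (intro mult_left_mono mult_right_mono power_increasing) auto
    have b\<theta>: "165 * (E n ^ 4 * \<eta> n) \<le> 165 * r\<theta> n"
      unfolding r\<theta> using E \<eta> by (intro mult_left_mono mult_right_mono power_increasing) auto
    obtain B where B: "B \<in> sets (M n)" "measure (M n) B \<le> bad n" and
      good: "\<And>\<omega>. \<omega> \<in> space (M n) - B \<Longrightarrow> \<exists>\<theta> \<gamma>. is_mle n p (Z n) (\<lambda>i j. a n i j \<omega>) \<theta> \<gamma> \<and>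
        (\<forall>k<p. \<bar>\<gamma> $ k - \<gamma>s n $ k\<bar> \<le> 10 ^ 5 * q * (\<kappa> n * E n ^ 13 * (\<eta> n)\<^sup>2)) \<and>
        (\<forall>r<2 * n - 1. \<bar>\<theta> $ r - \<theta>s n $ r\<bar> \<le> 165 * (E n ^ 4 * \<eta> n))"
      using mle_exists_near_truth[OF model[OF n] net \<theta>s[OF n] \<gamma>s[OF n] \<eta>_def small1[unfolded \<delta>_def] small2[unfolded \<delta>_def]]
      unfolding bad_def by blast
    have "\<exists>\<theta> \<gamma>. near n \<omega> \<theta> \<gamma>" if \<omega>: "\<omega> \<in> space (M n) - B" for \<omega>
    proof -
      obtain \<theta> \<gamma> where mle: "is_mle n p (Z n) (obs n \<omega>) \<theta> \<gamma>"
        and \<gamma>b: "\<And>k. k < p \<Longrightarrow> \<bar>\<gamma> $ k - \<gamma>s n $ k\<bar> \<le> 10 ^ 5 * q * r\<gamma> n"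
        and \<theta>b: "\<And>r. r < 2 * n - 1 \<Longrightarrow> \<bar>\<theta> $ r - \<theta>s n $ r\<bar> \<le> 165 * r\<theta> n"
        using good[OF \<omega>] b\<gamma> b\<theta> unfolding obs_def by (meson order_trans)
      have d: "dim_vec (\<gamma>s n) = p" "dim_vec (\<theta>s n) = 2 * n - 1" using \<gamma>s[OF n] \<theta>s[OF n] by auto
      have "vec_maxnorm (\<gamma> - \<gamma>s n) \<le> 10 ^ 5 * q * r\<gamma> n"
        by (rule vec_maxnorm_le) (use d p \<gamma>b in auto)
      moreover have "vec_maxnorm (\<theta> - \<theta>s n) \<le> 165 * r\<theta> n"
        by (rule vec_maxnorm_le) (use d n \<theta>b in auto)
      moreover have "vec_maxnorm (\<gamma> - \<gamma>s n) \<ge> 0" "vec_maxnorm (\<theta> - \<theta>s n) \<ge> 0"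
        using vec_maxnorm_ge[of 0 "\<gamma> - \<gamma>s n"] vec_maxnorm_ge[of 0 "\<theta> - \<theta>s n"] d p n by force+
      ultimately show ?thesis using mle unfolding near_def by auto
    qed
    then show ?case using B by blast
  qed
  have meas: "(\<lambda>\<omega>. f (is_mle n p (Z n) (obs n \<omega>))) \<in> measurable (M n) N" if n: "n \<ge> 2" and N: "space N = UNIV"
    for n N and f :: "(real vec \<Rightarrow> real vec \<Rightarrow> bool) \<Rightarrow> 'x"
  proof -
    interpret prob_space "M n" by (rule prob[OF n])
    have X: "(\<lambda>\<omega>. a n (fst e) (snd e) \<omega>) \<in> measurable (M n) (count_space UNIV)" if e: "e \<in> pairs n" for e
    proof -
      have "\<forall>e\<in>pairs n. (case e of (i, j) \<Rightarrow> a n i j) \<in> measurable (M n) (count_space UNIV)"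
        using model[OF n] by (simp add: poisson_network_def indep_vars_def pairs_def)
      then show ?thesis using e by (force simp: case_prod_beta)
    qed
    have "(\<lambda>\<omega>. (\<lambda>x. f (is_mle n p (Z n) (\<lambda>i j. x (i, j)))) (\<lambda>e. a n (fst e) (snd e) \<omega>)) \<in> measurable (M n) N"
    proof (rule measurable_finitely_determined[OF finite_pairs X _ N])
      show "f (is_mle n p (Z n) (\<lambda>i j. x (i, j))) = f (is_mle n p (Z n) (\<lambda>i j. y (i, j)))"
        if "\<And>e. e \<in> pairs n \<Longrightarrow> x e = y e" for x y
        using that by (intro arg_cong[where f = f] is_mle_cong) (simp add: weight_def)
    qed
    then show ?thesis by (simp add: obs_def)
  qed
  have uniq: "\<forall>\<^sub>F n in sequentially. \<forall>\<omega>\<in>space (M n). \<forall>\<theta> \<gamma> \<theta>' \<gamma>'.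
            is_mle n p (Z n) (obs n \<omega>) \<theta> \<gamma> \<and> is_mle n p (Z n) (obs n \<omega>) \<theta>' \<gamma>' \<longrightarrow> \<theta>' = \<theta> \<and> \<gamma>' = \<gamma>"
    using pd
  proof eventually_elim
    case (elim n)
    then show ?case by (meson is_mle_unique is_mle_def)
  qed
  have mle_near: "\<forall>\<^sub>F n in sequentially. \<exists>B\<in>sets (M n). measure (M n) B \<le> bad n \<and>
      (\<forall>\<omega>\<in>space (M n) - B. near n \<omega> (mle_theta n p (Z n) (obs n \<omega>)) (mle_gamma n p (Z n) (obs n \<omega>)))"
    using exists_near pd
  proof eventually_elim
    case (elim n)
    have "near n \<omega> (mle_theta n p (Z n) (obs n \<omega>)) (mle_gamma n p (Z n) (obs n \<omega>))"
      if "near n \<omega> \<theta> \<gamma>" "\<omega> \<in> space (M n)" for \<omega> \<theta> \<gamma>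
    proof -
      have mle: "is_mle n p (Z n) (obs n \<omega>) \<theta> \<gamma>" using that by (simp add: near_def)
      have "pos_def_mat (info_H n p (Z n) (obs n \<omega>) \<theta> \<gamma>)"
        using elim mle that unfolding is_mle_def by blast
      then show ?thesis using mle_eq[OF _ mle] elim that by simp
    qed
    then show ?case using elim by blast
  qed
  have bad0: "bad \<longlonglongrightarrow> 0" unfolding bad_def by real_asymp
  have ev_prob: "\<forall>\<^sub>F n in sequentially. prob_space (M n)"
    using eventually_ge_at_top[of 2] by eventually_elim (rule prob)
  have meas\<gamma>: "\<forall>\<^sub>F n in sequentially. (\<lambda>\<omega>. vec_maxnorm (mle_gamma n p (Z n) (obs n \<omega>) - \<gamma>s n)) \<in> borel_measurable (M n)"
    using eventually_ge_at_top[of 2]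
  proof eventually_elim
    case (elim n)
    show ?case
      using meas[OF elim, of borel "\<lambda>P. vec_maxnorm (snd (SOME (\<theta>, \<gamma>). P \<theta> \<gamma>) - \<gamma>s n)"]
      by (simp add: mle_gamma_def mle_def)
  qed
  have meas\<theta>: "\<forall>\<^sub>F n in sequentially. (\<lambda>\<omega>. vec_maxnorm (mle_theta n p (Z n) (obs n \<omega>) - \<theta>s n)) \<in> borel_measurable (M n)"
    using eventually_ge_at_top[of 2]
  proof eventually_elim
    case (elim n)
    show ?case
      using meas[OF elim, of borel "\<lambda>P. vec_maxnorm (fst (SOME (\<theta>, \<gamma>). P \<theta> \<gamma>) - \<theta>s n)"]
      by (simp add: mle_theta_def mle_def)
  qed
  have bound\<gamma>: "\<forall>\<^sub>F n in sequentially. \<exists>B\<in>sets (M n). measure (M n) B \<le> bad n \<and>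
      (\<forall>\<omega>\<in>space (M n) - B. \<bar>vec_maxnorm (mle_gamma n p (Z n) (obs n \<omega>) - \<gamma>s n)\<bar> \<le> 10 ^ 5 * q * \<bar>r\<gamma> n\<bar>)"
    using mle_near
  proof eventually_elim
    case (elim n)
    have "10 ^ 5 * q * r\<gamma> n \<le> 10 ^ 5 * q * \<bar>r\<gamma> n\<bar>" using q(1) by (intro mult_left_mono) auto
    then have "\<bar>vec_maxnorm (\<gamma> - \<gamma>s n)\<bar> \<le> 10 ^ 5 * q * \<bar>r\<gamma> n\<bar>" if "near n \<omega> \<theta> \<gamma>" for \<omega> \<theta> \<gamma>
      using that by (auto simp: near_def)
    then show ?case using elim by meson
  qed
  have bound\<theta>: "\<forall>\<^sub>F n in sequentially. \<exists>B\<in>sets (M n). measure (M n) B \<le> bad n \<and>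
      (\<forall>\<omega>\<in>space (M n) - B. \<bar>vec_maxnorm (mle_theta n p (Z n) (obs n \<omega>) - \<theta>s n)\<bar> \<le> 165 * \<bar>r\<theta> n\<bar>)"
    using mle_near
  proof eventually_elim
    case (elim n)
    have "\<bar>vec_maxnorm (\<theta> - \<theta>s n)\<bar> \<le> 165 * \<bar>r\<theta> n\<bar>" if "near n \<omega> \<theta> \<gamma>" for \<omega> \<theta> \<gamma>
      using that by (auto simp: near_def)
    then show ?case using elim by meson
  qed
  have r\<theta>0: "r\<theta> \<longlonglongrightarrow> 0"
  proof (rule tendsto_sandwich[OF _ _ tendsto_const lim2])
    show "\<forall>\<^sub>F n in sequentially. 0 \<le> r\<theta> n"
      using eventually_ge_at_top[of 2] by eventually_elim (simp add: r\<theta>_def)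
    show "\<forall>\<^sub>F n in sequentially. r\<theta> n \<le> E n ^ 15 * \<eta> n"
      using eventually_ge_at_top[of 2]
      by eventually_elim (auto simp: r\<theta> intro!: mult_right_mono power_increasing E1 \<eta>0)
  qed
  have r\<gamma>0: "r\<gamma> \<longlonglongrightarrow> 0"
  proof (rule tendsto_sandwich[OF _ _ tendsto_const tendsto_mult_zero[OF lim1 lim2]])
    show "\<forall>\<^sub>F n in sequentially. 0 \<le> r\<gamma> n"
      using lower eventually_ge_at_top[of 2] by eventually_elim (auto simp: r\<gamma>_def)
    show "\<forall>\<^sub>F n in sequentially. r\<gamma> n \<le> \<kappa> n * E n ^ 20 * \<eta> n * (E n ^ 15 * \<eta> n)"
      using lower eventually_ge_at_top[of 2]
    proof eventually_elim
      case (elim n)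
      have "r\<gamma> n = \<kappa> n * E n ^ 20 * \<eta> n * (E n ^ 1 * \<eta> n)"
        unfolding r\<gamma>[OF elim(2)] by (simp add: power2_eq_square power_numeral_reduce)
      also have "\<dots> \<le> \<kappa> n * E n ^ 20 * \<eta> n * (E n ^ 15 * \<eta> n)"
        using E1[OF elim(2)] \<eta>0[OF elim(2)] elim by (intro mult_left_mono mult_right_mono power_increasing) auto
      finally show ?case .
    qed
  qed
  have existence: "\<exists>C. \<forall>n\<ge>2. measure (M n)
            {\<omega> \<in> space (M n). \<exists>\<theta> \<gamma>. is_mle n p (Z n) (obs n \<omega>) \<theta> \<gamma>} \<ge> 1 - C / real n"
  proof -
    \<comment> \<open>adding \<open>N\<close> to the constant makes the bound negative, hence trivial, for the finitely many \<open>n < N\<close>\<close>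
    obtain N where N: "\<And>n. n \<ge> N \<Longrightarrow> \<exists>B\<in>sets (M n). measure (M n) B \<le> bad n \<and>
      (\<forall>\<omega>\<in>space (M n) - B. \<exists>\<theta> \<gamma>. near n \<omega> \<theta> \<gamma>)"
      using exists_near unfolding eventually_sequentially by blast
    have "measure (M n) {\<omega> \<in> space (M n). \<exists>\<theta> \<gamma>. is_mle n p (Z n) (obs n \<omega>) \<theta> \<gamma>} \<ge> 1 - (real N + (4 + 2 * real p)) / real n"
      if n: "n \<ge> 2" for n
    proof (cases "n \<ge> N")
      case False
      then have "1 \<le> (real N + (4 + 2 * real p)) / real n" using n by (simp add: field_simps)
      then show ?thesis using measure_nonneg[of "M n"] by (smt (verit))
    next
      case True
      interpret prob_space "M n" by (rule prob[OF n])
      obtain B where B: "B \<in> events" "prob B \<le> bad n" "\<And>\<omega>. \<omega> \<in> space (M n) - B \<Longrightarrow> \<exists>\<theta> \<gamma>. near n \<omega> \<theta> \<gamma>"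
        using N[OF True] by blast
      let ?S = "{\<omega> \<in> space (M n). \<exists>\<theta> \<gamma>. is_mle n p (Z n) (obs n \<omega>) \<theta> \<gamma>}"
      have "?S \<in> events"
        using meas[OF n, of "count_space UNIV" "\<lambda>P. \<exists>\<theta> \<gamma>. P \<theta> \<gamma>"] by (simp add: pred_def)
      moreover have "space (M n) - B \<subseteq> ?S" using B(3) unfolding near_def by blast
      ultimately have "prob (space (M n) - B) \<le> prob ?S" by (intro finite_measure_mono)
      moreover have "prob (space (M n) - B) = 1 - prob B" using B(1) by (rule prob_compl)
      moreover have "bad n \<le> (real N + (4 + 2 * real p)) / real n"
        unfolding bad_def by (intro divide_right_mono) auto
      ultimately show ?thesis using B(2) by linarith
    qed
    then show ?thesis by blast
  qed
  have K: "10 ^ 5 * q > 0" using q(1) by simp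
  show ?thesis
    using existence uniq
      stochastic_order_symbols[OF ev_prob meas\<gamma> bound\<gamma> bad0 K] r\<gamma>0
      stochastic_order_symbols[OF ev_prob meas\<theta> bound\<theta> bad0] r\<theta>0
    unfolding r\<gamma>_def[abs_def, symmetric] r\<theta>_def[abs_def, symmetric] by auto
qed

end
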